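(* Let $(0,\ell)\subset\mathbb R$ be a bounded interval and let $0<a\le b<\infty$. Let $m,n\in L^\infty(\mathbb R)$ be $\ell$-periodic functions with $a\le m(x),n(x)\le b$, and set $m_\varepsilon(x)=m(x/\varepsilon)$, $n_\varepsilon(x)=n(x/\varepsilon)$ for $\varepsilon>0$, and $$m_0=\frac1\ell\int_0^\ell m(x)\,dx,\qquad n_0=\frac1\ell\int_0^\ell n(x)\,dx .$$ Then for every $k\in\mathbb N$, every $t>0$, every $\varepsilon>0$ and each choice of sign $\pm$, $$|\lambda_{k,t,\varepsilon}^\pm-\lambda_{k,t,0}^\pm|\le C\left(\frac k\ell\right)^3\gamma(t)\,\varepsilon,$$ where $C$ depends only on the constants $a,b$, and $\gamma(t)=\max\{t^{-3/2},t^{1/2}\}$.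
   Context: Write $u^\pm=\max\{0,\pm u\}$. For $\varepsilon\ge0$ and $(\alpha,\beta)\in\mathbb R^2_+$, problem $(P_\varepsilon)$ is $$-u''=\alpha\,m_\varepsilon(x)u^+-\beta\,n_\varepsilon(x)u^-\ \text{ in }(0,\ell),\qquad u(0)=u(\ell)=0,$$ understood weakly: $u\in H^1_0([0,\ell])$ and $\int_0^\ell u'v'\,dx=\int_0^\ell(\alpha m_\varepsilon u^+-\beta n_\varepsilon u^-)v\,dx$ for all $v\in H^1_0([0,\ell])$. For $\varepsilon=0$ the weights are the constants $m_0,n_0$. For $k\ge1$, $\mathcal C_{k,\varepsilon}^+$ (resp. $\mathcal C_{k,\varepsilon}^-$) is the curve of pairs $(\alpha,\beta)$ for which $(P_\varepsilon)$ has a nontrivial solution with $k$ zeros in the open interval $(0,\ell)$ and positive (resp. negative) slope at the origin. For each $t>0$, $\varepsilon\ge0$, $k\ge1$ and sign $\pm$ there is a unique real number $\lambda_{k,t,\varepsilon}^\pm$ such that $(\lambda_{k,t,\varepsilon}^\pm,\,t\lambda_{k,t,\varepsilon}^\pm)\in\mathcal C_{k,\varepsilon}^\pm$; this defines $\lambda_{k,t,\varepsilon}^\pm$.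
   Formalization: The bound is proved with Cℓ in place of C (C depending only on a, b, uniform in ℓ); with ℓ-periodic weights the stated bound with C independent of ℓ fails by scaling as ℓ→∞ when a<b. *)

theory Defs
  imports "HOL-Analysis.Analysis"
begin

definition pos_part :: "real \<Rightarrow> real" where
  "pos_part r = max 0 r"

definition neg_part :: "real \<Rightarrow> real" where
  "neg_part r = max 0 (- r)"

definition square_integrable :: "real \<Rightarrow> (real \<Rightarrow> real) \<Rightarrow> bool" where
  "square_integrable l f \<longleftrightarrow>
     set_borel_measurable lebesgue {0<..<l} f \<and>
     set_integrable lebesgue {0<..<l} (\<lambda>x. (f x)\<^sup>2)"

definition test_function :: "real \<Rightarrow> (real \<Rightarrow> real) \<Rightarrow> (real \<Rightarrow> real) \<Rightarrow> bool" where
  "test_function l \<phi> \<phi>' \<longleftrightarrow>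
     (\<forall>x. (\<phi> has_real_derivative \<phi>' x) (at x)) \<and> continuous_on UNIV \<phi>' \<and>
     (\<exists>c d. 0 < c \<and> d < l \<and> (\<forall>x. x \<notin> {c..d} \<longrightarrow> \<phi> x = 0))"

text \<open>
  \<open>weak_derivative l u g\<close>: \<open>g\<close> is the weak derivative of \<open>u\<close> on \<open>(0, l)\<close>, tested
  against continuously differentiable functions with compact support in \<open>(0, l)\<close>.
\<close>

definition weak_derivative :: "real \<Rightarrow> (real \<Rightarrow> real) \<Rightarrow> (real \<Rightarrow> real) \<Rightarrow> bool" where
  "weak_derivative l u g \<longleftrightarrow>
     (\<forall>\<phi> \<phi>'. test_function l \<phi> \<phi>' \<longrightarrow>
        (LINT x:{0<..<l}|lebesgue. u x * \<phi>' x) = - (LINT x:{0<..<l}|lebesgue. g x * \<phi> x))"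

text \<open>
  The Sobolev space \<open>H\<^sup>1\<close> on \<open>(0, l)\<close> with zero boundary values; the second function is the
  weak derivative of the first.  As usual in dimension one, an element is identified with
  its representative that is continuous on \<open>[0, l]\<close>, so that boundary values, zeros and
  slopes are meaningful.  Values outside \<open>[0, l]\<close> are irrelevant.
\<close>

definition H10 :: "real \<Rightarrow> (real \<Rightarrow> real) \<Rightarrow> (real \<Rightarrow> real) \<Rightarrow> bool" where
  "H10 l u u' \<longleftrightarrow>
     continuous_on {0..l} u \<and> square_integrable l u \<and> square_integrable l u' \<and>
     weak_derivative l u u' \<and> u 0 = 0 \<and> u l = 0"

definition weak_solution ::
  "real \<Rightarrow> (real \<Rightarrow> real) \<Rightarrow> (real \<Rightarrow> real) \<Rightarrow> real \<Rightarrow> real \<Rightarrow> (real \<Rightarrow> real) \<Rightarrow> bool" where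
  "weak_solution l M N \<alpha> \<beta> u \<longleftrightarrow>
     (\<exists>u'. H10 l u u' \<and>
       (\<forall>v v'. H10 l v v' \<longrightarrow>
          (LINT x:{0<..<l}|lebesgue. u' x * v' x) =
          (LINT x:{0<..<l}|lebesgue.
             (\<alpha> * M x * pos_part (u x) - \<beta> * N x * neg_part (u x)) * v x)))"

text \<open>
  The sign \<open>s = 1\<close> selects positive and \<open>s = -1\<close> negative slope at the origin.
\<close>

definition fucik_curve ::
  "real \<Rightarrow> (real \<Rightarrow> real) \<Rightarrow> (real \<Rightarrow> real) \<Rightarrow> nat \<Rightarrow> real \<Rightarrow> (real \<times> real) set" where
  "fucik_curve l M N k s =
     {(\<alpha>, \<beta>). 0 \<le> \<alpha> \<and> 0 \<le> \<beta> \<and>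
        (\<exists>u. weak_solution l M N \<alpha> \<beta> u \<and> (\<exists>x\<in>{0..l}. u x \<noteq> 0) \<and>
             finite {x \<in> {0<..<l}. u x = 0} \<and> card {x \<in> {0<..<l}. u x = 0} = k \<and>
             (\<exists>d. (u has_real_derivative d) (at 0 within {0..l}) \<and> 0 < s * d))}"

text \<open>
  The oscillating weight \<open>w(x / \<epsilon>)\<close>, and for \<open>\<epsilon> = 0\<close> its homogenised constant, the mean over
  a period.  For an \<open>l\<close>-periodic \<open>w\<close> the period of \<open>weight l w \<epsilon>\<close> is \<open>\<epsilon> * l\<close>, not \<open>\<epsilon>\<close>.
\<close>

definition weight :: "real \<Rightarrow> (real \<Rightarrow> real) \<Rightarrow> real \<Rightarrow> real \<Rightarrow> real" where
  "weight l w \<epsilon> x =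
     (if \<epsilon> = 0 then (1 / l) * (LINT y:{0<..<l}|lebesgue. w y) else w (x / \<epsilon>))"

definition fucik_lambda ::
  "real \<Rightarrow> (real \<Rightarrow> real) \<Rightarrow> (real \<Rightarrow> real) \<Rightarrow> nat \<Rightarrow> real \<Rightarrow> real \<Rightarrow> real \<Rightarrow> real" where
  "fucik_lambda l m n k t \<epsilon> s =
     (THE \<mu>. (\<mu>, t * \<mu>) \<in> fucik_curve l (weight l m \<epsilon>) (weight l n \<epsilon>) k s)"

definition gamma_fun :: "real \<Rightarrow> real" where
  "gamma_fun t = max (t powr (- 3 / 2)) (t powr (1 / 2))"

text \<open>
  Membership in \<open>L\<^sup>\<infinity>\<close> of the line, \<open>l\<close>-periodicity and the bounds \<open>a \<le> w \<le> b\<close> (which imply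
  essential boundedness), all for functions up to null sets.
\<close>

definition admissible_weight :: "real \<Rightarrow> real \<Rightarrow> real \<Rightarrow> (real \<Rightarrow> real) \<Rightarrow> bool" where
  "admissible_weight l a b w \<longleftrightarrow>
     w \<in> borel_measurable lebesgue \<and>
     (AE x in lebesgue. w (x + l) = w x) \<and>
     (AE x in lebesgue. a \<le> w x \<and> w x \<le> b)"

end

theory Submission
  imports Defs
begin

text \<open>
  Between consecutive zeros a solution is, up to sign, a positive Dirichlet eigenfunction of
  \<open>- u'' = \<Lambda> w u\<close> with \<open>(w, \<Lambda>) = (m, \<mu>)\<close> or \<open>(n, t \<mu>)\<close>.  Given two solutions with the same
  number of zeros and the same initial sign, some nodal interval of the first lies inside the nodal
  interval of the second with the same index.  By Picone's argument the hump \<open>\<phi>\<close> of the first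
  solution is an admissible test function for the eigenvalue of the second, so
  \<open>\<Lambda>\<^sub>2 \<integral> w\<^sub>2 \<phi>\<^sup>2 \<le> \<integral> \<phi>'\<^sup>2 = \<Lambda>\<^sub>1 \<integral> w\<^sub>1 \<phi>\<^sup>2\<close>; integrating \<open>(w\<^sub>1 - w\<^sub>2) \<phi>\<^sup>2\<close> by parts against the
  bounded primitive of \<open>w\<^sub>1 - w\<^sub>2\<close>, which is \<open>O(\<epsilon> l)\<close> for periodic oscillation, gives
  \<open>\<Lambda>\<^sub>2 - \<Lambda>\<^sub>1 = O(\<epsilon> l \<Lambda>\<^sub>1\<^bsup>3/2\<^esup>)\<close>.  Equal weights give uniqueness of \<open>\<lambda>\<close>; existence is a shooting argument
  for the Pruefer angle; and \<open>\<lambda>\<close> is bounded by summing the lengths of the nodal intervals.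
\<close>

section \<open>Indefinite integrals\<close>

text \<open>The weights are merely bounded and measurable, so a solution has a second derivative
  only almost everywhere. All calculus is therefore done with pairs \<open>ac_on c d f f'\<close>,
  in which the density \<open>f'\<close> is part of the data, and the equation becomes a first-order
  system for \<open>u\<close> and its continuous derivative \<open>p\<close>. The nodal intervals of
  two solutions need not coincide, and a nested pair bounds \<open>\<mu>2 - \<mu>1\<close> from one
  side only. The opposite bound comes from exchanging the roles of the solutions, possibly on a
  different nodal interval. Nothing is known about the parity of the index found, so the estimate
  must survive whether the interval carries \<open>m\<close> or \<open>n\<close>. This produces
  \<open>gamma_fun\<close>: an interval with weight \<open>n\<close> costs a factor
  \<open>sqrt t\<close>, while a bound on \<open>sqrt \<mu>\<close> obtained from such intervals
  costs \<open>1 / sqrt t\<close>, which enters cubed. Since \<open>fucik_lambda\<close> is a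
  definite description, existence and uniqueness on the curve are needed before any estimate speaks
  about it.\<close>

definition ac_on :: "real \<Rightarrow> real \<Rightarrow> (real \<Rightarrow> real) \<Rightarrow> (real \<Rightarrow> real) \<Rightarrow> bool" where
  "ac_on c d f f' \<longleftrightarrow> f' absolutely_integrable_on {c..d} \<and>
     (\<forall>x\<in>{c..d}. f x = f c + integral {c..x} f')"

lemma ac_on_abs_integrable: "ac_on c d f f' \<Longrightarrow> f' absolutely_integrable_on {c..d}"
  by (simp add: ac_on_def)

lemma ac_on_eq: "ac_on c d f f' \<Longrightarrow> x \<in> {c..d} \<Longrightarrow> f x = f c + integral {c..x} f'"
  unfolding ac_on_def by blast

lemma abs_integrable_sub:
  fixes f :: "real \<Rightarrow> real"
  assumes "f absolutely_integrable_on {c..d}" "c \<le> x" "y \<le> d"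
  shows "f absolutely_integrable_on {x..y}"
  using absolutely_integrable_on_subinterval[OF assms(1)] assms(2,3) by auto

lemma ac_on_integrable:
  assumes "ac_on c d f f'" "c \<le> x" "y \<le> d"
  shows "f' integrable_on {x..y}"
  by (rule set_lebesgue_integral_eq_integral(1)[OF abs_integrable_sub[OF ac_on_abs_integrable[OF assms(1)] assms(2,3)]])

lemma ac_on_diff:
  assumes "ac_on c d f f'" "c \<le> x" "x \<le> y" "y \<le> d"
  shows "f y - f x = integral {x..y} f'"
proof -
  have "f x = f c + integral {c..x} f'" "f y = f c + integral {c..y} f'"
    by (rule ac_on_eq[OF assms(1)], use assms in simp)+
  moreover have "integral {c..x} f' + integral {x..y} f' = integral {c..y} f'"
    by (rule Henstock_Kurzweil_Integration.integral_combine[OF assms(2,3) ac_on_integrable[OF assms(1) order_refl assms(4)]])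
  ultimately show ?thesis by simp
qed

lemma ac_on_continuous:
  assumes "ac_on c d f f'"
  shows "continuous_on {c..d} f"
proof (cases "c \<le> d")
  case True
  have "f' integrable_on {c..d}" using ac_on_integrable[OF assms] by simp
  then have "continuous_on {c..d} (\<lambda>x. f c + integral {c..x} f')"
    by (intro continuous_intros indefinite_integral_continuous_1)
  then show ?thesis
    by (rule continuous_on_eq) (rule ac_on_eq[OF assms, symmetric])
qed auto

lemma ac_on_sub:
  assumes "ac_on c d f f'" "c \<le> x" "y \<le> d"
  shows "ac_on x y f f'"
  unfolding ac_on_def
proof (intro conjI ballI)
  show "f' absolutely_integrable_on {x..y}"
    by (rule abs_integrable_sub[OF ac_on_abs_integrable[OF assms(1)] assms(2,3)])
  fix z assume "z \<in> {x..y}"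
  then show "f z = f x + integral {x..z} f'"
    using ac_on_diff[OF assms(1), of x z] assms by auto
qed

text \<open>
  The product and chain rules below follow by checking that the defect on \<open>[x, y]\<close> is of higher
  order than \<open>y - x\<close>; this avoids almost everywhere differentiability of indefinite integrals.
\<close>

lemma constant_if_superlinear_increments:
  fixes H F :: "real \<Rightarrow> real"
  assumes F: "continuous_on {c..d} F"
    and H: "\<And>x y. c \<le> x \<Longrightarrow> x \<le> y \<Longrightarrow> y \<le> d \<Longrightarrow> \<bar>H y - H x\<bar> \<le> (y - x) * (F y - F x)"
    and "x \<in> {c..d}"
  shows "H x = H c"
proof -
  have D: "(H has_derivative (\<lambda>h. 0)) (at z within {c..d})" if z: "z \<in> {c..d}" for z
  proof -
  have "(H has_real_derivative 0) (at z within {c..d})"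
    unfolding has_field_derivative_iff
  proof (rule Lim_null_comparison)
    have "(F \<longlongrightarrow> F z) (at z within {c..d})"
      using F z by (simp add: continuous_on_def)
    then show "((\<lambda>y. \<bar>F y - F z\<bar>) \<longlongrightarrow> 0) (at z within {c..d})"
      by (auto intro!: tendsto_rabs_zero simp: LIM_zero)
    show "\<forall>\<^sub>F y in at z within {c..d}. norm ((H y - H z) / (y - z)) \<le> \<bar>F y - F z\<bar>"
      unfolding eventually_at
    proof (intro exI[of _ 1] conjI ballI impI)
      fix y assume y: "y \<in> {c..d}" "y \<noteq> z \<and> dist y z < 1"
      have "\<bar>H y - H z\<bar> \<le> \<bar>y - z\<bar> * \<bar>F y - F z\<bar>"
      proof (cases "z \<le> y")
        case True
        have "\<bar>H y - H z\<bar> \<le> (y - z) * (F y - F z)" using H[of z y] y z True by auto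
        also have "\<dots> \<le> \<bar>y - z\<bar> * \<bar>F y - F z\<bar>" by (metis abs_ge_self abs_mult)
        finally show ?thesis .
      next
        case False
        have "\<bar>H y - H z\<bar> \<le> (z - y) * (F z - F y)" using H[of y z] y z False by auto
        also have "\<dots> = (y - z) * (F y - F z)" by (simp add: algebra_simps)
        also have "\<dots> \<le> \<bar>y - z\<bar> * \<bar>F y - F z\<bar>" by (metis abs_ge_self abs_mult)
        finally show ?thesis .
      qed
      then show "norm ((H y - H z) / (y - z)) \<le> \<bar>F y - F z\<bar>"
        using y by (simp add: field_simps abs_mult)
    qed simp
  qed
  then show ?thesis
    by (simp add: has_field_derivative_def lambda_zero)
  qed
  show ?thesis
    by (rule has_derivative_zero_unique[OF _ D assms(3)]) (use assms(3) in auto)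
qed

text \<open>The allowance is \<open>y - x\<close> times an increment of a continuous
  \<open>F\<close>, rather than a multiple of \<open>(y - x)\<^sup>2\<close>: in the product rule
  \<open>F\<close> is a multiple of a primitive of \<bar>f'\<bar>, and f' may be unbounded.\<close>

lemma ac_onI:
  assumes f': "f' absolutely_integrable_on {c..d}"
    and F: "continuous_on {c..d} F"
    and b: "\<And>x y. c \<le> x \<Longrightarrow> x \<le> y \<Longrightarrow> y \<le> d \<Longrightarrow>
       \<bar>f y - f x - integral {x..y} f'\<bar> \<le> (y - x) * (F y - F x)"
  shows "ac_on c d f f'"
  unfolding ac_on_def
proof (intro conjI ballI f')
  fix x assume x: "x \<in> {c..d}"
  define H where "H = (\<lambda>x. f x - integral {c..x} f')"
  have "H x = H c"
  proof (rule constant_if_superlinear_increments[OF F _ x])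
    fix x y assume xy: "c \<le> x" "x \<le> y" "y \<le> d"
    have "f' integrable_on {c..y}"
      using abs_integrable_sub[OF f', of c y] xy set_lebesgue_integral_eq_integral(1) by auto
    then have "integral {c..x} f' + integral {x..y} f' = integral {c..y} f'"
      using xy by (intro Henstock_Kurzweil_Integration.integral_combine) auto
    then have "H y - H x = f y - f x - integral {x..y} f'" by (simp add: H_def)
    then show "\<bar>H y - H x\<bar> \<le> (y - x) * (F y - F x)" using b[OF xy] by simp
  qed
  then show "f x = f c + integral {c..x} f'" by (simp add: H_def)
qed

section \<open>Product and chain rules\<close>

lemma abs_integrable_cont_mult:
  fixes f g :: "real \<Rightarrow> real"
  assumes "continuous_on {c..d} f" "g absolutely_integrable_on {c..d}"
  shows "(\<lambda>x. f x * g x) absolutely_integrable_on {c..d}"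
proof (rule absolutely_integrable_bounded_measurable_product_real)
  show "f \<in> borel_measurable (lebesgue_on {c..d})"
    using assms(1) by (intro continuous_imp_measurable_on_sets_lebesgue) auto
  show "bounded (f ` {c..d})"
    using assms(1) by (intro compact_imp_bounded compact_continuous_image) auto
qed (use assms in auto)

lemma abs_integrable_mult_cont:
  fixes f g :: "real \<Rightarrow> real"
  assumes "continuous_on {c..d} f" "g absolutely_integrable_on {c..d}"
  shows "(\<lambda>x. g x * f x) absolutely_integrable_on {c..d}"
  using abs_integrable_cont_mult[OF assms] by (simp add: mult.commute)

lemma abs_integral_le_bound:
  fixes f :: "real \<Rightarrow> real"
  assumes "f integrable_on {x..y}" "\<And>s. s \<in> {x..y} \<Longrightarrow> \<bar>f s\<bar> \<le> B" "x \<le> y"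
  shows "\<bar>integral {x..y} f\<bar> \<le> B * (y - x)"
  using integral_norm_bound_integral[OF assms(1) integrable_const_ivl, of B] assms
  by (simp add: mult.commute)

text \<open>The asymmetry fits the applications: a weak derivative \<open>f'\<close> is only
  integrable, but every product formed below has a factor with bounded density, such as a test
  function, a solution or an exponential.\<close>

lemma ac_on_mult:
  assumes f: "ac_on c d f f'" and g: "ac_on c d g g'"
    and B: "\<And>x. x \<in> {c..d} \<Longrightarrow> \<bar>g' x\<bar> \<le> B"
  shows "ac_on c d (\<lambda>x. f x * g x) (\<lambda>x. f' x * g x + f x * g' x)"
proof -
  note cf = ac_on_continuous[OF f] and cg = ac_on_continuous[OF g]
  define F where "F = (\<lambda>x. integral {c..x} (\<lambda>s. \<bar>f' s\<bar>))"
  have absf: "(\<lambda>s. \<bar>f' s\<bar>) absolutely_integrable_on {c..d}"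
    using absolutely_integrable_norm[OF ac_on_abs_integrable[OF f]] by (simp add: comp_def)
  have F: "ac_on c d F (\<lambda>s. \<bar>f' s\<bar>)"
    unfolding ac_on_def using absf by (auto simp: F_def)
  show ?thesis
  proof (rule ac_onI)
    show "(\<lambda>x. f' x * g x + f x * g' x) absolutely_integrable_on {c..d}"
      by (intro set_integral_add abs_integrable_mult_cont abs_integrable_cont_mult
          ac_on_abs_integrable[OF f] ac_on_abs_integrable[OF g] cf cg)
    show "continuous_on {c..d} (\<lambda>x. 2 * B * F x)"
      by (intro continuous_intros ac_on_continuous[OF F])
    fix x y assume xy: "c \<le> x" "x \<le> y" "y \<le> d"
    have sub: "\<And>h. continuous_on {c..d} h \<Longrightarrow> continuous_on {x..y} h"
      using xy by (auto elim: continuous_on_subset)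
    have af: "f' absolutely_integrable_on {x..y}" and ag: "g' absolutely_integrable_on {x..y}"
      using xy by (auto intro!: abs_integrable_sub[OF ac_on_abs_integrable[OF f]]
          abs_integrable_sub[OF ac_on_abs_integrable[OF g]])
    have Fxy: "F y - F x = integral {x..y} (\<lambda>s. \<bar>f' s\<bar>)"
      using ac_on_diff[OF F] xy by auto
    have inc: "integral {x..z} f' \<le> F y - F x \<and> - integral {x..z} f' \<le> F y - F x" if "x \<le> z" "z \<le> y" for z
    proof -
      have "\<bar>integral {x..z} f'\<bar> \<le> integral {x..z} (\<lambda>s. \<bar>f' s\<bar>)"
        using integral_norm_bound_integral[of f' "{x..z}" "\<lambda>s. \<bar>f' s\<bar>"]
          ac_on_integrable[OF f, of x z] ac_on_integrable[OF F, of x z] that xy by simp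
      also have "\<dots> \<le> integral {x..y} (\<lambda>s. \<bar>f' s\<bar>)"
        using ac_on_integrable[OF F] that xy by (intro integral_subset_le) auto
      finally show ?thesis using Fxy by auto
    qed
    have i1: "(\<lambda>s. f' s * (g y - g s)) integrable_on {x..y}"
      using abs_integrable_mult_cont[OF _ af, of "\<lambda>s. g y - g s"] sub[OF cg]
      by (intro set_lebesgue_integral_eq_integral(1)) (simp add: continuous_on_diff)
    have i2: "(\<lambda>s. (f x - f s) * g' s) integrable_on {x..y}"
      using abs_integrable_cont_mult[OF _ ag, of "\<lambda>s. f x - f s"] sub[OF cf]
      by (intro set_lebesgue_integral_eq_integral(1)) (simp add: continuous_on_diff)
    have j: "f' integrable_on {x..y}" "g' integrable_on {x..y}"
      by (rule set_lebesgue_integral_eq_integral(1)[OF af], rule set_lebesgue_integral_eq_integral(1)[OF ag])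
    have j1: "(\<lambda>s. f' s * g s) integrable_on {x..y}" "(\<lambda>s. f s * g' s) integrable_on {x..y}"
      using abs_integrable_mult_cont[OF sub[OF cg] af] abs_integrable_cont_mult[OF sub[OF cf] ag]
      by (blast intro: set_lebesgue_integral_eq_integral(1))+
    \<comment> \<open>The defect is rewritten so that each integral pairs a density with an
      increment over \<open>[x, y]\<close>: increments of \<open>g\<close> are at most
      \<open>B * (y - x)\<close>, those of \<open>f\<close> at most
      \<open>F y - F x\<close>.\<close>
    have "f y * g y - f x * g x - integral {x..y} (\<lambda>s. f' s * g s + f s * g' s)
       = (f y - f x) * g y + f x * (g y - g x) - integral {x..y} (\<lambda>s. f' s * g s + f s * g' s)"
      by (simp add: algebra_simps)
    also have "\<dots> = integral {x..y} (\<lambda>s. f' s * g y) + integral {x..y} (\<lambda>s. f x * g' s)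
        - (integral {x..y} (\<lambda>s. f' s * g s) + integral {x..y} (\<lambda>s. f s * g' s))"
      using ac_on_diff[OF f xy] ac_on_diff[OF g xy] j1
      by (simp add: Henstock_Kurzweil_Integration.integral_add)
    also have "\<dots> = integral {x..y} (\<lambda>s. f' s * (g y - g s)) + integral {x..y} (\<lambda>s. (f x - f s) * g' s)"
      using j j1 unfolding right_diff_distrib left_diff_distrib
      by (subst (1 2) Henstock_Kurzweil_Integration.integral_diff) (auto intro: integrable_on_mult_left integrable_on_mult_right)
    finally have eq: "f y * g y - f x * g x - integral {x..y} (\<lambda>s. f' s * g s + f s * g' s)
      = integral {x..y} (\<lambda>s. f' s * (g y - g s)) + integral {x..y} (\<lambda>s. (f x - f s) * g' s)" .
    have B0: "0 \<le> B" using B[of x] xy by auto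
    have "\<bar>integral {x..y} (\<lambda>s. f' s * (g y - g s))\<bar> \<le> integral {x..y} (\<lambda>s. \<bar>f' s\<bar> * (B * (y - x)))"
    proof (rule integral_norm_bound_integral[where 'a = real, unfolded real_norm_def])
      show "(\<lambda>s. f' s * (g y - g s)) integrable_on {x..y}" by fact
      show "(\<lambda>s. \<bar>f' s\<bar> * (B * (y - x))) integrable_on {x..y}"
        using ac_on_integrable[OF F, of x y] xy by (intro integrable_on_mult_left) auto
      fix s assume s: "s \<in> {x..y}"
      have "\<bar>g y - g s\<bar> \<le> B * (y - s)"
        using ac_on_diff[OF g, of s y] abs_integral_le_bound[of g' s y B] ac_on_integrable[OF g, of s y] B s xy
        by auto
      also have "\<dots> \<le> B * (y - x)" using s B0 by (intro mult_left_mono) auto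
      finally show "\<bar>f' s * (g y - g s)\<bar> \<le> \<bar>f' s\<bar> * (B * (y - x))"
        by (simp add: abs_mult mult_left_mono)
    qed
    also have "\<dots> = (F y - F x) * (B * (y - x))" using Fxy by simp
    finally have b1: "\<bar>integral {x..y} (\<lambda>s. f' s * (g y - g s))\<bar> \<le> (F y - F x) * (B * (y - x))" .
    have b2: "\<bar>integral {x..y} (\<lambda>s. (f x - f s) * g' s)\<bar> \<le> ((F y - F x) * B) * (y - x)"
    proof (rule abs_integral_le_bound[OF i2 _ xy(2)])
      fix s assume s: "s \<in> {x..y}"
      have "\<bar>f x - f s\<bar> \<le> F y - F x"
        using inc[of s] ac_on_diff[OF f, of x s] s xy by auto
      then show "\<bar>(f x - f s) * g' s\<bar> \<le> (F y - F x) * B"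
        using B[of s] s xy by (auto simp: abs_mult intro!: mult_mono)
    qed
    show "\<bar>f y * g y - f x * g x - integral {x..y} (\<lambda>s. f' s * g s + f s * g' s)\<bar>
        \<le> (y - x) * (2 * B * F y - 2 * B * F x)"
      unfolding eq using b1 b2 by (simp add: algebra_simps)
  qed
qed


lemma ac_on_lipschitz:
  assumes "ac_on c d f f'" and "\<And>x. x \<in> {c..d} \<Longrightarrow> \<bar>f' x\<bar> \<le> B"
    and "x \<in> {c..d}" "y \<in> {c..d}"
  shows "\<bar>f y - f x\<bar> \<le> B * \<bar>y - x\<bar>"
proof -
  have *: "\<bar>f y - f x\<bar> \<le> B * (y - x)" if "x \<in> {c..d}" "y \<in> {c..d}" "x \<le> y" for x y
    using ac_on_diff[OF assms(1), of x y] abs_integral_le_bound[of f' x y B]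
      ac_on_integrable[OF assms(1), of x y] assms(2) that by auto
  show ?thesis
    using *[of x y] *[of y x] assms(3,4) by (cases "x \<le> y") (auto simp: abs_minus_commute)
qed

lemma mvt_closed_segment:
  fixes h h' :: "real \<Rightarrow> real"
  assumes "\<And>x. (h has_real_derivative h' x) (at x)"
  shows "\<exists>\<xi>\<in>closed_segment x y. h y - h x = h' \<xi> * (y - x)"
proof -
  consider "x < y" | "x = y" | "y < x" by linarith
  then show ?thesis
  proof cases
    case 1
    then obtain z where "x < z" "z < y" "h y - h x = (y - x) * h' z"
      using MVT2[of x y h h'] assms by auto
    then show ?thesis by (auto simp: closed_segment_eq_real_ivl mult.commute intro!: bexI[of _ z])
  next
    case 3
    then obtain z where "y < z" "z < x" "h x - h y = (x - y) * h' z"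
      using MVT2[of y x h h'] assms by auto
    then show ?thesis
      by (auto simp: closed_segment_eq_real_ivl algebra_simps intro!: bexI[of _ z])
  qed auto
qed

text \<open>By the mean value theorem the increment of \<open>h\<close> is \<open>h' \<xi>\<close>
  times that of \<open>f\<close>, so the defect integrates \<open>h' \<xi> - h' (f s)\<close>
  against \<open>f'\<close> and is quadratic in \<open>y - x\<close>. The set \<open>S\<close>
  localises the Lipschitz condition on \<open>h'\<close>, which the exponential satisfies only on
  bounded sets.\<close>

lemma ac_on_chain:
  assumes f: "ac_on c d f f'" and B: "\<And>x. x \<in> {c..d} \<Longrightarrow> \<bar>f' x\<bar> \<le> B"
    and h: "\<And>y. (h has_real_derivative h' y) (at y)"
    and S: "convex S" "f ` {c..d} \<subseteq> S"
    and A0: "0 \<le> A" and A: "\<And>u v. u \<in> S \<Longrightarrow> v \<in> S \<Longrightarrow> \<bar>h' u - h' v\<bar> \<le> A * \<bar>u - v\<bar>"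
  shows "ac_on c d (\<lambda>x. h (f x)) (\<lambda>x. h' (f x) * f' x)"
proof (rule ac_onI[where F = "\<lambda>x. A * B * B * x"])
  have "continuous_on S h'"
  proof (rule continuous_onI)
    fix x e assume x: "x \<in> S" "(0::real) < e"
    have "\<bar>h' y - h' x\<bar> < e" if "y \<in> S" "dist y x < e / (1 + \<bar>A\<bar>)" for y
    proof -
      have "\<bar>h' y - h' x\<bar> \<le> A * \<bar>y - x\<bar>" using A that x by auto
      also have "\<dots> \<le> (1 + \<bar>A\<bar>) * \<bar>y - x\<bar>" by (intro mult_right_mono) auto
      also have "\<dots> < e" using that by (simp add: dist_real_def field_simps)
      finally show ?thesis .
    qed
    then show "\<exists>k>0. \<forall>y\<in>S. dist y x < k \<longrightarrow> dist (h' y) (h' x) \<le> e"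
      using x by (intro exI[of _ "e / (1 + \<bar>A\<bar>)"]) (auto simp: dist_real_def intro: less_imp_le)
  qed
  then have ch: "continuous_on {c..d} (\<lambda>x. h' (f x))"
    using S ac_on_continuous[OF f] by (auto intro: continuous_on_compose2)
  show abs: "(\<lambda>x. h' (f x) * f' x) absolutely_integrable_on {c..d}"
    by (rule abs_integrable_cont_mult[OF ch ac_on_abs_integrable[OF f]])
  show "continuous_on {c..d} (\<lambda>x. A * B * B * x)" by (intro continuous_intros)
  fix x y assume xy: "c \<le> x" "x \<le> y" "y \<le> d"
  obtain \<xi> where \<xi>: "\<xi> \<in> closed_segment (f x) (f y)" "h (f y) - h (f x) = h' \<xi> * (f y - f x)"
    using mvt_closed_segment[of h h', OF h] by blast
  have "f x \<in> S" "f y \<in> S" using S(2) xy by auto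
  then have \<xi>S: "\<xi> \<in> S" using \<xi>(1) S(1) closed_segment_subset by blast
  have B0: "0 \<le> B" using B[of x] xy by auto
  have i1: "f' integrable_on {x..y}" using ac_on_integrable[OF f] xy by auto
  have i2: "(\<lambda>s. h' (f s) * f' s) integrable_on {x..y}"
    using abs_integrable_sub[OF abs xy(1,3)] by (rule set_lebesgue_integral_eq_integral(1))
  have "h (f y) - h (f x) - integral {x..y} (\<lambda>s. h' (f s) * f' s)
      = integral {x..y} (\<lambda>s. h' \<xi> * f' s) - integral {x..y} (\<lambda>s. h' (f s) * f' s)"
    unfolding \<xi>(2) ac_on_diff[OF f xy] by simp
  also have "\<dots> = integral {x..y} (\<lambda>s. (h' \<xi> - h' (f s)) * f' s)"
    using i1 i2 unfolding left_diff_distrib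
    by (subst Henstock_Kurzweil_Integration.integral_diff) (auto intro: integrable_on_mult_right)
  finally have eq: "h (f y) - h (f x) - integral {x..y} (\<lambda>s. h' (f s) * f' s)
      = integral {x..y} (\<lambda>s. (h' \<xi> - h' (f s)) * f' s)" .
  have "\<bar>integral {x..y} (\<lambda>s. (h' \<xi> - h' (f s)) * f' s)\<bar> \<le> (A * (B * (y - x)) * B) * (y - x)"
  proof (rule abs_integral_le_bound[OF _ _ xy(2)])
    show "(\<lambda>s. (h' \<xi> - h' (f s)) * f' s) integrable_on {x..y}"
      using i1 i2 unfolding left_diff_distrib by (intro integrable_diff integrable_on_mult_right) auto
    fix s assume s: "s \<in> {x..y}"
    have fsx: "\<bar>f s - f x\<bar> \<le> B * (y - x)"
      using ac_on_lipschitz[OF f B, of x s] s xy mult_left_mono[of "s - x" "y - x" B] B0 by auto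
    have fsy: "\<bar>f y - f s\<bar> \<le> B * (y - x)"
      using ac_on_lipschitz[OF f B, of s y] s xy mult_left_mono[of "y - s" "y - x" B] B0 by auto
    have "\<bar>\<xi> - f s\<bar> \<le> B * (y - x)"
      using fsx fsy \<xi>(1) by (auto simp: closed_segment_eq_real_ivl split: if_splits)
    moreover have fsS: "f s \<in> S" using S s xy by auto
    ultimately have "\<bar>h' \<xi> - h' (f s)\<bar> \<le> A * (B * (y - x))"
      using A[OF \<xi>S fsS] mult_left_mono[OF _ A0] by (meson order_trans)
    then show "\<bar>(h' \<xi> - h' (f s)) * f' s\<bar> \<le> A * (B * (y - x)) * B"
      unfolding abs_mult using B[of s] s xy by (intro mult_mono) auto
  qed
  then show "\<bar>h (f y) - h (f x) - integral {x..y} (\<lambda>s. h' (f s) * f' s)\<bar>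
      \<le> (y - x) * (A * B * B * y - A * B * B * x)"
    unfolding eq by (simp add: algebra_simps)
qed

lemma ac_on_C1:
  assumes "\<And>x. x \<in> {c..d} \<Longrightarrow> (f has_real_derivative f' x) (at x within {c..d})"
    and "continuous_on {c..d} f'"
  shows "ac_on c d f f'"
  unfolding ac_on_def
proof (intro conjI ballI)
  show "f' absolutely_integrable_on {c..d}"
    using absolutely_integrable_continuous[of c d f'] assms(2) by simp
  fix x assume x: "x \<in> {c..d}"
  have "(f' has_integral (f x - f c)) {c..x}"
  proof (rule fundamental_theorem_of_calculus)
    fix y assume "y \<in> {c..x}"
    then show "(f has_vector_derivative f' y) (at y within {c..x})"
      using assms(1)[of y] x DERIV_subset[of f "f' y" y "{c..d}" "{c..x}"]
      by (auto simp: has_real_derivative_iff_has_vector_derivative)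
  qed (use x in auto)
  then show "f x = f c + integral {c..x} f'"
    by (simp add: integral_unique)
qed

lemma ac_on_has_derivative:
  assumes f: "ac_on c d f f'" and "continuous_on {c..d} f'" and x: "x \<in> {c..d}"
  shows "(f has_real_derivative f' x) (at x within {c..d})"
proof -
  have "((\<lambda>x. f c + integral {c..x} f') has_real_derivative 0 + f' x) (at x within {c..d})"
    by (intro DERIV_add DERIV_const integral_has_real_derivative assms)
  then have "((\<lambda>x. f c + integral {c..x} f') has_real_derivative f' x) (at x within {c..d})"
    by simp
  then show ?thesis
    by (rule has_field_derivative_transform_within[OF _ zero_less_one x]) (rule ac_on_eq[OF f, symmetric])
qed

lemma ac_on_cong:
  assumes "ac_on c d f f'" "\<And>x. x \<in> {c..d} \<Longrightarrow> f x = g x" "\<And>x. x \<in> {c..d} \<Longrightarrow> f' x = g' x"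
  shows "ac_on c d g g'"
  unfolding ac_on_def
proof (intro conjI ballI)
  have "f' absolutely_integrable_on {c..d}" by (rule ac_on_abs_integrable[OF assms(1)])
  then show "g' absolutely_integrable_on {c..d}"
    by (rule set_integrable_cong[THEN iffD1, rotated -1]) (use assms(3) in auto)
  fix x assume x: "x \<in> {c..d}"
  have "integral {c..x} f' = integral {c..x} g'"
    using assms(3) x by (intro Henstock_Kurzweil_Integration.integral_cong) auto
  then show "g x = g c + integral {c..x} g'"
    using ac_on_eq[OF assms(1) x] assms(2)[of x] assms(2)[of c] x by auto
qed

lemma ac_on_add:
  assumes f: "ac_on c d f f'" and g: "ac_on c d g g'"
  shows "ac_on c d (\<lambda>x. f x + g x) (\<lambda>x. f' x + g' x)"
  unfolding ac_on_def
proof (intro conjI ballI)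
  show "(\<lambda>x. f' x + g' x) absolutely_integrable_on {c..d}"
    by (intro set_integral_add ac_on_abs_integrable[OF f] ac_on_abs_integrable[OF g])
  fix x assume x: "x \<in> {c..d}"
  have "integral {c..x} (\<lambda>x. f' x + g' x) = integral {c..x} f' + integral {c..x} g'"
    using x by (intro Henstock_Kurzweil_Integration.integral_add ac_on_integrable[OF f] ac_on_integrable[OF g]) auto
  then show "f x + g x = f c + g c + integral {c..x} (\<lambda>x. f' x + g' x)"
    using ac_on_eq[OF f x] ac_on_eq[OF g x] by linarith
qed

lemma ac_on_cmult:
  assumes f: "ac_on c d f f'"
  shows "ac_on c d (\<lambda>x. k * f x) (\<lambda>x. k * f' x)"
  unfolding ac_on_def
proof (intro conjI ballI)
  show "(\<lambda>x. k * f' x) absolutely_integrable_on {c..d}"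
    using ac_on_abs_integrable[OF f] by (intro set_integrable_mult_right) auto
  fix x assume x: "x \<in> {c..d}"
  have "f x = f c + integral {c..x} f'" by (rule ac_on_eq[OF f x])
  then show "k * f x = k * f c + integral {c..x} (\<lambda>x. k * f' x)"
    by (simp add: algebra_simps)
qed

lemma ac_on_indefinite_integral:
  assumes "f' absolutely_integrable_on {c..d}"
  shows "ac_on c d (\<lambda>x. k + integral {c..x} f') f'"
  using assms unfolding ac_on_def by auto

section \<open>Weak solutions\<close>

lemmas abs_integrable_open_closed = absolutely_integrable_on_Icc_iff_Ioo[symmetric, where 'a = real]

lemma LINT_open_eq_integral:
  fixes f :: "real \<Rightarrow> real"
  assumes "f absolutely_integrable_on {c..d}"
  shows "(LINT x:{c<..<d}|lebesgue. f x) = integral {c..d} f"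
  using set_lebesgue_integral_eq_integral(2)[of "{c<..<d}" f] assms
  by (simp add: abs_integrable_open_closed integral_open_interval_real)

lemma square_integrable_mult:
  assumes "square_integrable l f" "square_integrable l g"
  shows "(\<lambda>x. f x * g x) absolutely_integrable_on {0..l}"
proof -
  let ?A = "{0<..<l}"
  have f: "(\<lambda>x. indicator ?A x * f x) \<in> borel_measurable lebesgue"
      "integrable lebesgue (\<lambda>x. indicator ?A x * (f x)\<^sup>2)"
    and g: "(\<lambda>x. indicator ?A x * g x) \<in> borel_measurable lebesgue"
      "integrable lebesgue (\<lambda>x. indicator ?A x * (g x)\<^sup>2)"
    using assms by (auto simp: square_integrable_def set_borel_measurable_def set_integrable_def)
  have eq: "(\<lambda>x. indicator ?A x *\<^sub>R (f x * g x)) = (\<lambda>x. (indicator ?A x * f x) * (indicator ?A x * g x))"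
    by (auto simp: indicator_def)
  have "integrable lebesgue (\<lambda>x. indicator ?A x *\<^sub>R (f x * g x))"
  proof (rule Bochner_Integration.integrable_bound)
    show "integrable lebesgue (\<lambda>x. indicator ?A x * (f x)\<^sup>2 + indicator ?A x * (g x)\<^sup>2)"
      using f g by (intro Bochner_Integration.integrable_add)
    show "(\<lambda>x. indicator ?A x *\<^sub>R (f x * g x)) \<in> borel_measurable lebesgue"
      unfolding eq using f(1) g(1) by (rule borel_measurable_times)
    have "\<bar>f x * g x\<bar> \<le> (f x)\<^sup>2 + (g x)\<^sup>2" for x
      using sum_squares_bound[of "\<bar>f x\<bar>" "\<bar>g x\<bar>"] abs_ge_zero[of "f x * g x"]
      unfolding abs_mult power2_abs by linarith
    then show "AE x in lebesgue. norm (indicator ?A x *\<^sub>R (f x * g x))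
        \<le> norm (indicator ?A x * (f x)\<^sup>2 + indicator ?A x * (g x)\<^sup>2)"
      by (intro AE_I2) (auto simp: indicator_def)
  qed
  then show ?thesis
    unfolding abs_integrable_open_closed[symmetric] unfolding set_integrable_def .
qed

lemma square_integrable_continuous:
  assumes "continuous_on {0..l} f"
  shows "square_integrable l f"
  unfolding square_integrable_def
proof
  have "f absolutely_integrable_on {0<..<l}"
    using absolutely_integrable_continuous[of 0 l f] assms by (simp add: abs_integrable_open_closed)
  then show "set_borel_measurable lebesgue {0<..<l} f"
    unfolding set_integrable_def set_borel_measurable_def by (rule borel_measurable_integrable)
  show "(\<lambda>x. (f x)\<^sup>2) absolutely_integrable_on {0<..<l}"
    using absolutely_integrable_continuous[of 0 l "\<lambda>x. (f x)\<^sup>2"] assms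
    by (simp add: abs_integrable_open_closed continuous_on_power)
qed

lemma square_integrable_abs_integrable:
  assumes "square_integrable l f"
  shows "f absolutely_integrable_on {0..l}"
  using square_integrable_mult[OF assms square_integrable_continuous[of l "\<lambda>_. 1"]] by simp

lemma square_integrable_add:
  assumes f: "square_integrable l f" and g: "square_integrable l g"
  shows "square_integrable l (\<lambda>x. f x + g x)"
  unfolding square_integrable_def
proof
  show "set_borel_measurable lebesgue {0<..<l} (\<lambda>x. f x + g x)"
    using f g unfolding square_integrable_def set_borel_measurable_def
    by (simp add: distrib_left borel_measurable_add)
  have "(\<lambda>x. (f x * f x + f x * g x) + (f x * g x + g x * g x)) absolutely_integrable_on {0..l}"
    by (intro set_integral_add square_integrable_mult f g)
  then show "(\<lambda>x. (f x + g x)\<^sup>2) absolutely_integrable_on {0<..<l}"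
    by (simp add: abs_integrable_open_closed power2_eq_square algebra_simps)
qed

section \<open>Tent functions and the lemma of du Bois-Reymond\<close>

lemma has_derivative_half_square_pos:
  "((\<lambda>x::real. (max 0 x)\<^sup>2 / 2) has_real_derivative max 0 x) (at x)"
proof -
  consider "x < 0" | "x = 0" | "0 < x" by linarith
  then show ?thesis
  proof cases
    case 1
    have "((\<lambda>x::real. 0) has_real_derivative max 0 x) (at x)" using 1 by simp
    then show ?thesis
      by (rule DERIV_cong_ev[THEN iffD1, rotated -1])
        (use 1 in \<open>auto intro!: eventually_mono[OF order_tendstoD(2)[OF tendsto_ident_at 1]]
            simp: eventually_nhds intro: exI[of _ "{..<0}"]\<close>)
  next
    case 3
    have "((\<lambda>x::real. x\<^sup>2 / 2) has_real_derivative max 0 x) (at x)"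
      using 3 by (auto intro!: derivative_eq_intros)
    then show ?thesis
      by (rule DERIV_cong_ev[THEN iffD1, rotated -1])
        (use 3 in \<open>auto simp: eventually_nhds intro: exI[of _ "{0<..}"]\<close>)
  next
    case 2
    have "((\<lambda>h. (max 0 h)\<^sup>2 / 2 / h) \<longlongrightarrow> 0) (at (0::real))"
    proof (rule Lim_null_comparison)
      show "\<forall>\<^sub>F h in at (0::real). norm ((max 0 h)\<^sup>2 / 2 / h) \<le> \<bar>h\<bar>"
        by (auto simp: eventually_at max_def power2_eq_square intro!: exI[of _ 1])
      show "((\<lambda>h. \<bar>h\<bar>) \<longlongrightarrow> 0) (at (0::real))"
        by (auto intro!: tendsto_eq_intros)
    qed
    then show ?thesis using 2 by (simp add: DERIV_def)
  qed
qed

text \<open>The tent of height \<open>e\<close> on \<open>[-e, e]\<close>, written as a second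
  difference of the positive part so that a continuously differentiable primitive is
  explicit.\<close>

definition hat :: "real \<Rightarrow> real \<Rightarrow> real" where
  "hat e x = max 0 (x + e) - 2 * max 0 x + max 0 (x - e)"

definition hat_prim :: "real \<Rightarrow> real \<Rightarrow> real" where
  "hat_prim e x = (max 0 (x + e))\<^sup>2 / 2 - 2 * ((max 0 x)\<^sup>2 / 2) + (max 0 (x - e))\<^sup>2 / 2"

lemma hat_prim_deriv: "((\<lambda>x. hat_prim e (x - c)) has_real_derivative hat e (x - c)) (at x)"
proof -
  have *: "((\<lambda>x. (max 0 (x + k))\<^sup>2 / 2) has_real_derivative max 0 (x + k)) (at x)" for k :: real
    using has_derivative_half_square_pos[of "x + k"] by (simp add: DERIV_shift)
  show ?thesis
    unfolding hat_prim_def hat_def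
    using DERIV_add[OF DERIV_diff[OF *[of "e - c"] DERIV_cmult[OF *[of "- c"], of 2]] *[of "- e - c"]]
    by (simp add: algebra_simps)
qed

lemma hat_nonneg: "0 \<le> e \<Longrightarrow> 0 \<le> hat e x" by (auto simp: hat_def max_def)
lemma hat_zero: "0 \<le> e \<Longrightarrow> hat e x \<noteq> 0 \<Longrightarrow> \<bar>x\<bar> < e" by (auto simp: hat_def max_def split: if_splits)
lemma hat_0: "0 \<le> e \<Longrightarrow> hat e 0 = e" by (auto simp: hat_def)
lemma hat_prim_left: "0 \<le> e \<Longrightarrow> x \<le> - e \<Longrightarrow> hat_prim e x = 0" by (auto simp: hat_prim_def)
lemma hat_prim_right: "0 \<le> e \<Longrightarrow> e \<le> x \<Longrightarrow> hat_prim e x = e\<^sup>2"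
  by (auto simp: hat_prim_def max_def power2_eq_square field_simps)

lemma continuous_hat: "continuous_on S (\<lambda>x. hat e (x - c))"
  unfolding hat_def by (intro continuous_intros)

lemma test_function_hat_diff:
  assumes "0 < e" "0 < c - e" "c + e < l" "0 < d - e" "d + e < l"
  shows "test_function l (\<lambda>x. hat_prim e (x - c) - hat_prim e (x - d)) (\<lambda>x. hat e (x - c) - hat e (x - d))"
  unfolding test_function_def
proof (intro conjI allI)
  show "((\<lambda>x. hat_prim e (x - c) - hat_prim e (x - d)) has_real_derivative hat e (x - c) - hat e (x - d)) (at x)" for x
    by (intro DERIV_diff hat_prim_deriv)
  show "continuous_on UNIV (\<lambda>x. hat e (x - c) - hat e (x - d))"
    by (intro continuous_on_diff continuous_hat)
  show "\<exists>c' d'. 0 < c' \<and> d' < l \<and>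
      (\<forall>x. x \<notin> {c'..d'} \<longrightarrow> hat_prim e (x - c) - hat_prim e (x - d) = 0)"
  proof (intro exI conjI allI impI)
    show "0 < min (c - e) (d - e)" "max (c + e) (d + e) < l" using assms by auto
    fix x assume "x \<notin> {min (c - e) (d - e)..max (c + e) (d + e)}"
    then have "(x - c \<le> - e \<and> x - d \<le> - e) \<or> (e \<le> x - c \<and> e \<le> x - d)"
      by auto
    then show "hat_prim e (x - c) - hat_prim e (x - d) = 0"
      using assms hat_prim_left hat_prim_right by auto
  qed
qed

lemma test_function_ac_on:
  assumes "test_function l \<phi> \<phi>'"
  shows "ac_on c d \<phi> \<phi>'" "continuous_on S \<phi>'" "\<phi> 0 = 0" "\<phi> l = 0"
proof -
  show c: "continuous_on S \<phi>'" for S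
    using assms continuous_on_subset unfolding test_function_def by blast
  show "ac_on c d \<phi> \<phi>'"
    using assms by (intro ac_on_C1 c) (auto simp: test_function_def intro: has_field_derivative_at_within)
  show "\<phi> 0 = 0" "\<phi> l = 0"
    using assms unfolding test_function_def by force+
qed

lemma continuous_bounded_Icc:
  fixes f :: "real \<Rightarrow> real"
  assumes "continuous_on {c..d} f"
  obtains B where "0 \<le> B" "\<And>x. x \<in> {c..d} \<Longrightarrow> \<bar>f x\<bar> \<le> B"
proof -
  have "bounded (f ` {c..d})"
    using assms by (intro compact_imp_bounded compact_continuous_image) auto
  then obtain B where "\<forall>x\<in>{c..d}. \<bar>f x\<bar> \<le> B" "0 < B"
    by (auto simp: bounded_pos)
  then show ?thesis using that[of B] by auto
qed

text \<open>Two tents of equal mass at \<open>c\<close> and \<open>d\<close>, taken with opposite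
  signs, form the derivative of an admissible test function. If \<open>h\<close> exceeded
  \<open>A\<close> near \<open>c\<close> and stayed below \<open>A\<close> near \<open>d\<close>,
  pairing \<open>h - A\<close> with that derivative would give a positive number.\<close>

lemma du_bois_reymond:
  assumes h: "continuous_on {0..l} h" and "0 < l"
    and test: "\<And>\<phi> \<phi>'. test_function l \<phi> \<phi>' \<Longrightarrow> integral {0..l} (\<lambda>x. h x * \<phi>' x) = 0"
    and x: "x \<in> {0..l}"
  shows "h x = h 0"
proof -
  have le: "h c \<le> h d" if c: "c \<in> {0<..<l}" and d: "d \<in> {0<..<l}" for c d
  proof (rule ccontr)
    assume "\<not> h c \<le> h d"
    define A where "A = (h c + h d) / 2"
    have A: "h d < A" "A < h c" using \<open>\<not> h c \<le> h d\<close> by (auto simp: A_def)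
    have ic: "isCont h c" "isCont h d"
      using continuous_on_interior[OF h] c d by (auto simp: interior_atLeastAtMost_real)
    obtain e1 where e1: "0 < e1" "\<And>x. \<bar>x - c\<bar> < e1 \<Longrightarrow> A < h x"
      using order_tendstoD(1)[OF ic(1)[unfolded isCont_def] A(2)] A(2)
      unfolding eventually_at dist_real_def by (metis UNIV_I)
    obtain e2 where e2: "0 < e2" "\<And>x. \<bar>x - d\<bar> < e2 \<Longrightarrow> h x < A"
      using order_tendstoD(2)[OF ic(2)[unfolded isCont_def] A(1)] A(1)
      unfolding eventually_at dist_real_def by (metis UNIV_I)
    have cd: "c \<noteq> d" using A by auto
    \<comment> \<open>Halving the minimum makes every inequality strict: both tents stay inside
      \<open>(0, l)\<close> and inside the neighbourhoods where \<open>h - A\<close> has its sign,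
      and neither reaches the centre of the other.\<close>
    define e where "e = min (min (min e1 e2) \<bar>c - d\<bar>) (min (min c d) (min (l - c) (l - d))) / 2"
    have e: "0 < e" "e < e1" "e < e2" "0 < c - e" "c + e < l" "0 < d - e" "d + e < l" "e < \<bar>c - d\<bar>"
      using e1(1) e2(1) c d cd by (auto simp: e_def min_def field_simps)
    let ?p = "\<lambda>x. hat e (x - c) - hat e (x - d)"
    have t: "test_function l (\<lambda>x. hat_prim e (x - c) - hat_prim e (x - d)) ?p"
      by (rule test_function_hat_diff) (use e in auto)
    have cp: "continuous_on {0..l} ?p" by (intro continuous_on_diff continuous_hat)
    have "integral {0..l} ?p = 0"
      using ac_on_diff[OF test_function_ac_on(1)[OF t, of 0 l], of 0 l] test_function_ac_on(3,4)[OF t] \<open>0 < l\<close>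
      by simp
    moreover have "integral {0..l} (\<lambda>x. h x * ?p x) = 0" by (rule test[OF t])
    moreover have "?p integrable_on {0..l}" "(\<lambda>x. h x * ?p x) integrable_on {0..l}"
      by (intro integrable_continuous_real continuous_on_mult h cp)+
    ultimately have "integral {0..l} (\<lambda>x. h x * ?p x - A * ?p x) = 0"
      by (subst Henstock_Kurzweil_Integration.integral_diff) (auto intro: integrable_on_mult_right)
    then have "integral {0..l} (\<lambda>x. (h x - A) * ?p x) = 0"
      by (simp add: algebra_simps)
    moreover have "0 \<le> (h x - A) * ?p x" for x
    proof -
      have "0 \<le> (h x - A) * hat e (x - c)"
        using e1(2)[of x] hat_zero[of e "x - c"] hat_nonneg[of e "x - c"] e
        by (cases "hat e (x - c) = 0") auto
      moreover have "0 \<le> (A - h x) * hat e (x - d)"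
        using e2(2)[of x] hat_zero[of e "x - d"] hat_nonneg[of e "x - d"] e
        by (cases "hat e (x - d) = 0") auto
      ultimately show ?thesis by (simp add: algebra_simps)
    qed
    moreover have "continuous_on {0..l} (\<lambda>x. (h x - A) * ?p x)"
      by (intro continuous_on_mult continuous_on_diff h cp continuous_on_const continuous_hat)
    \<comment> \<open>A continuous nonnegative integrand with integral zero vanishes everywhere, but
      at \<open>c\<close> its value is \<open>(h c - A) * e\<close>.\<close>
    ultimately have "(h c - A) * ?p c = 0"
      using integral_eq_0_iff[of 0 l "\<lambda>x. (h x - A) * ?p x"] \<open>0 < l\<close> c by auto
    moreover have "hat e (c - d) = 0" "hat e (c - c) = e"
      using hat_zero[of e "c - d"] hat_0[of e] e by auto
    ultimately show False using A e by simp
  qed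
  have "h y = h (l/2)" if "y \<in> {0<..<l}" for y
    using le[of y "l/2"] le[of "l/2" y] that \<open>0 < l\<close> by auto
  moreover have cl: "closure {0<..<l} = {0..l}" using \<open>0 < l\<close> by simp
  ultimately have "h y = h (l/2)" if "y \<in> {0..l}" for y
    using continuous_constant_on_closure[of "{0<..<l}" h "h (l/2)" y] h that by metis
  from this[OF x] this[of 0] show ?thesis using \<open>0 < l\<close> by simp
qed


section \<open>Integration by parts and the Sobolev space\<close>

lemma integral_mult_parts:
  assumes f: "ac_on c d f f'" and g: "ac_on c d g g'"
    and B: "\<And>x. x \<in> {c..d} \<Longrightarrow> \<bar>g' x\<bar> \<le> B" and "c \<le> d"
  shows "(\<lambda>x. f' x * g x) absolutely_integrable_on {c..d}" "(\<lambda>x. f x * g' x) absolutely_integrable_on {c..d}"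
    "integral {c..d} (\<lambda>x. f' x * g x) + integral {c..d} (\<lambda>x. f x * g' x) = f d * g d - f c * g c"
proof -
  show i: "(\<lambda>x. f' x * g x) absolutely_integrable_on {c..d}" "(\<lambda>x. f x * g' x) absolutely_integrable_on {c..d}"
    using abs_integrable_mult_cont[OF ac_on_continuous[OF g] ac_on_abs_integrable[OF f]]
      abs_integrable_cont_mult[OF ac_on_continuous[OF f] ac_on_abs_integrable[OF g]] by auto
  show "integral {c..d} (\<lambda>x. f' x * g x) + integral {c..d} (\<lambda>x. f x * g' x) = f d * g d - f c * g c"
    using ac_on_diff[OF ac_on_mult[OF f g B], of c d] \<open>c \<le> d\<close>
      Henstock_Kurzweil_Integration.integral_add[OF set_lebesgue_integral_eq_integral(1)[OF i(1)]
        set_lebesgue_integral_eq_integral(1)[OF i(2)]] by simp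
qed

text \<open>The difference of \<open>v\<close> and the primitive of \<open>v'\<close> is orthogonal
  to all derivatives of test functions, hence constant. As \<open>v\<close> is the continuous
  representative, the representation holds at every point.\<close>

lemma H10_ac_on:
  assumes "H10 l v v'" "0 < l"
  shows "ac_on 0 l v v'"
proof -
  have cv: "continuous_on {0..l} v" and v': "v' absolutely_integrable_on {0..l}" and v0: "v 0 = 0"
    using assms(1) square_integrable_abs_integrable by (auto simp: H10_def)
  define V where "V = (\<lambda>x. 0 + integral {0..x} v')"
  have V: "ac_on 0 l V v'" unfolding V_def by (rule ac_on_indefinite_integral[OF v'])
  note cV = ac_on_continuous[OF V]
  have "v x - V x = v 0 - V 0" if "x \<in> {0..l}" for x
  proof (rule du_bois_reymond[OF _ assms(2) _ that])
    show "continuous_on {0..l} (\<lambda>x. v x - V x)" by (intro continuous_on_diff cv cV)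
    fix \<phi> \<phi>' assume t: "test_function l \<phi> \<phi>'"
    note \<phi> = test_function_ac_on(1)[OF t, of 0 l] and c' = test_function_ac_on(2)[OF t, of "{0..l}"]
      and z = test_function_ac_on(3,4)[OF t]
    obtain B where B: "\<And>x. x \<in> {0..l} \<Longrightarrow> \<bar>\<phi>' x\<bar> \<le> B"
      using continuous_bounded_Icc[OF c'] by blast
    note parts = integral_mult_parts[OF V \<phi> B, simplified]
    have "(\<lambda>x. v x * \<phi>' x) absolutely_integrable_on {0..l}"
      by (rule abs_integrable_cont_mult[OF cv ac_on_abs_integrable[OF \<phi>]])
    moreover have "(LINT x:{0<..<l}|lebesgue. v x * \<phi>' x) = - (LINT x:{0<..<l}|lebesgue. v' x * \<phi> x)"
      using assms(1) t unfolding H10_def weak_derivative_def by blast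
    ultimately have "integral {0..l} (\<lambda>x. v x * \<phi>' x) = - integral {0..l} (\<lambda>x. v' x * \<phi> x)"
      using parts(1) assms(2) by (simp add: LINT_open_eq_integral)
    also have "\<dots> = integral {0..l} (\<lambda>x. V x * \<phi>' x)"
      using parts(3) z assms(2) by simp
    finally show "integral {0..l} (\<lambda>x. (v x - V x) * \<phi>' x) = 0"
      using integrable_continuous_real[OF continuous_on_mult[OF cv c']]
        integrable_continuous_real[OF continuous_on_mult[OF cV c']]
      by (simp add: left_diff_distrib Henstock_Kurzweil_Integration.integral_diff)
  qed
  then have "V x = v x" if "x \<in> {0..l}" for x
    using that v0 by (simp add: V_def)
  then show ?thesis
    using ac_on_cong[OF V] by simp
qed

lemma H10_intro:
  assumes v: "ac_on 0 l v v'" and sq: "square_integrable l v'" and z: "v 0 = 0" "v l = 0" and "0 < l"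
  shows "H10 l v v'"
  unfolding H10_def
proof (intro conjI sq z)
  show c: "continuous_on {0..l} v" by (rule ac_on_continuous[OF v])
  show "square_integrable l v" by (rule square_integrable_continuous[OF c])
  show "weak_derivative l v v'"
    unfolding weak_derivative_def
  proof (intro allI impI)
    fix \<phi> \<phi>' assume t: "test_function l \<phi> \<phi>'"
    note \<phi> = test_function_ac_on(1)[OF t, of 0 l] and c' = test_function_ac_on(2)[OF t, of "{0..l}"]
    obtain B where B: "\<And>x. x \<in> {0..l} \<Longrightarrow> \<bar>\<phi>' x\<bar> \<le> B"
      using continuous_bounded_Icc[OF c'] by blast
    note parts = integral_mult_parts[OF v \<phi> B, simplified]
    show "(LINT x:{0<..<l}|lebesgue. v x * \<phi>' x) = - (LINT x:{0<..<l}|lebesgue. v' x * \<phi> x)"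
      using parts z \<open>0 < l\<close> by (simp add: LINT_open_eq_integral)
  qed
qed

section \<open>Weak solutions as solutions of a first-order system\<close>

definition jump_rhs :: "(real \<Rightarrow> real) \<Rightarrow> (real \<Rightarrow> real) \<Rightarrow> real \<Rightarrow> real \<Rightarrow> real \<Rightarrow> real \<Rightarrow> real" where
  "jump_rhs M N \<alpha> \<beta> x r = \<alpha> * M x * pos_part r - \<beta> * N x * neg_part r"

definition bounded_weight :: "real \<Rightarrow> real \<Rightarrow> (real \<Rightarrow> real) \<Rightarrow> bool" where
  "bounded_weight a b w \<longleftrightarrow> w \<in> borel_measurable lebesgue \<and> (\<forall>x. a \<le> w x \<and> w x \<le> b)"

definition regular_solution ::
  "real \<Rightarrow> (real \<Rightarrow> real) \<Rightarrow> (real \<Rightarrow> real) \<Rightarrow> real \<Rightarrow> real \<Rightarrow> (real \<Rightarrow> real) \<Rightarrow> (real \<Rightarrow> real) \<Rightarrow> bool" where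
  "regular_solution l M N \<alpha> \<beta> u p \<longleftrightarrow> ac_on 0 l u p \<and>
     ac_on 0 l p (\<lambda>x. - jump_rhs M N \<alpha> \<beta> x (u x)) \<and> u 0 = 0 \<and> u l = 0"

lemma bounded_weight_abs_integrable:
  assumes "bounded_weight a b w"
  shows "w absolutely_integrable_on {c..d}"
proof -
  have "(\<lambda>x. w x * 1) absolutely_integrable_on {c..d}"
  proof (rule absolutely_integrable_bounded_measurable_product_real)
    show "w \<in> borel_measurable (lebesgue_on {c..d})"
      using assms by (intro measurable_restrict_space1) (simp add: bounded_weight_def)
    show "bounded (w ` {c..d})"
      using assms by (intro boundedI[of _ "\<bar>a\<bar> + \<bar>b\<bar>"]) (auto simp: bounded_weight_def abs_le_iff; smt (verit))
    show "(\<lambda>x. 1::real) absolutely_integrable_on {c..d}"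
      using absolutely_integrable_continuous[of c d "\<lambda>_. 1::real"] by simp
  qed auto
  then show ?thesis by simp
qed

lemma jump_rhs_abs_integrable:
  assumes "bounded_weight a b M" "bounded_weight a b N" "continuous_on {c..d} u"
  shows "(\<lambda>x. jump_rhs M N \<alpha> \<beta> x (u x)) absolutely_integrable_on {c..d}"
proof -
  have "(\<lambda>x. M x * (\<alpha> * pos_part (u x)) - N x * (\<beta> * neg_part (u x))) absolutely_integrable_on {c..d}"
    unfolding pos_part_def neg_part_def
    by (intro set_integral_diff abs_integrable_mult_cont bounded_weight_abs_integrable[OF assms(1)]
        bounded_weight_abs_integrable[OF assms(2)] continuous_intros assms(3))
  then show ?thesis by (simp add: jump_rhs_def algebra_simps)
qed

lemma jump_rhs_bound:
  assumes "bounded_weight a b M" "bounded_weight a b N" "0 \<le> a" "0 \<le> \<alpha>" "0 \<le> \<beta>"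
  shows "\<bar>jump_rhs M N \<alpha> \<beta> x r\<bar> \<le> (\<alpha> + \<beta>) * b * \<bar>r\<bar>"
proof -
  have "0 \<le> M x" "M x \<le> b" "0 \<le> N x" "N x \<le> b"
    using assms by (auto simp: bounded_weight_def intro: order_trans)
  then have "\<alpha> * M x * \<bar>r\<bar> \<le> \<alpha> * b * \<bar>r\<bar>" "\<beta> * N x * \<bar>r\<bar> \<le> \<beta> * b * \<bar>r\<bar>"
    "0 \<le> \<alpha> * M x * \<bar>r\<bar>" "0 \<le> \<beta> * N x * \<bar>r\<bar>"
    using assms by (auto intro!: mult_right_mono mult_left_mono)
  then show ?thesis
    by (cases "0 \<le> r") (auto simp: jump_rhs_def pos_part_def neg_part_def distrib_right max_def)
qed

text \<open>The weak equation says that \<open>u' + P\<close> is constant almost everywhere, where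
  \<open>P\<close> is a primitive of the right-hand side. Testing with a function whose derivative
  is \<open>u' + P\<close> minus its mean proves this at once: the square of that derivative
  integrates to zero.\<close>

lemma weak_solution_regular:
  assumes M: "bounded_weight a b M" and N: "bounded_weight a b N" and "0 \<le> a" "0 \<le> \<alpha>" "0 \<le> \<beta>" "0 < l"
    and "weak_solution l M N \<alpha> \<beta> u"
  shows "\<exists>p. regular_solution l M N \<alpha> \<beta> u p"
proof -
  obtain u' where u: "H10 l u u'"
    and weak: "\<And>v v'. H10 l v v' \<Longrightarrow> (LINT x:{0<..<l}|lebesgue. u' x * v' x) =
      (LINT x:{0<..<l}|lebesgue. jump_rhs M N \<alpha> \<beta> x (u x) * v x)"
    using assms(7) unfolding weak_solution_def jump_rhs_def by blast
  let ?r = "\<lambda>x. jump_rhs M N \<alpha> \<beta> x (u x)"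
  have acu: "ac_on 0 l u u'" by (rule H10_ac_on[OF u \<open>0 < l\<close>])
  have squ: "square_integrable l u'" and cu: "continuous_on {0..l} u" and u0: "u 0 = 0" "u l = 0"
    using u by (auto simp: H10_def)
  define P where "P = (\<lambda>x. 0 + integral {0..x} ?r)"
  have P: "ac_on 0 l P ?r"
    unfolding P_def by (rule ac_on_indefinite_integral[OF jump_rhs_abs_integrable[OF M N cu]])
  have cP: "continuous_on {0..l} P" by (rule ac_on_continuous[OF P])
  have rB: "\<exists>B. \<forall>x\<in>{0..l}. \<bar>?r x\<bar> \<le> B"
  proof -
    obtain B where B: "\<And>x. x \<in> {0..l} \<Longrightarrow> \<bar>u x\<bar> \<le> B"
      using continuous_bounded_Icc[OF cu] by blast
    have "0 \<le> b" using M \<open>0 \<le> a\<close> by (auto simp: bounded_weight_def intro: order_trans)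
    then have "\<bar>?r x\<bar> \<le> (\<alpha> + \<beta>) * b * B" if "x \<in> {0..l}" for x
      using jump_rhs_bound[OF M N assms(3-5), of x "u x"] mult_left_mono[OF B[OF that], of "(\<alpha> + \<beta>) * b"] assms(4,5)
      by simp
    then show ?thesis by blast
  qed
  then obtain B where B: "\<And>x. x \<in> {0..l} \<Longrightarrow> \<bar>?r x\<bar> \<le> B" by blast
  \<comment> \<open>The mean \<open>c\<close> is subtracted exactly so that \<open>v l = 0\<close>,
    which makes \<open>v\<close> an admissible test function.\<close>
  define c where "c = integral {0..l} (\<lambda>x. u' x + P x) / l"
  define v' where "v' = (\<lambda>x. u' x + (P x + - c))"
  have sqv: "square_integrable l v'"
    unfolding v'_def by (intro square_integrable_add squ square_integrable_continuous continuous_intros cP)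
  define v where "v = (\<lambda>x. 0 + integral {0..x} v')"
  have acv: "ac_on 0 l v v'"
    unfolding v_def by (rule ac_on_indefinite_integral[OF square_integrable_abs_integrable[OF sqv]])
  have iu: "u' integrable_on {0..l}" using ac_on_integrable[OF acu] \<open>0 < l\<close> by auto
  have iP: "P integrable_on {0..l}" by (rule integrable_continuous_real[OF cP])
  have v0: "v 0 = 0" by (simp add: v_def)
  have "integral {0..l} v' = integral {0..l} (\<lambda>x. u' x + P x) - integral {0..l} (\<lambda>x. c)"
    unfolding v'_def using iu iP
    by (subst Henstock_Kurzweil_Integration.integral_diff[symmetric]) (auto intro: integrable_add simp: algebra_simps)
  then have vl: "v l = 0" using \<open>0 < l\<close> by (simp add: v_def c_def)
  have Hv: "H10 l v v'" by (rule H10_intro[OF acv sqv v0 vl \<open>0 < l\<close>])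
  note parts = integral_mult_parts[OF acv P B less_imp_le[OF \<open>0 < l\<close>], simplified]
  have uv: "(\<lambda>x. u' x * v' x) absolutely_integrable_on {0..l}" by (rule square_integrable_mult[OF squ sqv])
  have "integral {0..l} (\<lambda>x. u' x * v' x) = integral {0..l} (\<lambda>x. v x * ?r x)"
    using weak[OF Hv] uv parts(2) by (simp add: LINT_open_eq_integral mult.commute)
  also have "\<dots> = - integral {0..l} (\<lambda>x. v' x * P x)" using parts(3) v0 vl by simp
  finally have e1: "integral {0..l} (\<lambda>x. u' x * v' x) + integral {0..l} (\<lambda>x. v' x * P x) = 0" by simp
  have iv: "v' integrable_on {0..l}" using ac_on_integrable[OF acv] \<open>0 < l\<close> by auto
  have "integral {0..l} v' = 0" using vl by (simp add: v_def)
  have e2: "integral {0..l} (\<lambda>x. v' x * v' x) = 0"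
  proof -
    have "integral {0..l} (\<lambda>x. v' x * v' x)
        = integral {0..l} (\<lambda>x. (u' x * v' x + v' x * P x) - v' x * c)"
      by (intro Henstock_Kurzweil_Integration.integral_cong) (simp add: v'_def algebra_simps)
    also have "\<dots> = integral {0..l} (\<lambda>x. u' x * v' x + v' x * P x) - integral {0..l} (\<lambda>x. v' x * c)"
      using set_lebesgue_integral_eq_integral(1)[OF uv] set_lebesgue_integral_eq_integral(1)[OF parts(1)] iv
      by (intro Henstock_Kurzweil_Integration.integral_diff integrable_add integrable_on_mult_left)
    also have "integral {0..l} (\<lambda>x. u' x * v' x + v' x * P x) = 0"
      using e1 set_lebesgue_integral_eq_integral(1)[OF uv] set_lebesgue_integral_eq_integral(1)[OF parts(1)]
      by (simp add: Henstock_Kurzweil_Integration.integral_add)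
    also have "integral {0..l} (\<lambda>x. v' x * c) = 0" using \<open>integral {0..l} v' = 0\<close> by simp
    finally show ?thesis by simp
  qed
  have ivv: "(\<lambda>x. v' x * v' x) integrable_on {0..l}"
    using square_integrable_mult[OF sqv sqv] by (rule set_lebesgue_integral_eq_integral(1))
  have v_zero: "v x = 0" if x: "x \<in> {0..l}" for x
  proof -
    have ivx: "v' integrable_on {0..x}" using ac_on_integrable[OF acv] x by auto
    have "\<bar>v x\<bar> \<le> d" if "0 < d" for d
    proof -
      \<comment> \<open>The bound \<bar>v'\<bar> \<le> \<open>e + v'\<^sup>2 / e\<close> replaces
        Cauchy-Schwarz: since the square integrates to zero, integrating leaves at most
        \<open>e * l = d\<close>, and \<open>d\<close> is arbitrary.\<close>
      define e where "e = d / l"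
      have e: "0 < e" using that \<open>0 < l\<close> by (simp add: e_def)
      have sub: "(\<lambda>s. v' s * v' s) integrable_on {0..x}"
        using integrable_on_subinterval[OF ivv, of 0 x] x by auto
      have "\<bar>integral {0..x} v'\<bar> \<le> integral {0..x} (\<lambda>s. e + v' s * v' s / e)"
      proof (rule integral_norm_bound_integral[where 'a = real, unfolded real_norm_def, OF ivx])
        show "(\<lambda>s. e + v' s * v' s / e) integrable_on {0..x}"
          by (intro integrable_add integrable_on_divide sub) auto
        fix s
        have "2 * \<bar>v' s\<bar> * e \<le> \<bar>v' s\<bar>\<^sup>2 + e\<^sup>2" by (rule sum_squares_bound)
        moreover have "0 \<le> \<bar>v' s\<bar> * e" using e by simp
        ultimately have "\<bar>v' s\<bar> * e \<le> v' s * v' s + e * e" by (simp add: power2_eq_square)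
        then show "\<bar>v' s\<bar> \<le> e + v' s * v' s / e" using e by (simp add: field_simps)
      qed
      also have "\<dots> = e * x + integral {0..x} (\<lambda>s. v' s * v' s) / e"
        using sub x by (subst Henstock_Kurzweil_Integration.integral_add) (auto intro: integrable_on_divide)
      also have "integral {0..x} (\<lambda>s. v' s * v' s) \<le> integral {0..l} (\<lambda>s. v' s * v' s)"
        using x by (intro integral_subset_le sub ivv) auto
      also have "e * x + integral {0..l} (\<lambda>s. v' s * v' s) / e \<le> d"
        using e2 x \<open>0 < l\<close> that by (simp add: e_def field_simps)
      finally show ?thesis using e by (simp add: v_def divide_right_mono)
    qed
    then show ?thesis
      by (metis abs_le_zero_iff dense_ge)
  qed
  have "regular_solution l M N \<alpha> \<beta> u (\<lambda>x. c + - 1 * P x)"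
    unfolding regular_solution_def
  proof (intro conjI u0)
    \<comment> \<open>Subtracting the zero function \<open>v\<close> leaves \<open>u\<close>
      unchanged but replaces its density \<open>u'\<close> by the continuous function
      \<open>c - P\<close>, so no almost-everywhere argument arises.\<close>
    have "ac_on 0 l (\<lambda>x. u x + - 1 * v x) (\<lambda>x. u' x + - 1 * v' x)"
      by (intro ac_on_add ac_on_cmult acu acv)
    then show "ac_on 0 l u (\<lambda>x. c + - 1 * P x)"
      by (rule ac_on_cong) (auto simp: v_zero v'_def)
    have "ac_on 0 l (\<lambda>x. c) (\<lambda>x. 0)" by (rule ac_on_C1) auto
    then have "ac_on 0 l (\<lambda>x. c + - 1 * P x) (\<lambda>x. 0 + - 1 * ?r x)"
      by (intro ac_on_add ac_on_cmult P)
    then show "ac_on 0 l (\<lambda>x. c + - 1 * P x) (\<lambda>x. - ?r x)" by simp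
  qed
  then show ?thesis by blast
qed

lemma regular_weak_solution:
  assumes M: "bounded_weight a b M" and N: "bounded_weight a b N" and "0 \<le> a" "0 \<le> \<alpha>" "0 \<le> \<beta>" "0 < l"
    and reg: "regular_solution l M N \<alpha> \<beta> u p"
  shows "weak_solution l M N \<alpha> \<beta> u"
  unfolding weak_solution_def
proof (intro exI[of _ p] conjI allI impI)
  let ?r = "\<lambda>x. jump_rhs M N \<alpha> \<beta> x (u x)"
  have u: "ac_on 0 l u p" and p: "ac_on 0 l p (\<lambda>x. - ?r x)" and u0: "u 0 = 0" "u l = 0"
    using reg by (auto simp: regular_solution_def)
  have cp: "continuous_on {0..l} p" by (rule ac_on_continuous[OF p])
  have cu: "continuous_on {0..l} u" by (rule ac_on_continuous[OF u])
  show "H10 l u p" by (rule H10_intro[OF u square_integrable_continuous[OF cp] u0 \<open>0 < l\<close>])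
  fix v v' assume v: "H10 l v v'"
  obtain B where B: "\<And>x. x \<in> {0..l} \<Longrightarrow> \<bar>u x\<bar> \<le> B"
    using continuous_bounded_Icc[OF cu] by blast
  have "0 \<le> b" using M \<open>0 \<le> a\<close> by (auto simp: bounded_weight_def intro: order_trans)
  then have rB: "\<bar>- ?r x\<bar> \<le> (\<alpha> + \<beta>) * b * B" if "x \<in> {0..l}" for x
    using jump_rhs_bound[OF M N assms(3-5), of x "u x"] mult_left_mono[OF B[OF that], of "(\<alpha> + \<beta>) * b"] assms(4,5)
    by simp
  note parts = integral_mult_parts[OF H10_ac_on[OF v \<open>0 < l\<close>] p rB less_imp_le[OF \<open>0 < l\<close>], simplified]
  have "(\<lambda>x. v x * ?r x) absolutely_integrable_on {0..l}"
    using set_integrable_mult_right[of "- 1" lebesgue "{0..l}" "\<lambda>x. - (v x * ?r x)"] parts(2) by simp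
  then have "(LINT x:{0<..<l}|lebesgue. v' x * p x) = (LINT x:{0<..<l}|lebesgue. v x * ?r x)"
    using parts(1,3) v by (simp add: LINT_open_eq_integral H10_def)
  then show "(LINT x:{0<..<l}|lebesgue. p x * v' x) =
     (LINT x:{0<..<l}|lebesgue. (\<alpha> * M x * pos_part (u x) - \<beta> * N x * neg_part (u x)) * v x)"
    by (simp add: jump_rhs_def mult.commute)
qed

section \<open>Nodal structure\<close>

lemma ac_on_mono:
  assumes f: "ac_on c d f f'" and pos: "\<And>x. x \<in> {c..d} \<Longrightarrow> 0 \<le> f' x"
    and "c \<le> x" "x \<le> y" "y \<le> d"
  shows "f x \<le> f y"
proof -
  have "0 \<le> integral {x..y} f'"
    using ac_on_integrable[OF f, of x y] assms by (intro integral_nonneg) auto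
  then show ?thesis using ac_on_diff[OF f assms(3-5)] by simp
qed

lemma ac_on_exp: "ac_on c d (\<lambda>x. exp (L * x)) (\<lambda>x. L * exp (L * x))"
proof (rule ac_on_C1)
  show "((\<lambda>x. exp (L * x)) has_real_derivative L * exp (L * x)) (at x within {c..d})" for x
    by (auto intro!: derivative_eq_intros)
  show "continuous_on {c..d} (\<lambda>x. L * exp (L * x))"
    by (intro continuous_on_mult continuous_on_const continuous_on_exp continuous_on_id)
qed

lemma exp_deriv_bounded:
  fixes L :: real
  obtains B where "\<And>x. x \<in> {c..d} \<Longrightarrow> \<bar>L * exp (L * x)\<bar> \<le> B"
proof -
  have "continuous_on {c..d} (\<lambda>x. L * exp (L * x))"
    by (intro continuous_on_mult continuous_on_const continuous_on_exp continuous_on_id)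
  then obtain B where "\<And>x. x \<in> {c..d} \<Longrightarrow> \<bar>L * exp (L * x)\<bar> \<le> B"
    by (rule continuous_bounded_Icc) blast
  then show ?thesis by (rule that)
qed

text \<open>\<open>E x * exp (L * x)\<close> is nondecreasing and \<open>E x * exp (- L * x)\<close>
  is nonincreasing; the first carries a zero of the nonnegative \<open>E\<close> to the left, the
  second to the right.\<close>

lemma gronwall_zero:
  assumes E: "ac_on c d E e"
    and b: "\<And>x. x \<in> {c..d} \<Longrightarrow> 0 \<le> E x" "\<And>x. x \<in> {c..d} \<Longrightarrow> \<bar>e x\<bar> \<le> L * E x"
    and z: "z \<in> {c..d}" "E z = 0" and x: "x \<in> {c..d}"
  shows "E x = 0"
proof -
  have key: "0 \<le> e y * exp (L * y) + E y * (L * exp (L * y))"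
    "0 \<le> - 1 * (e y * exp (- L * y) + E y * (- L * exp (- L * y)))" if "y \<in> {c..d}" for y
  proof -
    have *: "0 \<le> (e y + L * E y) * exp (L * y)" "0 \<le> (L * E y - e y) * exp (- L * y)"
      using b(2)[OF that] by (auto simp: abs_le_iff)
    then show "0 \<le> e y * exp (L * y) + E y * (L * exp (L * y))"
      "0 \<le> - 1 * (e y * exp (- L * y) + E y * (- L * exp (- L * y)))"
      by (simp_all add: algebra_simps)
  qed
  obtain B where B: "\<And>x. x \<in> {c..d} \<Longrightarrow> \<bar>L * exp (L * x)\<bar> \<le> B"
    using exp_deriv_bounded[of c d L] by blast
  obtain B' where B': "\<And>x. x \<in> {c..d} \<Longrightarrow> \<bar>- L * exp (- L * x)\<bar> \<le> B'"
    using exp_deriv_bounded[of c d "- L"] by blast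
  have "E x \<le> 0"
  proof (cases "x \<le> z")
    case True
    have "E x * exp (L * x) \<le> E z * exp (L * z)"
      by (rule ac_on_mono[OF ac_on_mult[OF E ac_on_exp B] key(1)]) (use True z x in auto)
    then show ?thesis using z by (simp add: mult_le_0_iff)
  next
    case False
    have "- 1 * (E z * exp (- L * z)) \<le> - 1 * (E x * exp (- L * x))"
      by (rule ac_on_mono[OF ac_on_cmult[OF ac_on_mult[OF E ac_on_exp B']] key(2)]) (use False z x in auto)
    then show ?thesis using z by (simp add: mult_le_0_iff)
  qed
  then show ?thesis using b(1)[OF x] by simp
qed

text \<open>The right-hand side is at most linear in \<open>u\<close>, so
  \<open>u\<^sup>2 + p\<^sup>2\<close> satisfies a Gronwall inequality. Consequently a nontrivial
  solution crosses zero with nonzero slope.\<close>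

lemma regular_solution_no_double_zero:
  assumes M: "bounded_weight a b M" and N: "bounded_weight a b N" and "0 \<le> a" "0 \<le> \<alpha>" "0 \<le> \<beta>"
    and reg: "regular_solution l M N \<alpha> \<beta> u p"
    and z: "z \<in> {0..l}" "u z = 0" "p z = 0" and x: "x \<in> {0..l}"
  shows "u x = 0"
proof -
  let ?r = "\<lambda>x. jump_rhs M N \<alpha> \<beta> x (u x)"
  have u: "ac_on 0 l u p" and p: "ac_on 0 l p (\<lambda>x. - ?r x)"
    using reg by (auto simp: regular_solution_def)
  have cp: "continuous_on {0..l} p" by (rule ac_on_continuous[OF p])
  have cu: "continuous_on {0..l} u" by (rule ac_on_continuous[OF u])
  define K where "K = (\<alpha> + \<beta>) * b"
  have "0 \<le> b" using M \<open>0 \<le> a\<close> by (auto simp: bounded_weight_def intro: order_trans)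
  then have K: "0 \<le> K" using assms(4,5) by (simp add: K_def)
  have rb: "\<bar>?r x\<bar> \<le> K * \<bar>u x\<bar>" for x
    using jump_rhs_bound[OF M N assms(3-5)] by (simp add: K_def)
  obtain B where B: "\<And>x. x \<in> {0..l} \<Longrightarrow> \<bar>u x\<bar> \<le> B"
    using continuous_bounded_Icc[OF cu] by blast
  obtain Bp where Bp: "\<And>x. x \<in> {0..l} \<Longrightarrow> \<bar>p x\<bar> \<le> Bp"
    using continuous_bounded_Icc[OF cp] by blast
  have rB: "\<bar>- ?r x\<bar> \<le> K * B" if "x \<in> {0..l}" for x
    using rb[of x] mult_left_mono[OF B[OF that] K] by simp
  have E: "ac_on 0 l (\<lambda>x. u x * u x + p x * p x)
      (\<lambda>x. (p x * u x + u x * p x) + (- ?r x * p x + p x * - ?r x))"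
    by (intro ac_on_add ac_on_mult[OF u u Bp] ac_on_mult[OF p p rB])
  have "u x * u x + p x * p x = 0"
  proof (rule gronwall_zero[OF E _ _ z(1) _ x])
    fix y
    have "2 * \<bar>u y\<bar> * \<bar>p y\<bar> \<le> \<bar>u y\<bar>\<^sup>2 + \<bar>p y\<bar>\<^sup>2" by (rule sum_squares_bound)
    then have up: "2 * (\<bar>u y\<bar> * \<bar>p y\<bar>) \<le> u y * u y + p y * p y" by (simp add: power2_eq_square)
    have "\<bar>(p y * u y + u y * p y) + (- ?r y * p y + p y * - ?r y)\<bar>
        \<le> 2 * (\<bar>u y\<bar> * \<bar>p y\<bar>) + 2 * (\<bar>?r y\<bar> * \<bar>p y\<bar>)"
      unfolding abs_mult[symmetric] by (auto simp: abs_if mult.commute)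
    also have "\<bar>?r y\<bar> * \<bar>p y\<bar> \<le> K * \<bar>u y\<bar> * \<bar>p y\<bar>" using rb by (intro mult_right_mono) auto
    also have "2 * (\<bar>u y\<bar> * \<bar>p y\<bar>) + 2 * (K * \<bar>u y\<bar> * \<bar>p y\<bar>) = (1 + K) * (2 * (\<bar>u y\<bar> * \<bar>p y\<bar>))"
      by (simp add: algebra_simps)
    also have "\<dots> \<le> (1 + K) * (u y * u y + p y * p y)" using up K by (intro mult_left_mono) auto
    finally show "\<bar>(p y * u y + u y * p y) + (- ?r y * p y + p y * - ?r y)\<bar> \<le> (1 + K) * (u y * u y + p y * p y)"
      by simp
  qed (use z in auto)
  then show ?thesis
    by (metis add_nonneg_eq_0_iff mult_eq_0_iff zero_le_square)
qed

lemma finite_set_increasing_enumeration: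
  fixes Z :: "'a::linorder set"
  assumes "finite Z" "card Z = Suc (Suc k)" "c \<in> Z" "d \<in> Z" "Z \<subseteq> {c..d}"
  shows "\<exists>z. z 0 = c \<and> z (Suc k) = d \<and> (\<forall>i\<le>k. z i < z (Suc i)) \<and>
    (\<forall>i\<le>k. \<forall>x. z i < x \<longrightarrow> x < z (Suc i) \<longrightarrow> x \<notin> Z) \<and> (\<forall>i\<le>Suc k. z i \<in> Z)"
proof -
  define L where "L = sorted_list_of_set Z"
  have L: "set L = Z" "length L = Suc (Suc k)" "sorted_wrt (<) L"
    using assms by (auto simp: L_def strict_sorted_list_of_set)
  have lt: "L ! i < L ! j" if "i < j" "j \<le> Suc k" for i j
    using L(2,3) that by (simp add: sorted_wrt_nth_less)
  have mem: "L ! i \<in> Z" if "i \<le> Suc k" for i using L that by (metis le_imp_less_Suc nth_mem)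
  have ex: "\<exists>j\<le>Suc k. x = L ! j" if "x \<in> Z" for x
    using that L by (metis in_set_conv_nth less_Suc_eq_le)
  show ?thesis
  proof (intro exI[of _ "\<lambda>i. L ! i"] conjI allI impI)
    obtain j where j: "j \<le> Suc k" "c = L ! j" using ex[OF assms(3)] by blast
    show "L ! 0 = c"
      using j lt[of 0 j] mem[of 0] assms(5) by (cases "j = 0") (auto simp: not_less[symmetric] subset_iff)
    obtain j' where j': "j' \<le> Suc k" "d = L ! j'" using ex[OF assms(4)] by blast
    show "L ! Suc k = d"
      using j' lt[of j' "Suc k"] mem[of "Suc k"] assms(5)
      by (cases "j' = Suc k") (auto simp: not_less[symmetric] subset_iff)
    show "L ! i < L ! Suc i" if "i \<le> k" for i using lt[of i "Suc i"] that by auto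
    show "L ! i \<in> Z" if "i \<le> Suc k" for i using mem that .
    fix i x assume i: "i \<le> k" "L ! i < x" "x < L ! Suc i"
    show "x \<notin> Z"
    proof
      assume "x \<in> Z"
      then obtain j where j: "j \<le> Suc k" "x = L ! j" using ex by blast
      show False
      proof (cases "j \<le> i")
        case True
        then show False using lt[of j i] i j by (cases "j = i") auto
      next
        case False
        then show False using lt[of "Suc i" j] i j by (cases "j = Suc i") auto
      qed
    qed
  qed
qed

lemma positive_between_zeros:
  fixes f :: "real \<Rightarrow> real"
  assumes f: "continuous_on {c..d} f" and nz: "\<And>x. c < x \<Longrightarrow> x < d \<Longrightarrow> f x \<noteq> 0"
    and y: "c < y" "y < d" "0 < f y" and x: "c < x" "x < d"
  shows "0 < f x"
proof (rule ccontr)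
  assume "\<not> 0 < f x"
  then have fx: "f x < 0" using nz[OF x] by auto
  have sub: "continuous_on {min x y..max x y} f" using f x y by (auto elim!: continuous_on_subset)
  show False
  proof (cases "x \<le> y")
    case True
    then show False using IVT'[of f x 0 y] fx y x sub nz by (auto simp: min_def max_def)
  next
    case False
    then show False using IVT2'[of f x 0 y] fx y x sub nz by (auto simp: min_def max_def)
  qed
qed

text \<open>The endpoints are counted among the zeros: \<open>k\<close> interior zeros give points
  \<open>z 0, ..., z (Suc k)\<close> and \<open>k + 1\<close> nodal intervals, indexed from 0, with
  alternating signs starting from \<open>s\<close>.\<close>

definition nodal_solution ::
  "real \<Rightarrow> (real \<Rightarrow> real) \<Rightarrow> (real \<Rightarrow> real) \<Rightarrow> real \<Rightarrow> real \<Rightarrow> nat \<Rightarrow> real \<Rightarrow>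
   (real \<Rightarrow> real) \<Rightarrow> (real \<Rightarrow> real) \<Rightarrow> (nat \<Rightarrow> real) \<Rightarrow> bool" where
  "nodal_solution l M N \<alpha> \<beta> k s u p z \<longleftrightarrow> regular_solution l M N \<alpha> \<beta> u p \<and>
     z 0 = 0 \<and> z (Suc k) = l \<and> (\<forall>i\<le>k. z i < z (Suc i)) \<and> (\<forall>i\<le>Suc k. z i \<in> {0..l} \<and> u (z i) = 0) \<and>
     (\<forall>i\<le>k. \<forall>x. z i < x \<longrightarrow> x < z (Suc i) \<longrightarrow> 0 < s * (- 1) ^ i * u x)"

text \<open>The signs alternate by induction on the slopes at the zeros. After normalisation a
  positive slope makes \<open>u\<close> positive up to the next zero; there the slope cannot be
  positive, nor zero by uniqueness, so it is negative.\<close>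

lemma fucik_curve_nodal_solution:
  assumes M: "bounded_weight a b M" and N: "bounded_weight a b N" and "0 \<le> a" "0 < l" "s \<in> {1, - 1}"
    and curve: "(\<alpha>, \<beta>) \<in> fucik_curve l M N k s"
  shows "\<exists>u p z. nodal_solution l M N \<alpha> \<beta> k s u p z"
proof -
  obtain u D where weak: "weak_solution l M N \<alpha> \<beta> u" and nontriv: "\<exists>x\<in>{0..l}. u x \<noteq> 0"
    and fin: "finite {x \<in> {0<..<l}. u x = 0}" and card: "card {x \<in> {0<..<l}. u x = 0} = k"
    and D: "(u has_real_derivative D) (at 0 within {0..l})" "0 < s * D" and ab: "0 \<le> \<alpha>" "0 \<le> \<beta>"
    using curve unfolding fucik_curve_def by blast
  obtain p where reg: "regular_solution l M N \<alpha> \<beta> u p"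
    using weak_solution_regular[OF M N assms(3) ab \<open>0 < l\<close> weak] by blast
  have u: "ac_on 0 l u p" and p: "ac_on 0 l p (\<lambda>x. - jump_rhs M N \<alpha> \<beta> x (u x))" and u0: "u 0 = 0" "u l = 0"
    using reg by (auto simp: regular_solution_def)
  have cp: "continuous_on {0..l} p" by (rule ac_on_continuous[OF p])
  have cu: "continuous_on {0..l} u" by (rule ac_on_continuous[OF u])
  have du: "(u has_real_derivative p x) (at x within {0..l})" if "x \<in> {0..l}" for x
    by (rule ac_on_has_derivative[OF u cp that])
  have "D = p 0"
  proof (rule has_field_derivative_unique[OF D(1) du])
    show "at (0::real) within {0..l} \<noteq> bot" using \<open>0 < l\<close> by (simp add: trivial_limit_within islimpt_Icc)
  qed (use \<open>0 < l\<close> in auto)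
  then have p0: "0 < s * p 0" using D by simp
  let ?Z = "{x \<in> {0..l}. u x = 0}"
  have Z: "?Z = insert 0 (insert l {x \<in> {0<..<l}. u x = 0})" using u0 \<open>0 < l\<close> by force
  have "finite ?Z" unfolding Z using fin by simp
  moreover have "card ?Z = Suc (Suc k)" unfolding Z using fin card \<open>0 < l\<close> by simp
  moreover have "0 \<in> ?Z" "l \<in> ?Z" "?Z \<subseteq> {0..l}" using u0 \<open>0 < l\<close> by auto
  ultimately obtain z where z: "z 0 = 0" "z (Suc k) = l" "\<And>i. i \<le> k \<Longrightarrow> z i < z (Suc i)"
    "\<And>i x. i \<le> k \<Longrightarrow> z i < x \<Longrightarrow> x < z (Suc i) \<Longrightarrow> x \<notin> ?Z" "\<And>i. i \<le> Suc k \<Longrightarrow> z i \<in> ?Z"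
    using finite_set_increasing_enumeration[of ?Z k 0 l] by blast
  have hump: "\<And>x. z i < x \<Longrightarrow> x < z (Suc i) \<Longrightarrow> 0 < s * (- 1) ^ i * u x"
    if i: "i \<le> k" and pi: "0 < s * (- 1) ^ i * p (z i)" for i
  proof -
    have zz: "z i \<in> {0..l}" "u (z i) = 0" "z (Suc i) \<in> {0..l}" using z(5)[of i] z(5)[of "Suc i"] i by auto
    have "((\<lambda>x. s * (- 1) ^ i * u x) has_real_derivative s * (- 1) ^ i * p (z i)) (at (z i) within {0..l})"
      by (intro DERIV_cmult du zz)
    from has_real_derivative_pos_inc_right[OF this pi]
    obtain e where e: "0 < e" "\<And>h. 0 < h \<Longrightarrow> z i + h \<in> {0..l} \<Longrightarrow> h < e \<Longrightarrow> 0 < s * (- 1) ^ i * u (z i + h)"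
      using zz by auto
    define h where "h = min e (z (Suc i) - z i) / 2"
    have h: "0 < h" "h < e" "z i + h < z (Suc i)" using e(1) z(3)[OF i] by (auto simp: h_def min_def field_simps)
    fix x assume x: "z i < x" "x < z (Suc i)"
    show "0 < s * (- 1) ^ i * u x"
    proof (rule positive_between_zeros[where f = "\<lambda>x. s * (- 1) ^ i * u x" and c = "z i" and d = "z (Suc i)" and y = "z i + h"])
      show "continuous_on {z i..z (Suc i)} (\<lambda>x. s * (- 1) ^ i * u x)"
        using zz by (intro continuous_intros continuous_on_subset[OF cu]) auto
      show "0 < s * (- 1) ^ i * u (z i + h)" using e(2)[of h] h zz by auto
      show "s * (- 1) ^ i * u x \<noteq> 0" if "z i < x" "x < z (Suc i)" for x
        using z(4)[OF i that] that zz \<open>s \<in> {1, - 1}\<close> by auto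
    qed (use h x in auto)
  qed
  have slope: "0 < s * (- 1) ^ i * p (z i)" if "i \<le> k" for i
    using that
  proof (induction i)
    case 0
    then show ?case using p0 z(1) by simp
  next
    case (Suc i)
    then have i: "i \<le> k" and pi: "0 < s * (- 1) ^ i * p (z i)" by auto
    note pos = hump[OF i pi]
    have zz: "z (Suc i) \<in> {0..l}" "u (z (Suc i)) = 0" "z i \<in> {0..l}" "z i < z (Suc i)"
      using z(5)[of i] z(5)[of "Suc i"] z(3)[of i] i by auto
    have "\<not> 0 < s * (- 1) ^ i * p (z (Suc i))"
    proof
      assume "0 < s * (- 1) ^ i * p (z (Suc i))"
      moreover have "((\<lambda>x. s * (- 1) ^ i * u x) has_real_derivative s * (- 1) ^ i * p (z (Suc i))) (at (z (Suc i)) within {0..l})"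
        by (intro DERIV_cmult du zz)
      ultimately obtain e where e: "0 < e"
        "\<And>h. 0 < h \<Longrightarrow> z (Suc i) - h \<in> {0..l} \<Longrightarrow> h < e \<Longrightarrow> s * (- 1) ^ i * u (z (Suc i) - h) < 0"
        using has_real_derivative_pos_inc_left[of "\<lambda>x. s * (- 1) ^ i * u x" _ "z (Suc i)" "{0..l}"] zz by auto
      define h where "h = min e (z (Suc i) - z i) / 2"
      have h: "0 < h" "h < e" "z i < z (Suc i) - h" using e(1) zz(4) by (auto simp: h_def min_def field_simps)
      then show False using e(2)[of h] pos[of "z (Suc i) - h"] zz by auto
    qed
    \<comment> \<open>Here nontriviality of \<open>u\<close> is used: a double zero would force
      \<open>u\<close> to vanish on all of \<open>[0, l]\<close>.\<close>
    moreover have "p (z (Suc i)) \<noteq> 0"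
      using regular_solution_no_double_zero[OF M N assms(3) ab reg zz(1,2)] nontriv by blast
    then have "s * (- 1) ^ i * p (z (Suc i)) \<noteq> 0" using \<open>s \<in> {1, - 1}\<close> by auto
    ultimately have "s * (- 1) ^ i * p (z (Suc i)) < 0" by linarith
    then show ?case by simp
  qed
  have "nodal_solution l M N \<alpha> \<beta> k s u p z"
    unfolding nodal_solution_def
  proof (intro conjI allI impI reg z(1,2,3))
    show "z i \<in> {0..l}" "u (z i) = 0" if "i \<le> Suc k" for i using z(5)[OF that] by auto
    show "0 < s * (- 1) ^ i * u x" if "i \<le> k" "z i < x" "x < z (Suc i)" for i x
      by (rule hump[OF that(1) slope[OF that(1)] that(2,3)])
  qed
  then show ?thesis by blast
qed

text \<open>If no interval were nested, \<open>y i \<le> z i\<close> would always imply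
  \<open>y (Suc i) < z (Suc i)\<close>. Starting from the common left endpoint this would separate
  the right endpoints.\<close>

lemma nested_nodal_interval:
  fixes y z :: "nat \<Rightarrow> 'a::linorder"
  assumes "y 0 = z 0" "y (Suc k) = z (Suc k)"
  shows "\<exists>i\<le>k. y i \<le> z i \<and> z (Suc i) \<le> y (Suc i)"
proof (rule ccontr)
  assume "\<not> ?thesis"
  then have step: "y i \<le> z i \<Longrightarrow> y (Suc i) < z (Suc i)" if "i \<le> k" for i
    using that by (metis not_le)
  have "i \<le> k \<Longrightarrow> y i \<le> z i" for i
    using step by (induction i) (auto simp: assms(1) intro: less_imp_le)
  then show False using step[of k] assms(2) by auto
qed

section \<open>Comparison of eigenvalues on nodal intervals\<close>

lemma weight_mult_integrable:
  assumes "bounded_weight a b w" "continuous_on {c..d} f"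
  shows "(\<lambda>x. w x * f x) integrable_on {c..d}"
  by (rule set_lebesgue_integral_eq_integral(1)[OF abs_integrable_mult_cont[OF assms(2) bounded_weight_abs_integrable[OF assms(1)]]])

text \<open>
  Picone's identity with \<open>u + e\<close> in place of \<open>u\<close>: the boundary terms then vanish even where
  \<open>u = 0\<close>, and \<open>e \<rightarrow> 0\<close> is a dominated limit.
\<close>

lemma weighted_integral_le_energy:
  assumes w: "bounded_weight a b w" and "0 \<le> a" "0 \<le> \<Lambda>" and cd: "c < d"
    and u: "ac_on c d u p" and p: "ac_on c d p (\<lambda>x. - (\<Lambda> * w x * u x))"
    and pos: "\<And>x. x \<in> {c..d} \<Longrightarrow> 0 \<le> u x" "\<And>x. c < x \<Longrightarrow> x < d \<Longrightarrow> 0 < u x"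
    and \<phi>: "\<And>x. x \<in> {c..d} \<Longrightarrow> (\<phi> has_real_derivative \<phi>' x) (at x within {c..d})"
    and c': "continuous_on {c..d} \<phi>'" and \<phi>0: "\<phi> c = 0" "\<phi> d = 0"
  shows "\<Lambda> * integral {c..d} (\<lambda>x. w x * (\<phi> x)\<^sup>2) \<le> integral {c..d} (\<lambda>x. (\<phi>' x)\<^sup>2)"
proof -
  have cu: "continuous_on {c..d} u" by (rule ac_on_continuous[OF u])
  have cp: "continuous_on {c..d} p" by (rule ac_on_continuous[OF p])
  have c\<phi>: "continuous_on {c..d} \<phi>"
    using \<phi> DERIV_continuous by (metis continuous_on_eq_continuous_within)
  have du: "(u has_real_derivative p x) (at x within {c..d})" if "x \<in> {c..d}" for x
    by (rule ac_on_has_derivative[OF u cp that])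
  have wi: "(\<lambda>x. w x * ((\<phi> x)\<^sup>2 * (u x / (u x + e)))) integrable_on {c..d}" if "0 < e" for e
    using pos(1) that by (intro weight_mult_integrable[OF w] continuous_intros c\<phi> cu) (auto simp: add_nonneg_pos less_imp_neq dest!: pos(1))
  have approx: "\<Lambda> * integral {c..d} (\<lambda>x. w x * ((\<phi> x)\<^sup>2 * (u x / (u x + e)))) \<le> integral {c..d} (\<lambda>x. (\<phi>' x)\<^sup>2)"
    if e: "0 < e" for e
  proof -
    have ne: "u x + e \<noteq> 0" "0 < u x + e" if "x \<in> {c..d}" for x using pos(1)[OF that] e by auto
    \<comment> \<open>This is Picone's test function; multiplying the equation for \<open>p\<close>
      by it and integrating by parts leaves no boundary term because \<open>\<phi>\<close> vanishes
      at both ends.\<close>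
    define g where "g = (\<lambda>x. (\<phi> x)\<^sup>2 / (u x + e))"
    define g' where "g' = (\<lambda>x. 2 * \<phi> x * \<phi>' x / (u x + e) - (\<phi> x)\<^sup>2 * p x / (u x + e)\<^sup>2)"
    have cg': "continuous_on {c..d} g'"
      unfolding g'_def by (intro continuous_intros c\<phi> c' cu cp) (use ne in auto)
    have g: "ac_on c d g g'"
    proof (rule ac_on_C1[OF _ cg'])
      fix x assume x: "x \<in> {c..d}"
      show "(g has_real_derivative g' x) (at x within {c..d})"
        unfolding g_def
      proof (rule DERIV_cong)
        show "((\<lambda>x. (\<phi> x)\<^sup>2 / (u x + e)) has_real_derivative
            (2 * \<phi> x * \<phi>' x * (u x + e) - (\<phi> x)\<^sup>2 * p x) / ((u x + e) * (u x + e))) (at x within {c..d})"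
          by (intro DERIV_divide ne(1)[OF x]) (auto intro!: derivative_eq_intros \<phi>[OF x] du[OF x])
        show "(2 * \<phi> x * \<phi>' x * (u x + e) - (\<phi> x)\<^sup>2 * p x) / ((u x + e) * (u x + e)) = g' x"
          using ne(1)[OF x] by (simp add: g'_def diff_divide_distrib power2_eq_square)
      qed
    qed
    obtain B where B: "\<And>x. x \<in> {c..d} \<Longrightarrow> \<bar>g' x\<bar> \<le> B"
      using continuous_bounded_Icc[OF cg'] by blast
    note parts = integral_mult_parts[OF p g B less_imp_le[OF cd], simplified]
    have gz: "g c = 0" "g d = 0" using \<phi>0 by (auto simp: g_def)
    have "\<Lambda> * integral {c..d} (\<lambda>x. w x * ((\<phi> x)\<^sup>2 * (u x / (u x + e))))
        = integral {c..d} (\<lambda>x. \<Lambda> * (w x * ((\<phi> x)\<^sup>2 * (u x / (u x + e)))))"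
      by (rule Henstock_Kurzweil_Integration.integral_mult_right[symmetric])
    also have "(\<lambda>x. \<Lambda> * (w x * ((\<phi> x)\<^sup>2 * (u x / (u x + e))))) = (\<lambda>x. \<Lambda> * w x * u x * g x)"
      by (auto simp: g_def)
    also have "integral {c..d} (\<lambda>x. \<Lambda> * w x * u x * g x) = integral {c..d} (\<lambda>x. p x * g' x)"
      using parts(3) gz by simp
    also have "\<dots> \<le> integral {c..d} (\<lambda>x. (\<phi>' x)\<^sup>2)"
    proof (rule integral_le)
      show "(\<lambda>x. p x * g' x) integrable_on {c..d}" "(\<lambda>x. (\<phi>' x)\<^sup>2) integrable_on {c..d}"
        by (intro integrable_continuous_real continuous_intros cp cg' c')+
      fix x assume x: "x \<in> {c..d}"
      \<comment> \<open>With \<open>q = \<phi> x * p x / (u x + e)\<close> this is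
        \<open>2 * \<phi>' x * q - q\<^sup>2\<close>, and the missing square is
        \<open>(\<phi>' x - q)\<^sup>2\<close>.\<close>
      have "p x * g' x = 2 * \<phi>' x * (\<phi> x * p x / (u x + e)) - (\<phi> x * p x / (u x + e))\<^sup>2"
        using ne[OF x] by (simp add: g'_def field_simps power2_eq_square)
      also have "\<dots> \<le> (\<phi>' x)\<^sup>2" using sum_squares_bound[of "\<phi>' x" "\<phi> x * p x / (u x + e)"] by simp
      finally show "p x * g' x \<le> (\<phi>' x)\<^sup>2" .
    qed
    finally show ?thesis .
  qed
  have "(\<lambda>n. integral {c..d} (\<lambda>x. w x * ((\<phi> x)\<^sup>2 * (u x / (u x + inverse (real (Suc n)))))))
      \<longlonglongrightarrow> integral {c..d} (\<lambda>x. w x * (\<phi> x)\<^sup>2)"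
  proof (rule dominated_convergence(2))
    show "(\<lambda>x. w x * ((\<phi> x)\<^sup>2 * (u x / (u x + inverse (real (Suc n)))))) integrable_on {c..d}" for n
      by (rule wi) simp
    show "(\<lambda>x. w x * (\<phi> x)\<^sup>2) integrable_on {c..d}"
      by (intro weight_mult_integrable[OF w] continuous_intros c\<phi>)
    have w0: "0 \<le> w x" for x using w \<open>0 \<le> a\<close> by (auto simp: bounded_weight_def intro: order_trans)
    show "norm (w x * ((\<phi> x)\<^sup>2 * (u x / (u x + inverse (real (Suc n)))))) \<le> w x * (\<phi> x)\<^sup>2"
      if "x \<in> {c..d}" for n x
    proof -
      have "0 \<le> u x / (u x + inverse (real (Suc n)))" "u x / (u x + inverse (real (Suc n))) \<le> 1"
        using pos(1)[OF that] by (auto simp: divide_le_eq_1 add_nonneg_pos)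
      then have "0 \<le> (\<phi> x)\<^sup>2 * (u x / (u x + inverse (real (Suc n))))"
          "(\<phi> x)\<^sup>2 * (u x / (u x + inverse (real (Suc n)))) \<le> (\<phi> x)\<^sup>2 * 1"
        by (auto intro!: mult_nonneg_nonneg mult_left_mono simp del: times_divide_eq_right mult_1_right)
      then show ?thesis
        unfolding real_norm_def using w0[of x]
        by (subst abs_of_nonneg) (auto intro!: mult_nonneg_nonneg mult_left_mono simp del: times_divide_eq_right)
    qed
    fix x assume x: "x \<in> {c..d}"
    show "(\<lambda>n. w x * ((\<phi> x)\<^sup>2 * (u x / (u x + inverse (real (Suc n)))))) \<longlonglongrightarrow> w x * (\<phi> x)\<^sup>2"
    proof (cases "\<phi> x = 0")
      case False
      \<comment> \<open>Where \<open>\<phi>\<close> does not vanish, \<open>x\<close> is an interior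
        point, so the quotient tends to 1; at the remaining points the limit is trivial.\<close>
      then have "0 < u x" using pos(2)[of x] x \<phi>0 by (metis atLeastAtMost_iff less_le)
      then have "(\<lambda>n. w x * ((\<phi> x)\<^sup>2 * (u x / (u x + inverse (real (Suc n)))))) \<longlonglongrightarrow> w x * ((\<phi> x)\<^sup>2 * (u x / (u x + 0)))"
        by (intro tendsto_intros LIMSEQ_inverse_real_of_nat) auto
      then show ?thesis using \<open>0 < u x\<close> by simp
    qed simp
  qed
  then have "(\<lambda>n. \<Lambda> * integral {c..d} (\<lambda>x. w x * ((\<phi> x)\<^sup>2 * (u x / (u x + inverse (real (Suc n)))))))
      \<longlonglongrightarrow> \<Lambda> * integral {c..d} (\<lambda>x. w x * (\<phi> x)\<^sup>2)"
    by (intro tendsto_mult_left)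
  then show ?thesis
    by (rule LIMSEQ_le_const2) (intro exI[of _ 0] allI impI approx, simp)
qed

definition hump ::
  "(real \<Rightarrow> real) \<Rightarrow> real \<Rightarrow> real \<Rightarrow> real \<Rightarrow> (real \<Rightarrow> real) \<Rightarrow> (real \<Rightarrow> real) \<Rightarrow> bool" where
  "hump w \<Lambda> c d u p \<longleftrightarrow> c < d \<and> ac_on c d u p \<and> ac_on c d p (\<lambda>x. - (\<Lambda> * w x * u x)) \<and>
     u c = 0 \<and> u d = 0 \<and> (\<forall>x. c < x \<longrightarrow> x < d \<longrightarrow> 0 < u x)"

lemma hump_energy_le:
  assumes w: "bounded_weight a b w" and "0 \<le> a" "0 \<le> \<Lambda>"
    and h: "hump w \<Lambda> c' d' u p" and sub: "c' \<le> c" "c < d" "d \<le> d'"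
    and \<phi>: "\<And>x. x \<in> {c..d} \<Longrightarrow> (\<phi> has_real_derivative \<phi>' x) (at x within {c..d})"
    and "continuous_on {c..d} \<phi>'" "\<phi> c = 0" "\<phi> d = 0"
  shows "\<Lambda> * integral {c..d} (\<lambda>x. w x * (\<phi> x)\<^sup>2) \<le> integral {c..d} (\<lambda>x. (\<phi>' x)\<^sup>2)"
proof (rule weighted_integral_le_energy[OF w assms(2,3) sub(2)])
  show "ac_on c d u p" "ac_on c d p (\<lambda>x. - (\<Lambda> * w x * u x))"
    using h sub by (auto simp: hump_def intro: ac_on_sub)
  show pos: "0 < u x" if "c < x" "x < d" for x using h sub that by (auto simp: hump_def)
  fix x assume "x \<in> {c..d}"
  then have "x = c' \<or> x = d' \<or> (c' < x \<and> x < d')" using sub by auto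
  then show "0 \<le> u x" using h by (auto simp: hump_def less_imp_le)
qed (use assms in auto)

text \<open>The test function \<open>(x - c) * (d - x)\<close> has energy \<open>L ^ 3 / 3\<close>
  and squared norm \<open>L ^ 5 / 30\<close>, whose quotient is \<open>10 / L\<^sup>2\<close>. The
  constant 10 stands in for the sharp value pi squared and avoids trigonometric integrals.\<close>

lemma hump_length_bound:
  assumes w: "bounded_weight a b w" and "0 < a" "0 \<le> \<Lambda>" and h: "hump w \<Lambda> c d u p"
  shows "\<Lambda> * a * (d - c)\<^sup>2 \<le> 10"
proof -
  define L where "L = d - c"
  have L: "0 < L" using h by (auto simp: L_def hump_def)
  have cd: "c < d" using h by (simp add: hump_def)
  define \<phi> where "\<phi> = (\<lambda>x. (x - c) * (d - x))"
  define \<phi>' where "\<phi>' = (\<lambda>x. c + d - 2 * x)"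
  have "\<Lambda> * integral {c..d} (\<lambda>x. w x * (\<phi> x)\<^sup>2) \<le> integral {c..d} (\<lambda>x. (\<phi>' x)\<^sup>2)"
  proof (rule hump_energy_le[OF w _ \<open>0 \<le> \<Lambda>\<close> h])
    show "(\<phi> has_real_derivative \<phi>' x) (at x within {c..d})" for x
      unfolding \<phi>_def \<phi>'_def by (auto intro!: derivative_eq_intros)
    show "continuous_on {c..d} \<phi>'" unfolding \<phi>'_def by (intro continuous_intros)
  qed (use \<open>0 < a\<close> cd in \<open>auto simp: \<phi>_def\<close>)
  also have "integral {c..d} (\<lambda>x. (\<phi>' x)\<^sup>2) = L ^ 3 / 3"
  proof (rule integral_unique)
    have "((\<lambda>x. (\<phi>' x)\<^sup>2) has_integral (2 * d - c - d) ^ 3 / 6 - (2 * c - c - d) ^ 3 / 6) {c..d}"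
    proof (rule fundamental_theorem_of_calculus)
      show "((\<lambda>x. (2 * x - c - d) ^ 3 / 6) has_vector_derivative (\<phi>' x)\<^sup>2) (at x within {c..d})" for x
        unfolding \<phi>'_def has_real_derivative_iff_has_vector_derivative[symmetric]
        by (auto intro!: derivative_eq_intros simp: power2_eq_square field_simps)
    qed (use cd in auto)
    moreover have "(2 * d - c - d) ^ 3 / 6 - (2 * c - c - d) ^ 3 / 6 = L ^ 3 / 3"
    proof -
      have "2 * d - c - d = L" "2 * c - c - d = - L" by (auto simp: L_def)
      then show ?thesis by (simp only: power_minus_odd odd_numeral) simp
    qed
    ultimately show "((\<lambda>x. (\<phi>' x)\<^sup>2) has_integral L ^ 3 / 3) {c..d}" by (simp only:)
  qed
  finally have 1: "\<Lambda> * integral {c..d} (\<lambda>x. w x * (\<phi> x)\<^sup>2) \<le> L ^ 3 / 3" .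
  have c\<phi>: "continuous_on {c..d} \<phi>" unfolding \<phi>_def by (intro continuous_intros)
  have "a * integral {c..d} (\<lambda>x. (\<phi> x)\<^sup>2) = integral {c..d} (\<lambda>x. a * (\<phi> x)\<^sup>2)" by simp
  also have "\<dots> \<le> integral {c..d} (\<lambda>x. w x * (\<phi> x)\<^sup>2)"
    using w by (intro integral_le weight_mult_integrable[OF w] continuous_intros c\<phi> integrable_continuous_real)
      (auto simp: bounded_weight_def intro!: mult_right_mono)
  finally have "a * integral {c..d} (\<lambda>x. (\<phi> x)\<^sup>2) \<le> integral {c..d} (\<lambda>x. w x * (\<phi> x)\<^sup>2)" .
  moreover have "integral {c..d} (\<lambda>x. (\<phi> x)\<^sup>2) = L ^ 5 / 30"
  proof (rule integral_unique)
    let ?F = "\<lambda>x. L\<^sup>2 * (x - c) ^ 3 / 3 - L * (x - c) ^ 4 / 2 + (x - c) ^ 5 / 5"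
    have "((\<lambda>x. (\<phi> x)\<^sup>2) has_integral ?F d - ?F c) {c..d}"
    proof (rule fundamental_theorem_of_calculus)
      fix x
      have "(\<phi> x)\<^sup>2 = (x - c)\<^sup>2 * (L - (x - c))\<^sup>2" by (simp add: \<phi>_def L_def power_mult_distrib)
      also have "\<dots> = L\<^sup>2 * (x - c)\<^sup>2 - 2 * L * (x - c) ^ 3 + (x - c) ^ 4" by algebra
      finally have eq: "(\<phi> x)\<^sup>2 = L\<^sup>2 * (x - c)\<^sup>2 - 2 * L * (x - c) ^ 3 + (x - c) ^ 4" .
      show "(?F has_vector_derivative (\<phi> x)\<^sup>2) (at x within {c..d})"
        unfolding eq has_real_derivative_iff_has_vector_derivative[symmetric]
        by (auto intro!: derivative_eq_intros)
    qed (use cd in auto)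
    moreover have "?F d - ?F c = L ^ 5 / 30"
      by (simp add: L_def[symmetric] field_simps) algebra
    ultimately show "((\<lambda>x. (\<phi> x)\<^sup>2) has_integral L ^ 5 / 30) {c..d}" by (simp only:)
  qed
  ultimately have "a * (L ^ 5 / 30) \<le> integral {c..d} (\<lambda>x. w x * (\<phi> x)\<^sup>2)" by (simp only:)
  then have "\<Lambda> * (a * (L ^ 5 / 30)) \<le> L ^ 3 / 3"
    using order_trans[OF mult_left_mono[OF _ \<open>0 \<le> \<Lambda>\<close>] 1] by blast
  then have "L ^ 3 * (\<Lambda> * a * L\<^sup>2) \<le> L ^ 3 * 10"
    by (simp add: field_simps power2_eq_square eval_nat_numeral)
  then show ?thesis using L by (simp add: L_def)
qed

text \<open>The inner eigenfunction \<open>u1\<close> tests the outer eigenvalue. Integration by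
  parts moves the difference of the weights onto its primitive, which is small even when the
  difference itself is not. With \<open>\<delta> = 0\<close> this is monotonicity of the eigenvalue
  in the interval.\<close>

lemma hump_comparison:
  assumes w1: "bounded_weight a b w1" and w2: "bounded_weight a b w2" and "0 < a" and \<Lambda>: "0 \<le> \<Lambda>1" "0 \<le> \<Lambda>2"
    and h1: "hump w1 \<Lambda>1 c d u1 p1" and h2: "hump w2 \<Lambda>2 c' d' u2 p2" and sub: "c' \<le> c" "d \<le> d'"
    and osc: "\<And>x. x \<in> {c..d} \<Longrightarrow> \<bar>integral {c..x} (\<lambda>y. w1 y - w2 y)\<bar> \<le> \<delta>"
  shows "\<Lambda>2 \<le> \<Lambda>1 + 2 * \<delta> * sqrt b / a * (\<Lambda>1 * sqrt \<Lambda>1)"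
proof -
  have cd: "c < d" and u: "ac_on c d u1 p1" and p: "ac_on c d p1 (\<lambda>x. - (\<Lambda>1 * w1 x * u1 x))"
    and u0: "u1 c = 0" "u1 d = 0" and pos: "\<And>x. c < x \<Longrightarrow> x < d \<Longrightarrow> 0 < u1 x"
    using h1 by (auto simp: hump_def)
  have ab: "a \<le> b" using w1 by (auto simp: bounded_weight_def intro: order_trans)
  have \<delta>: "0 \<le> \<delta>" using osc[of c] cd by simp
  have cu: "continuous_on {c..d} u1" by (rule ac_on_continuous[OF u])
  have cp: "continuous_on {c..d} p1" by (rule ac_on_continuous[OF p])
  have du: "(u1 has_real_derivative p1 x) (at x within {c..d})" if "x \<in> {c..d}" for x
    by (rule ac_on_has_derivative[OF u cp that])
  define I where "I = integral {c..d} (\<lambda>x. (u1 x)\<^sup>2)"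
  define E where "E = integral {c..d} (\<lambda>x. (p1 x)\<^sup>2)"
  have iI: "(\<lambda>x. (u1 x)\<^sup>2) integrable_on {c..d}" and iE: "(\<lambda>x. (p1 x)\<^sup>2) integrable_on {c..d}"
    by (intro integrable_continuous_real continuous_intros cu cp)+
  have iw: "(\<lambda>x. w1 x * (u1 x)\<^sup>2) integrable_on {c..d}" "(\<lambda>x. w2 x * (u1 x)\<^sup>2) integrable_on {c..d}"
    by (intro weight_mult_integrable[OF w1] weight_mult_integrable[OF w2] continuous_intros cu)+
  have I0: "0 < I"
  proof -
    have "I \<noteq> 0"
      using integral_eq_0_iff[of c d "\<lambda>x. (u1 x)\<^sup>2"] cd pos[of "(c + d) / 2"] cu
      by (auto simp: I_def continuous_on_power)
    moreover have "0 \<le> I" unfolding I_def by (rule integral_nonneg[OF iI]) simp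
    ultimately show ?thesis by simp
  qed
  obtain B where B: "\<And>x. x \<in> {c..d} \<Longrightarrow> \<bar>p1 x\<bar> \<le> B"
    using continuous_bounded_Icc[OF cp] by blast
  have E_eq: "E = \<Lambda>1 * integral {c..d} (\<lambda>x. w1 x * (u1 x)\<^sup>2)"
  proof -
    have "integral {c..d} (\<lambda>x. - (\<Lambda>1 * w1 x * u1 x) * u1 x) + integral {c..d} (\<lambda>x. p1 x * p1 x) = 0"
      using integral_mult_parts(3)[OF p u B less_imp_le[OF cd]] u0 by simp
    moreover have "integral {c..d} (\<lambda>x. - (\<Lambda>1 * w1 x * u1 x) * u1 x)
        = integral {c..d} (\<lambda>x. - \<Lambda>1 * (w1 x * (u1 x)\<^sup>2))"
      by (intro Henstock_Kurzweil_Integration.integral_cong) (auto simp: power2_eq_square)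
    moreover have "\<dots> = - \<Lambda>1 * integral {c..d} (\<lambda>x. w1 x * (u1 x)\<^sup>2)"
      by (rule Henstock_Kurzweil_Integration.integral_mult_right)
    ultimately show ?thesis unfolding E_def power2_eq_square[of "p1 _"] by linarith
  qed
  have w1b: "integral {c..d} (\<lambda>x. w1 x * (u1 x)\<^sup>2) \<le> b * I"
  proof -
    have "integral {c..d} (\<lambda>x. w1 x * (u1 x)\<^sup>2) \<le> integral {c..d} (\<lambda>x. b * (u1 x)\<^sup>2)"
      using w1 by (intro integral_le iw integrable_on_mult_right iI)
        (auto simp: bounded_weight_def intro!: mult_right_mono)
    then show ?thesis by (simp add: I_def)
  qed
  have w2a: "a * I \<le> integral {c..d} (\<lambda>x. w2 x * (u1 x)\<^sup>2)"
  proof -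
    have "integral {c..d} (\<lambda>x. a * (u1 x)\<^sup>2) \<le> integral {c..d} (\<lambda>x. w2 x * (u1 x)\<^sup>2)"
      using w2 by (intro integral_le iw integrable_on_mult_right iI)
        (auto simp: bounded_weight_def intro!: mult_right_mono)
    then show ?thesis by (simp add: I_def)
  qed
  \<comment> \<open>With eigenvalue zero the energy would vanish and \<open>u1\<close> would be
    constant, contradicting its zero boundary values; positivity is needed to divide by
    \<open>S\<close> below.\<close>
  have \<Lambda>1: "0 < \<Lambda>1"
  proof (rule ccontr)
    assume "\<not> 0 < \<Lambda>1"
    then have "E = 0" using \<Lambda> E_eq by simp
    then have p0: "p1 x = 0" if "x \<in> {c..d}" for x
      using integral_eq_0_iff[of c d "\<lambda>x. (p1 x)\<^sup>2"] cd cp that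
      by (auto simp: E_def continuous_on_power)
    have "\<bar>u1 ((c + d) / 2) - u1 c\<bar> \<le> 0 * \<bar>(c + d) / 2 - c\<bar>"
      by (rule ac_on_lipschitz[OF u]) (use p0 cd in auto)
    then show False using u0 pos[of "(c + d) / 2"] cd by simp
  qed
  \<comment> \<open>This weight balances the inequality between \<bar>u1 * p1\<bar> and the two
    squares: since \<open>E \<le> S\<^sup>2 * I\<close>, both \<open>S * I\<close> and
    \<open>E / S\<close> are at most \<open>S * I\<close>. It is the source of the power 3/2 of
    \<open>\<Lambda>1\<close>.\<close>
  define S where "S = sqrt (\<Lambda>1 * b)"
  have S: "0 < S" "S * S = \<Lambda>1 * b" using \<Lambda>1 ab \<open>0 < a\<close> by (auto simp: S_def)
  define Q where "Q = (\<lambda>x. 0 + integral {c..x} (\<lambda>y. w1 y - w2 y))"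
  have Q: "ac_on c d Q (\<lambda>y. w1 y - w2 y)"
    unfolding Q_def by (intro ac_on_indefinite_integral set_integral_diff bounded_weight_abs_integrable[OF w1]
        bounded_weight_abs_integrable[OF w2])
  have cuu: "continuous_on {c..d} (\<lambda>x. 2 * u1 x * p1 x)" by (intro continuous_intros cu cp)
  have uu: "ac_on c d (\<lambda>x. (u1 x)\<^sup>2) (\<lambda>x. 2 * u1 x * p1 x)"
    by (rule ac_on_C1[OF _ cuu]) (auto intro!: derivative_eq_intros du)
  obtain B' where B': "\<And>x. x \<in> {c..d} \<Longrightarrow> \<bar>2 * u1 x * p1 x\<bar> \<le> B'"
    using continuous_bounded_Icc[OF cuu] by blast
  have cQ: "continuous_on {c..d} Q" by (rule ac_on_continuous[OF Q])
  have "integral {c..d} (\<lambda>x. (w1 x - w2 x) * (u1 x)\<^sup>2) = - integral {c..d} (\<lambda>x. Q x * (2 * u1 x * p1 x))"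
    using integral_mult_parts(3)[OF Q uu B' less_imp_le[OF cd]] u0 by simp
  also have "\<dots> \<le> \<bar>integral {c..d} (\<lambda>x. Q x * (2 * u1 x * p1 x))\<bar>" by simp
  also have "\<dots> \<le> integral {c..d} (\<lambda>x. \<delta> * (S * (u1 x)\<^sup>2 + (p1 x)\<^sup>2 / S))"
  proof (rule integral_norm_bound_integral[where 'a = real, unfolded real_norm_def])
    show "(\<lambda>x. Q x * (2 * u1 x * p1 x)) integrable_on {c..d}"
      "(\<lambda>x. \<delta> * (S * (u1 x)\<^sup>2 + (p1 x)\<^sup>2 / S)) integrable_on {c..d}"
      using S by (intro integrable_continuous_real continuous_intros cQ cu cp; simp)+
    fix x assume x: "x \<in> {c..d}"
    have "2 * \<bar>S * u1 x\<bar> * \<bar>p1 x\<bar> \<le> \<bar>S * u1 x\<bar>\<^sup>2 + \<bar>p1 x\<bar>\<^sup>2" by (rule sum_squares_bound)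
    then have "S * (2 * \<bar>u1 x\<bar> * \<bar>p1 x\<bar>) \<le> S * (S * (u1 x)\<^sup>2 + (p1 x)\<^sup>2 / S)"
      using S(1) by (simp add: abs_mult power_mult_distrib algebra_simps power2_eq_square)
    then have "2 * \<bar>u1 x\<bar> * \<bar>p1 x\<bar> \<le> S * (u1 x)\<^sup>2 + (p1 x)\<^sup>2 / S" using S(1) by simp
    moreover have "\<bar>Q x\<bar> \<le> \<delta>" using osc[OF x] by (simp add: Q_def)
    ultimately have "\<bar>Q x\<bar> * (2 * \<bar>u1 x\<bar> * \<bar>p1 x\<bar>) \<le> \<delta> * (S * (u1 x)\<^sup>2 + (p1 x)\<^sup>2 / S)"
      using \<delta> by (intro mult_mono) auto
    then show "\<bar>Q x * (2 * u1 x * p1 x)\<bar> \<le> \<delta> * (S * (u1 x)\<^sup>2 + (p1 x)\<^sup>2 / S)"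
      by (simp add: abs_mult)
  qed
  also have "\<dots> = \<delta> * (S * I + E / S)"
  proof -
    have "integral {c..d} (\<lambda>x. S * (u1 x)\<^sup>2 + (p1 x)\<^sup>2 / S)
        = integral {c..d} (\<lambda>x. S * (u1 x)\<^sup>2) + integral {c..d} (\<lambda>x. (p1 x)\<^sup>2 / S)"
      by (intro Henstock_Kurzweil_Integration.integral_add integrable_on_mult_right integrable_on_divide iI iE)
    then show ?thesis by (simp add: I_def E_def)
  qed
  also have "\<dots> \<le> \<delta> * (2 * (S * I))"
  proof (rule mult_left_mono[OF _ \<delta>])
    have "E \<le> \<Lambda>1 * (b * I)" unfolding E_eq using w1b \<Lambda>1 by (intro mult_left_mono) auto
    also have "\<dots> = S * I * S" using S(2) by (simp add: algebra_simps)
    finally have "E / S \<le> S * I" using S(1) by (simp add: divide_le_eq)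
    then show "S * I + E / S \<le> 2 * (S * I)" by linarith
  qed
  finally have 1: "integral {c..d} (\<lambda>x. (w1 x - w2 x) * (u1 x)\<^sup>2) \<le> 2 * \<delta> * S * I" by simp
  let ?J1 = "integral {c..d} (\<lambda>x. w1 x * (u1 x)\<^sup>2)" and ?J2 = "integral {c..d} (\<lambda>x. w2 x * (u1 x)\<^sup>2)"
  have 2: "?J1 - ?J2 \<le> 2 * \<delta> * S * I"
    using 1 iw by (simp add: left_diff_distrib Henstock_Kurzweil_Integration.integral_diff)
  have "\<Lambda>2 * ?J2 \<le> E"
    unfolding E_def
    by (rule hump_energy_le[OF w2 _ \<Lambda>(2) h2 sub(1) cd sub(2) du cp u0]) (use \<open>0 < a\<close> in auto)
  also have "\<dots> \<le> \<Lambda>1 * (?J2 + 2 * \<delta> * S * I)" unfolding E_eq using 2 \<Lambda>1 by (intro mult_left_mono) auto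
  finally have 3: "(\<Lambda>2 - \<Lambda>1) * ?J2 \<le> \<Lambda>1 * (2 * \<delta> * S * I)" by (simp add: algebra_simps)
  have rhs: "2 * \<delta> * sqrt b / a * (\<Lambda>1 * sqrt \<Lambda>1) = \<Lambda>1 * (2 * \<delta> * S) / a"
    by (simp add: S_def real_sqrt_mult)
  show ?thesis
  proof (cases "\<Lambda>2 \<le> \<Lambda>1")
    case True
    moreover have "0 \<le> \<Lambda>1 * (2 * \<delta> * S) / a" using \<Lambda>1 \<delta> S \<open>0 < a\<close> by simp
    ultimately show ?thesis unfolding rhs by linarith
  next
    case False
    \<comment> \<open>Replacing \<open>?J2\<close> by its lower bound \<open>a * I\<close> is
      legitimate only because \<open>\<Lambda>2 - \<Lambda>1\<close> is positive here, hence the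
      case distinction.\<close>
    then have "(\<Lambda>2 - \<Lambda>1) * (a * I) \<le> (\<Lambda>2 - \<Lambda>1) * ?J2" using w2a by (intro mult_left_mono) auto
    with 3 have "((\<Lambda>2 - \<Lambda>1) * a) * I \<le> (\<Lambda>1 * (2 * \<delta> * S)) * I" by (simp add: algebra_simps)
    then have "(\<Lambda>2 - \<Lambda>1) * a \<le> \<Lambda>1 * (2 * \<delta> * S)" using I0 by (simp only: mult_le_cancel_right_pos)
    then have "\<Lambda>2 - \<Lambda>1 \<le> \<Lambda>1 * (2 * \<delta> * S) / a" using \<open>0 < a\<close> by (simp add: le_divide_eq)
    then show ?thesis unfolding rhs by linarith
  qed
qed

text \<open>On a nodal interval only one of the two parts of \<open>u\<close> is present, so after
  multiplication by its sign the jump problem becomes linear.\<close>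

lemma nodal_solution_hump:
  assumes "nodal_solution l M N \<alpha> \<beta> k s u p z" "s \<in> {1, - 1}" "i \<le> k"
  shows "hump (if s * (- 1) ^ i = 1 then M else N) (if s * (- 1) ^ i = 1 then \<alpha> else \<beta>) (z i) (z (Suc i))
     (\<lambda>x. s * (- 1) ^ i * u x) (\<lambda>x. s * (- 1) ^ i * p x)"
proof -
  define \<sigma> where "\<sigma> = s * (- 1) ^ i"
  have \<sigma>: "\<sigma> = 1 \<or> \<sigma> = - 1" using assms(2) by (cases "even i") (auto simp: \<sigma>_def)
  have u: "ac_on 0 l u p" and p: "ac_on 0 l p (\<lambda>x. - jump_rhs M N \<alpha> \<beta> x (u x))"
    and lt: "z i < z (Suc i)" and zi: "0 \<le> z i" "z (Suc i) \<le> l" "u (z i) = 0" "u (z (Suc i)) = 0"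
    and pos: "\<And>x. z i < x \<Longrightarrow> x < z (Suc i) \<Longrightarrow> 0 < \<sigma> * u x"
    using assms unfolding nodal_solution_def regular_solution_def \<sigma>_def by auto
  have pos': "0 \<le> \<sigma> * u x" if "x \<in> {z i..z (Suc i)}" for x
    using pos[of x] that zi(3,4) by (cases "x = z i \<or> x = z (Suc i)") (auto intro: less_imp_le)
  have "ac_on (z i) (z (Suc i)) (\<lambda>x. \<sigma> * p x) (\<lambda>x. \<sigma> * - jump_rhs M N \<alpha> \<beta> x (u x))"
    by (intro ac_on_cmult ac_on_sub[OF p] zi)
  then have "ac_on (z i) (z (Suc i)) (\<lambda>x. \<sigma> * p x)
      (\<lambda>x. - ((if \<sigma> = 1 then \<alpha> else \<beta>) * (if \<sigma> = 1 then M else N) x * (\<sigma> * u x)))"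
  proof (rule ac_on_cong)
    fix x assume "x \<in> {z i..z (Suc i)}"
    from pos'[OF this] \<sigma> show "\<sigma> * - jump_rhs M N \<alpha> \<beta> x (u x)
      = - ((if \<sigma> = 1 then \<alpha> else \<beta>) * (if \<sigma> = 1 then M else N) x * (\<sigma> * u x))"
      by (auto simp: jump_rhs_def pos_part_def neg_part_def max_def)
  qed simp
  moreover have "ac_on (z i) (z (Suc i)) (\<lambda>x. \<sigma> * u x) (\<lambda>x. \<sigma> * p x)"
    by (intro ac_on_cmult ac_on_sub[OF u] zi)
  ultimately show ?thesis
    unfolding \<sigma>_def[symmetric] hump_def using lt zi pos by auto
qed

section \<open>Comparison of the curves and oscillating weights\<close>

text \<open>The length bound gives \<open>sqrt \<mu>\<close> times the length at most
  \<open>sqrt (10 / a)\<close> on intervals with weight \<open>M\<close>, and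
  \<open>1 / sqrt t\<close> times that on intervals with weight \<open>N\<close>, whose eigenvalue
  is \<open>t * \<mu>\<close>. The \<open>k + 1\<close> lengths sum to \<open>l\<close>.\<close>

lemma nodal_sqrt_bound:
  assumes M: "bounded_weight a b M" and N: "bounded_weight a b N" and "0 < a" "0 < t" "0 \<le> \<mu>" "s \<in> {1, - 1}"
    and sol: "nodal_solution l M N \<mu> (t * \<mu>) k s u p z"
  shows "sqrt \<mu> * l \<le> real (Suc k) * (sqrt (10 / a) * max 1 (1 / sqrt t))"
proof -
  define R where "R = sqrt (10 / a)"
  have R: "0 < R" using \<open>0 < a\<close> by (simp add: R_def)
  have step: "sqrt \<mu> * (z (Suc i) - z i) \<le> R * max 1 (1 / sqrt t)" if i: "i \<le> k" for i
  proof -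
    have L: "0 \<le> z (Suc i) - z i" using sol i by (auto simp: nodal_solution_def less_imp_le)
    note h = nodal_solution_hump[OF sol \<open>s \<in> {1, - 1}\<close> i]
    have root: "sqrt \<Lambda> * (z (Suc i) - z i) \<le> R" if "\<Lambda> * a * (z (Suc i) - z i)\<^sup>2 \<le> 10" for \<Lambda>
    proof -
      have "\<Lambda> * (z (Suc i) - z i)\<^sup>2 \<le> 10 / a" using that \<open>0 < a\<close> by (simp add: field_simps)
      then have "sqrt (\<Lambda> * (z (Suc i) - z i)\<^sup>2) \<le> R" by (simp add: R_def)
      then show ?thesis using L by (simp add: real_sqrt_mult)
    qed
    show ?thesis
    proof (cases "s * (- 1) ^ i = 1")
      case True
      have "\<mu> * a * (z (Suc i) - z i)\<^sup>2 \<le> 10"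
        using hump_length_bound[OF M \<open>0 < a\<close> \<open>0 \<le> \<mu>\<close>] h True by simp
      from root[OF this] have "sqrt \<mu> * (z (Suc i) - z i) \<le> R * 1" by simp
      also have "\<dots> \<le> R * max 1 (1 / sqrt t)" using R by (intro mult_left_mono) auto
      finally show ?thesis .
    next
      case False
      have "t * \<mu> * a * (z (Suc i) - z i)\<^sup>2 \<le> 10"
        using hump_length_bound[OF N \<open>0 < a\<close>, of "t * \<mu>"] h False \<open>0 < t\<close> \<open>0 \<le> \<mu>\<close> by simp
      from root[OF this] have "sqrt \<mu> * (z (Suc i) - z i) \<le> R * (1 / sqrt t)"
        using \<open>0 < t\<close> by (simp add: real_sqrt_mult field_simps)
      also have "\<dots> \<le> R * max 1 (1 / sqrt t)" using R by (intro mult_left_mono) auto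
      finally show ?thesis .
    qed
  qed
  have "l = (\<Sum>i<Suc k. z (Suc i) - z i)"
    using sol by (subst sum_lessThan_telescope) (simp add: nodal_solution_def)
  then have "sqrt \<mu> * l = (\<Sum>i<Suc k. sqrt \<mu> * (z (Suc i) - z i))" by (simp only: sum_distrib_left)
  also have "\<dots> \<le> (\<Sum>i<Suc k. R * max 1 (1 / sqrt t))" by (intro sum_mono step) auto
  finally show ?thesis by (simp add: R_def)
qed

text \<open>Equal index and equal \<open>s\<close> mean equal sign, so the nested intervals carry
  corresponding weights. For the weight \<open>N\<close> the eigenvalue is \<open>t * \<mu>\<close>;
  dividing its 3/2 power by \<open>t\<close> leaves \<open>sqrt t\<close>, and the maximum covers
  both parities.\<close>

lemma nodal_comparison:
  assumes M1: "bounded_weight a b M1" and N1: "bounded_weight a b N1"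
    and M2: "bounded_weight a b M2" and N2: "bounded_weight a b N2"
    and "0 < a" "0 < t" "0 \<le> \<mu>1" "0 \<le> \<mu>2" "s \<in> {1, - 1}"
    and sol1: "nodal_solution l M1 N1 \<mu>1 (t * \<mu>1) k s u1 p1 z1"
    and sol2: "nodal_solution l M2 N2 \<mu>2 (t * \<mu>2) k s u2 p2 z2"
    and oscM: "\<And>x y. 0 \<le> x \<Longrightarrow> x \<le> y \<Longrightarrow> y \<le> l \<Longrightarrow> \<bar>integral {x..y} (\<lambda>y. M1 y - M2 y)\<bar> \<le> \<delta>"
    and oscN: "\<And>x y. 0 \<le> x \<Longrightarrow> x \<le> y \<Longrightarrow> y \<le> l \<Longrightarrow> \<bar>integral {x..y} (\<lambda>y. N1 y - N2 y)\<bar> \<le> \<delta>"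
    and "0 \<le> \<delta>"
  shows "\<mu>2 \<le> \<mu>1 + 2 * \<delta> * sqrt b / a * (max 1 (sqrt t) * (\<mu>1 * sqrt \<mu>1))"
proof -
  define K where "K = 2 * \<delta> * sqrt b / a"
  have "a \<le> b" using M1 by (auto simp: bounded_weight_def intro: order_trans)
  then have K: "0 \<le> K" using \<open>0 < a\<close> \<open>0 \<le> \<delta>\<close> by (simp add: K_def)
  obtain i where i: "i \<le> k" "z2 i \<le> z1 i" "z1 (Suc i) \<le> z2 (Suc i)"
    using nested_nodal_interval[of z2 z1 k] sol1 sol2 by (auto simp: nodal_solution_def)
  have z: "0 \<le> z1 i" "z1 (Suc i) \<le> l" using sol1 i(1) by (auto simp: nodal_solution_def)
  note h1 = nodal_solution_hump[OF sol1 \<open>s \<in> {1, - 1}\<close> i(1)]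
    and h2 = nodal_solution_hump[OF sol2 \<open>s \<in> {1, - 1}\<close> i(1)]
  have m0: "0 \<le> \<mu>1 * sqrt \<mu>1" using \<open>0 \<le> \<mu>1\<close> by simp
  show ?thesis
  proof (cases "s * (- 1) ^ i = 1")
    case True
    have "\<mu>2 \<le> \<mu>1 + K * (\<mu>1 * sqrt \<mu>1)"
      unfolding K_def
    proof (rule hump_comparison[OF M1 M2 \<open>0 < a\<close> \<open>0 \<le> \<mu>1\<close> \<open>0 \<le> \<mu>2\<close> _ _ i(2,3)])
      show "\<bar>integral {z1 i..x} (\<lambda>y. M1 y - M2 y)\<bar> \<le> \<delta>" if "x \<in> {z1 i..z1 (Suc i)}" for x
        using that z by (intro oscM) auto
    qed (use h1 h2 True in auto)
    moreover have "\<mu>1 * sqrt \<mu>1 \<le> max 1 (sqrt t) * (\<mu>1 * sqrt \<mu>1)"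
      using mult_right_mono[OF _ m0, of 1 "max 1 (sqrt t)"] by simp
    ultimately show ?thesis using mult_left_mono[OF _ K] unfolding K_def[symmetric] by fastforce
  next
    case False
    have "t * \<mu>2 \<le> t * \<mu>1 + K * ((t * \<mu>1) * sqrt (t * \<mu>1))"
      unfolding K_def
    proof (rule hump_comparison[OF N1 N2 \<open>0 < a\<close> _ _ _ _ i(2,3)])
      show "\<bar>integral {z1 i..x} (\<lambda>y. N1 y - N2 y)\<bar> \<le> \<delta>" if "x \<in> {z1 i..z1 (Suc i)}" for x
        using that z by (intro oscN) auto
    qed (use h1 h2 False \<open>0 < t\<close> \<open>0 \<le> \<mu>1\<close> \<open>0 \<le> \<mu>2\<close> in auto)
    also have "\<dots> = t * (\<mu>1 + K * (sqrt t * (\<mu>1 * sqrt \<mu>1)))"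
      by (simp add: real_sqrt_mult algebra_simps)
    finally have "\<mu>2 \<le> \<mu>1 + K * (sqrt t * (\<mu>1 * sqrt \<mu>1))" using \<open>0 < t\<close> by simp
    moreover have "sqrt t * (\<mu>1 * sqrt \<mu>1) \<le> max 1 (sqrt t) * (\<mu>1 * sqrt \<mu>1)"
      by (rule mult_right_mono[OF _ m0]) simp
    ultimately show ?thesis using mult_left_mono[OF _ K] unfolding K_def[symmetric] by fastforce
  qed
qed

text \<open>The two maxima never exceed 1 simultaneously: for \<open>t \<ge> 1\<close> only the
  comparison factor \<open>sqrt t\<close> remains, for \<open>t < 1\<close> only the cube of
  \<open>1 / sqrt t\<close> from the length bound.\<close>

lemma slope_factor_le_gamma_fun:
  assumes "0 < t"
  shows "max 1 (sqrt t) * (max 1 (1 / sqrt t)) ^ 3 \<le> gamma_fun t"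
proof -
  define r where "r = sqrt t"
  have r: "0 < r" "t = r powr 2" using assms by (auto simp: r_def)
  have p: "t powr (- 3 / 2) = 1 / r ^ 3" "t powr (1 / 2) = r"
  proof -
    have "t powr (- 3 / 2) = r powr (- 3)" "t powr (1 / 2) = r powr 1"
      unfolding r(2) powr_powr by simp_all
    then show "t powr (- 3 / 2) = 1 / r ^ 3" "t powr (1 / 2) = r"
      using r(1) by (simp_all add: powr_minus_divide)
  qed
  show ?thesis
  proof (cases "1 \<le> r")
    case True
    then have "max 1 r * (max 1 (1 / r)) ^ 3 = r" by (simp add: max_def)
    then show ?thesis unfolding gamma_fun_def p r_def[symmetric] by simp
  next
    case False
    then have "max 1 r * (max 1 (1 / r)) ^ 3 = 1 / r ^ 3" using r(1) by (auto simp: max_def field_simps)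
    then show ?thesis unfolding gamma_fun_def p r_def[symmetric] by simp
  qed
qed

text \<open>Cubing the bound on \<open>sqrt \<mu>1\<close> controls
  \<open>\<mu>1 * sqrt \<mu>1\<close>, which is where \<open>(real k / l) ^ 3\<close> comes from.
  The estimate is one-sided; exchanging the two problems yields the other side.\<close>

lemma fucik_curve_difference_bound:
  assumes M1: "bounded_weight a b M1" and N1: "bounded_weight a b N1"
    and M2: "bounded_weight a b M2" and N2: "bounded_weight a b N2"
    and "0 < a" "0 < t" "0 < l" "s \<in> {1, - 1}" "1 \<le> k"
    and c1: "(\<mu>1, t * \<mu>1) \<in> fucik_curve l M1 N1 k s"
    and c2: "(\<mu>2, t * \<mu>2) \<in> fucik_curve l M2 N2 k s"
    and oscM: "\<And>x y. 0 \<le> x \<Longrightarrow> x \<le> y \<Longrightarrow> y \<le> l \<Longrightarrow> \<bar>integral {x..y} (\<lambda>y. M1 y - M2 y)\<bar> \<le> \<delta>"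
    and oscN: "\<And>x y. 0 \<le> x \<Longrightarrow> x \<le> y \<Longrightarrow> y \<le> l \<Longrightarrow> \<bar>integral {x..y} (\<lambda>y. N1 y - N2 y)\<bar> \<le> \<delta>"
    and "0 \<le> \<delta>"
  shows "\<mu>2 - \<mu>1 \<le> (2 * sqrt b / a * (2 * sqrt (10 / a)) ^ 3) * \<delta> * (real k / l) ^ 3 * gamma_fun t"
proof -
  have \<mu>: "0 \<le> \<mu>1" "0 \<le> \<mu>2" using c1 c2 by (auto simp: fucik_curve_def)
  obtain u1 p1 z1 where s1: "nodal_solution l M1 N1 \<mu>1 (t * \<mu>1) k s u1 p1 z1"
    using fucik_curve_nodal_solution[OF M1 N1 _ _ _ c1] assms by auto
  obtain u2 p2 z2 where s2: "nodal_solution l M2 N2 \<mu>2 (t * \<mu>2) k s u2 p2 z2"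
    using fucik_curve_nodal_solution[OF M2 N2 _ _ _ c2] assms by auto
  define g where "g = max 1 (1 / sqrt t)"
  have "a \<le> b" using M1 by (auto simp: bounded_weight_def intro: order_trans)
  have "sqrt \<mu>1 * l \<le> real (Suc k) * (sqrt (10 / a) * g)"
    unfolding g_def by (rule nodal_sqrt_bound[OF M1 N1 _ _ _ _ s1]) (use assms \<mu> in auto)
  \<comment> \<open>The count is \<open>k + 1\<close> intervals for \<open>k\<close> interior zeros;
    \<open>k \<ge> 1\<close> lets it be absorbed into \<open>2 * k\<close>.\<close>
  also have "\<dots> \<le> (2 * real k) * (sqrt (10 / a) * g)"
    using \<open>1 \<le> k\<close> \<open>0 < a\<close> by (intro mult_right_mono mult_nonneg_nonneg) (auto simp: g_def)
  finally have root: "sqrt \<mu>1 \<le> 2 * sqrt (10 / a) * (real k / l) * g"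
    using \<open>0 < l\<close> by (simp add: field_simps)
  have "\<mu>1 * sqrt \<mu>1 = sqrt \<mu>1 ^ 3" using \<mu> by (simp add: power3_eq_cube)
  also have "\<dots> \<le> (2 * sqrt (10 / a) * (real k / l) * g) ^ 3" using root \<mu> by (intro power_mono) auto
  also have "\<dots> = (2 * sqrt (10 / a)) ^ 3 * (real k / l) ^ 3 * g ^ 3" by (simp only: power_mult_distrib)
  finally have cube: "\<mu>1 * sqrt \<mu>1 \<le> (2 * sqrt (10 / a)) ^ 3 * (real k / l) ^ 3 * g ^ 3" .
  have "\<mu>2 - \<mu>1 \<le> 2 * \<delta> * sqrt b / a * (max 1 (sqrt t) * (\<mu>1 * sqrt \<mu>1))"
    using nodal_comparison[OF M1 N1 M2 N2 \<open>0 < a\<close> \<open>0 < t\<close> \<mu> \<open>s \<in> {1, - 1}\<close> s1 s2 oscM oscN \<open>0 \<le> \<delta>\<close>] by simp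
  also have "\<dots> \<le> 2 * \<delta> * sqrt b / a * (max 1 (sqrt t) * ((2 * sqrt (10 / a)) ^ 3 * (real k / l) ^ 3 * g ^ 3))"
    using \<open>0 \<le> \<delta>\<close> \<open>0 < a\<close> \<open>a \<le> b\<close> by (intro mult_left_mono cube) auto
  also have "\<dots> = 2 * \<delta> * sqrt b / a * ((2 * sqrt (10 / a)) ^ 3 * (real k / l) ^ 3) * (max 1 (sqrt t) * g ^ 3)"
    by simp
  also have "\<dots> \<le> 2 * \<delta> * sqrt b / a * ((2 * sqrt (10 / a)) ^ 3 * (real k / l) ^ 3) * gamma_fun t"
    using \<open>0 \<le> \<delta>\<close> \<open>0 < a\<close> \<open>a \<le> b\<close> \<open>0 < l\<close> unfolding g_def
    by (intro mult_left_mono slope_factor_le_gamma_fun[OF \<open>0 < t\<close>] mult_nonneg_nonneg divide_nonneg_nonneg zero_le_power) auto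
  also have "\<dots> = (2 * sqrt b / a * (2 * sqrt (10 / a)) ^ 3) * \<delta> * (real k / l) ^ 3 * gamma_fun t"
    by simp
  finally show ?thesis .
qed

text \<open>Comparing a problem with itself has \<open>\<delta> = 0\<close>, so both differences are
  nonpositive.\<close>

lemma fucik_curve_unique:
  assumes M: "bounded_weight a b M" and N: "bounded_weight a b N"
    and "0 < a" "0 < t" "0 < l" "s \<in> {1, - 1}" "1 \<le> k"
    and c: "(\<mu>1, t * \<mu>1) \<in> fucik_curve l M N k s" "(\<mu>2, t * \<mu>2) \<in> fucik_curve l M N k s"
  shows "\<mu>1 = \<mu>2"
  using fucik_curve_difference_bound[OF M N M N assms(3-7) c(1) c(2), of 0]
    fucik_curve_difference_bound[OF M N M N assms(3-7) c(2) c(1), of 0] by simp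

lemma weak_solution_cong_AE:
  assumes meas: "M \<in> borel_measurable lebesgue" "N \<in> borel_measurable lebesgue"
      "M' \<in> borel_measurable lebesgue" "N' \<in> borel_measurable lebesgue"
    and ae: "AE x in lebesgue. M x = M' x" "AE x in lebesgue. N x = N' x"
  shows "weak_solution l M N \<alpha> \<beta> u = weak_solution l M' N' \<alpha> \<beta> u"
proof -
  let ?A = "{0<..<l}"
  have eq: "(LINT x:?A|lebesgue. (\<alpha> * M x * pos_part (u x) - \<beta> * N x * neg_part (u x)) * v x)
    = (LINT x:?A|lebesgue. (\<alpha> * M' x * pos_part (u x) - \<beta> * N' x * neg_part (u x)) * v x)"
    if u: "H10 l u u'" and v: "H10 l v v'" for u' v v'
  proof -
    \<comment> \<open>The functions \<open>u\<close> and \<open>v\<close> are measurable only after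
      restriction to \<open>(0, l)\<close>; the truncations are measurable on the whole line and
      give the same integrand.\<close>
    define U V where "U = (\<lambda>x. indicator ?A x * u x)" and "V = (\<lambda>x. indicator ?A x * v x)"
    have UV [measurable]: "U \<in> borel_measurable lebesgue" "V \<in> borel_measurable lebesgue"
      using u v by (auto simp: H10_def square_integrable_def set_borel_measurable_def U_def V_def)
    have meas': "(\<lambda>x. indicator ?A x *\<^sub>R ((\<alpha> * P x * pos_part (u x) - \<beta> * Q x * neg_part (u x)) * v x)) \<in> borel_measurable lebesgue"
      if [measurable]: "P \<in> borel_measurable lebesgue" "Q \<in> borel_measurable lebesgue" for P Q
    proof -
      have "(\<lambda>x. (\<alpha> * P x * max 0 (U x) - \<beta> * Q x * max 0 (- U x)) * V x) \<in> borel_measurable lebesgue"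
        by measurable
      also have "(\<lambda>x. (\<alpha> * P x * max 0 (U x) - \<beta> * Q x * max 0 (- U x)) * V x)
        = (\<lambda>x. indicator ?A x *\<^sub>R ((\<alpha> * P x * pos_part (u x) - \<beta> * Q x * neg_part (u x)) * v x))"
        by (auto simp: U_def V_def indicator_def pos_part_def neg_part_def)
      finally show ?thesis .
    qed
    show ?thesis
      unfolding set_lebesgue_integral_def
    proof (rule integral_cong_AE[OF meas'[OF meas(1,2)] meas'[OF meas(3,4)]])
      show "AE x in lebesgue. indicator ?A x *\<^sub>R ((\<alpha> * M x * pos_part (u x) - \<beta> * N x * neg_part (u x)) * v x)
        = indicator ?A x *\<^sub>R ((\<alpha> * M' x * pos_part (u x) - \<beta> * N' x * neg_part (u x)) * v x)"
        using ae by eventually_elim simp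
    qed
  qed
  show ?thesis
    unfolding weak_solution_def
    by (intro ex_cong1 conj_cong refl all_cong1 imp_cong) (simp only: eq)
qed

lemma fucik_curve_cong_AE:
  assumes "M \<in> borel_measurable lebesgue" "N \<in> borel_measurable lebesgue"
      "M' \<in> borel_measurable lebesgue" "N' \<in> borel_measurable lebesgue"
    "AE x in lebesgue. M x = M' x" "AE x in lebesgue. N x = N' x"
  shows "fucik_curve l M N k s = fucik_curve l M' N' k s"
  unfolding fucik_curve_def weak_solution_cong_AE[OF assms] ..

section \<open>Rescaled and periodic functions\<close>

lemma AE_lebesgue_iff_negligible: "(AE x in lebesgue. P x) \<longleftrightarrow> negligible {x. \<not> P x}"
  unfolding eventually_ae_filter_negligible using negligible_subset by blast

lemma AE_lebesgue_scale:
  assumes "AE x in lebesgue. P x" "(\<epsilon>::real) \<noteq> 0"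
  shows "AE x in lebesgue. P (x / \<epsilon>)"
proof -
  have "negligible {x. \<not> P x}" using assms(1) by (simp add: AE_lebesgue_iff_negligible)
  then have "negligible ((*) \<epsilon> ` {x. \<not> P x})"
    by (rule negligible_differentiable_image_negligible[rotated])
      (auto intro!: derivative_intros simp: differentiable_on_def)
  moreover have "{x. \<not> P (x / \<epsilon>)} \<subseteq> (*) \<epsilon> ` {x. \<not> P x}"
  proof
    fix x assume "x \<in> {x. \<not> P (x / \<epsilon>)}"
    then show "x \<in> (*) \<epsilon> ` {x. \<not> P x}" using assms(2) by (intro image_eqI[of _ _ "x / \<epsilon>"]) auto
  qed
  ultimately show ?thesis using negligible_subset by (auto simp: AE_lebesgue_iff_negligible)
qed

lemma measurable_lebesgue_scale:
  fixes f :: "real \<Rightarrow> real"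
  assumes "f \<in> borel_measurable lebesgue"
  shows "(\<lambda>x. f (x / \<epsilon>)) \<in> borel_measurable lebesgue"
  using measurable_compose[OF lebesgue_measurable_scaling[of "1 / \<epsilon>"] assms] by simp

text \<open>Mean zero makes the primitive itself periodic, so only its values on one period matter,
  and there it is at most \<open>B * l\<close>. Periodicity holds up to a null set, which the
  integral ignores.\<close>

lemma periodic_integral_bound:
  fixes w :: "real \<Rightarrow> real"
  assumes int: "\<And>c d. w integrable_on {c..d}" and per: "AE x in lebesgue. w (x + l) = w x"
    and b: "\<And>x. \<bar>w x\<bar> \<le> B" and mean: "integral {0..l} w = 0" and "0 < l" "0 \<le> x"
  shows "\<bar>integral {0..x} w\<bar> \<le> B * l"
proof -
  have B: "0 \<le> B" using b[of 0] by linarith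
  have shift: "integral {0..x + l} w = integral {0..x} w" if "0 \<le> x" for x
  proof -
    have "integral {0..x + l} w = integral {0..l} w + integral {l..x + l} w"
      using \<open>0 < l\<close> that by (intro Henstock_Kurzweil_Integration.integral_combine[symmetric] int) auto
    also have "integral {l..x + l} w = integral {0..x} (\<lambda>y. w (y + l))"
      using integral_shift_real_ivl[of l l "x + l" w] by simp
    also have "\<dots> = integral {0..x} w"
      using per by (intro integral_spike[of "{x. w (x + l) \<noteq> w x}"]) (auto simp: AE_lebesgue_iff_negligible)
    finally show ?thesis using mean by simp
  qed
  have "\<bar>integral {0..x} w\<bar> \<le> B * l" if "0 \<le> x" "x \<le> real (Suc n) * l" for n x
    using that
  proof (induction n arbitrary: x)
    case 0
    have "\<bar>integral {0..x} w\<bar> \<le> B * (x - 0)"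
      using 0 by (intro abs_integral_le_bound int b) auto
    also have "\<dots> \<le> B * l" using 0 B by (intro mult_left_mono) auto
    finally show ?case .
  next
    case (Suc n)
    show ?case
    proof (cases "x \<le> real (Suc n) * l")
      case True
      then show ?thesis using Suc by blast
    next
      case False
      then have "l \<le> x" using \<open>0 < l\<close> Suc.prems
        by (metis (no_types, opaque_lifting) less_eq_real_def mult_1 mult_right_mono nle_le of_nat_0_le_iff of_nat_Suc le_add_same_cancel1 order_trans)
      then have "integral {0..x} w = integral {0..x - l} w" using shift[of "x - l"] by simp
      moreover have "\<bar>integral {0..x - l} w\<bar> \<le> B * l"
        by (rule Suc.IH) (use Suc.prems \<open>l \<le> x\<close> in \<open>auto simp: algebra_simps\<close>)
      ultimately show ?thesis by simp
    qed
  qed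
  moreover obtain n where "x / l \<le> real n" using real_arch_simple by blast
  then have "x \<le> real (Suc n) * l" using \<open>0 < l\<close> by (simp add: field_simps)
  ultimately show ?thesis using \<open>0 \<le> x\<close> by blast
qed

text \<open>Rescaling gains the factor \<open>\<epsilon>\<close>, while the primitive stays bounded
  regardless of the number of periods in \<open>[x, y]\<close>. The factor 2 arises because an
  integral from an arbitrary \<open>x\<close> is a difference of two values of the
  primitive.\<close>

lemma periodic_oscillation_bound:
  fixes w :: "real \<Rightarrow> real"
  assumes int: "\<And>c d. w integrable_on {c..d}" and per: "AE x in lebesgue. w (x + l) = w x"
    and b: "\<And>x. \<bar>w x\<bar> \<le> B" and mean: "integral {0..l} w = 0" and "0 < l" "0 < \<epsilon>" "0 \<le> x" "x \<le> y"
  shows "\<bar>integral {x..y} (\<lambda>s. w (s / \<epsilon>))\<bar> \<le> 2 * B * l * \<epsilon>"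
proof -
  have im: "(\<lambda>s. s / (1 / \<epsilon>)) ` {x / \<epsilon>..y / \<epsilon>} = {x..y}"
    using \<open>0 < \<epsilon>\<close> \<open>x \<le> y\<close> image_divide_atLeastAtMost[of "1 / \<epsilon>" "x / \<epsilon>" "y / \<epsilon>"] by simp
  have "integral {x..y} (\<lambda>s. w (s / \<epsilon>)) = \<epsilon> * integral {x / \<epsilon>..y / \<epsilon>} w"
    using integral_stretch_real[of "1 / \<epsilon>" "x / \<epsilon>" "y / \<epsilon>" w] \<open>0 < \<epsilon>\<close> unfolding im by simp
  moreover have "integral {0..x / \<epsilon>} w + integral {x / \<epsilon>..y / \<epsilon>} w = integral {0..y / \<epsilon>} w"
    using \<open>0 < \<epsilon>\<close> \<open>0 \<le> x\<close> \<open>x \<le> y\<close> by (intro Henstock_Kurzweil_Integration.integral_combine int) (auto simp: divide_right_mono)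
  moreover have "\<bar>integral {0..x / \<epsilon>} w\<bar> \<le> B * l" "\<bar>integral {0..y / \<epsilon>} w\<bar> \<le> B * l"
    using assms by (intro periodic_integral_bound[OF int per b mean]; simp)+
  ultimately have "\<bar>integral {x..y} (\<lambda>s. w (s / \<epsilon>))\<bar> = \<epsilon> * \<bar>integral {0..y / \<epsilon>} w - integral {0..x / \<epsilon>} w\<bar>"
    using \<open>0 < \<epsilon>\<close> by (simp add: abs_mult algebra_simps)
  also have "\<dots> \<le> \<epsilon> * (2 * (B * l))"
    using \<open>\<bar>integral {0..x / \<epsilon>} w\<bar> \<le> B * l\<close> \<open>\<bar>integral {0..y / \<epsilon>} w\<bar> \<le> B * l\<close> \<open>0 < \<epsilon>\<close>
    by (intro mult_left_mono) (auto simp: abs_le_iff)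
  finally show ?thesis by (simp add: algebra_simps)
qed

text \<open>
  Clamping to \<open>[a, b]\<close> turns the almost everywhere bounds into pointwise ones without changing
  the equivalence class.
\<close>

lemma admissible_weight_representative:
  assumes adm: "admissible_weight l a b w" and "0 < a" "a \<le> b" "0 < l" "0 < \<epsilon>"
  obtains W W0 where "bounded_weight a b W" "bounded_weight a b W0"
    "weight l w \<epsilon> \<in> borel_measurable lebesgue" "weight l w 0 \<in> borel_measurable lebesgue"
    "AE x in lebesgue. weight l w \<epsilon> x = W x" "AE x in lebesgue. weight l w 0 x = W0 x"
    "\<And>x y. 0 \<le> x \<Longrightarrow> x \<le> y \<Longrightarrow> \<bar>integral {x..y} (\<lambda>s. W s - W0 s)\<bar> \<le> 2 * b * l * \<epsilon>"
proof -
  have meas: "w \<in> borel_measurable lebesgue" and per: "AE x in lebesgue. w (x + l) = w x"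
    and bd: "AE x in lebesgue. a \<le> w x \<and> w x \<le> b"
    using adm by (auto simp: admissible_weight_def)
  define v where "v = (\<lambda>x. max a (min b (w x)))"
  have v_meas: "v \<in> borel_measurable lebesgue"
    unfolding v_def using meas by (intro borel_measurable_max borel_measurable_min borel_measurable_const)
  have v: "bounded_weight a b v" using v_meas \<open>a \<le> b\<close> by (auto simp: bounded_weight_def v_def)
  have vw: "AE x in lebesgue. w x = v x" using bd by eventually_elim (auto simp: v_def)
  have vper: "AE x in lebesgue. v (x + l) = v x" using per by eventually_elim (simp add: v_def)
  have vabs: "v absolutely_integrable_on {c..d}" for c d by (rule bounded_weight_abs_integrable[OF v])
  have vint: "v integrable_on {c..d}" for c d by (rule set_lebesgue_integral_eq_integral(1)[OF vabs])
  define m where "m = integral {0..l} v / l"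
  have "(LINT y:{0<..<l}|lebesgue. w y) = (LINT y:{0<..<l}|lebesgue. v y)"
    unfolding set_lebesgue_integral_def
  proof (rule integral_cong_AE)
    show "(\<lambda>x. indicator {0<..<l} x *\<^sub>R w x) \<in> borel_measurable lebesgue"
      "(\<lambda>x. indicator {0<..<l} x *\<^sub>R v x) \<in> borel_measurable lebesgue"
      by (intro borel_measurable_scaleR borel_measurable_indicator meas v_meas; simp)+
    show "AE x in lebesgue. indicator {0<..<l} x *\<^sub>R w x = indicator {0<..<l} x *\<^sub>R v x"
      using vw by eventually_elim simp
  qed
  also have "\<dots> = integral {0..l} v" by (rule LINT_open_eq_integral[OF vabs])
  finally have w0: "weight l w 0 x = m" for x by (simp add: weight_def m_def)
  have "a * l \<le> integral {0..l} v" "integral {0..l} v \<le> b * l"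
  proof -
    have "integral {0..l} (\<lambda>_. a) \<le> integral {0..l} v" "integral {0..l} v \<le> integral {0..l} (\<lambda>_. b)"
      using v by (intro integral_le vint; auto simp: bounded_weight_def)+
    then show "a * l \<le> integral {0..l} v" "integral {0..l} v \<le> b * l" using \<open>0 < l\<close> by (simp_all add: mult.commute)
  qed
  then have m: "a \<le> m" "m \<le> b" using \<open>0 < l\<close> by (auto simp: m_def field_simps)
  show ?thesis
  proof (rule that[of "\<lambda>x. v (x / \<epsilon>)" "\<lambda>_. m"])
    show "bounded_weight a b (\<lambda>x. v (x / \<epsilon>))"
      using v measurable_lebesgue_scale[OF v_meas] by (auto simp: bounded_weight_def)
    show "bounded_weight a b (\<lambda>_. m)" using m by (auto simp: bounded_weight_def)
    show "weight l w \<epsilon> \<in> borel_measurable lebesgue"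
      using measurable_lebesgue_scale[OF meas, of \<epsilon>] \<open>0 < \<epsilon>\<close> by (simp add: weight_def[abs_def])
    show "weight l w 0 \<in> borel_measurable lebesgue" by (simp add: w0[abs_def])
    show "AE x in lebesgue. weight l w \<epsilon> x = v (x / \<epsilon>)"
      using AE_lebesgue_scale[OF vw, of \<epsilon>] \<open>0 < \<epsilon>\<close> by (simp add: weight_def)
    show "AE x in lebesgue. weight l w 0 x = m" by (simp add: w0)
    fix x y :: real assume xy: "0 \<le> x" "x \<le> y"
    show "\<bar>integral {x..y} (\<lambda>s. v (s / \<epsilon>) - m)\<bar> \<le> 2 * b * l * \<epsilon>"
    proof (rule periodic_oscillation_bound[where w = "\<lambda>x. v x - m", OF _ _ _ _ \<open>0 < l\<close> \<open>0 < \<epsilon>\<close> xy])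
      show "(\<lambda>x. v x - m) integrable_on {c..d}" for c d by (intro integrable_diff vint) auto
      show "AE x in lebesgue. v (x + l) - m = v x - m" using vper by eventually_elim simp
      \<comment> \<open>Both numbers lie in \<open>[a, b]\<close> with \<open>a > 0\<close>, so
        their distance is at most \<open>b\<close>.\<close>
      show "\<bar>v x - m\<bar> \<le> b" for x
        using v m \<open>0 < a\<close> unfolding bounded_weight_def by (smt (verit))
      show "integral {0..l} (\<lambda>x. v x - m) = 0"
        using vint[of 0 l] \<open>0 < l\<close> by (subst Henstock_Kurzweil_Integration.integral_diff) (auto simp: m_def)
    qed
  qed
qed

section \<open>Existence by the Pruefer angle\<close>

text \<open>
  With \<open>\<theta> s = exp (2 L s) g s\<close> the Picard operator contracts by \<open>1/2\<close> in the supremum norm on all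
  of \<open>[0, l]\<close>, so no continuation argument is needed.
\<close>

lemma caratheodory_existence:
  fixes F :: "real \<Rightarrow> real \<Rightarrow> real"
  assumes "0 < l" "0 \<le> L"
    and int: "\<And>h. continuous_on {0..l} h \<Longrightarrow> (\<lambda>s. F s (h s)) absolutely_integrable_on {0..l}"
    and lip: "\<And>s x y. \<bar>F s x - F s y\<bar> \<le> L * \<bar>x - y\<bar>"
  shows "\<exists>\<theta>. ac_on 0 l \<theta> (\<lambda>s. F s (\<theta> s)) \<and> \<theta> 0 = \<theta>0"
proof -
  define wt where "wt = (\<lambda>s. exp (2 * L * s))"
  have cwt: "continuous_on S wt" for S unfolding wt_def by (intro continuous_intros)
  have wt0: "0 < wt s" "0 < exp (- 2 * L * s)" "exp (- 2 * L * s) * wt s = 1" for s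
    by (auto simp: wt_def exp_add[symmetric])
  define J where "J = (\<lambda>g y. exp (- 2 * L * y) * (\<theta>0 + integral {0..y} (\<lambda>s. F s (wt s * g s))))"
  \<comment> \<open>Bounded continuous functions live on the whole line; clamping the argument
    extends \<open>J\<close> from \<open>[0, l]\<close> so that Banach's theorem applies in their
    complete space.\<close>
  define cl where "cl = (\<lambda>x::real. max 0 (min l x))"
  have cl: "cl x \<in> {0..l}" for x using \<open>0 < l\<close> by (auto simp: cl_def)
  have Fi: "(\<lambda>s. F s (wt s * apply_bcontfun g s)) absolutely_integrable_on {0..l}" for g :: "real \<Rightarrow>\<^sub>C real"
    by (intro int continuous_on_mult cwt) simp
  have Fint: "(\<lambda>s. F s (wt s * apply_bcontfun g s)) integrable_on {0..y}" if "y \<le> l" for g :: "real \<Rightarrow>\<^sub>C real" and y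
    using abs_integrable_sub[OF Fi, of 0 y g] that by (intro set_lebesgue_integral_eq_integral(1)) auto
  have Jc: "continuous_on {0..l} (J (apply_bcontfun g))" for g :: "real \<Rightarrow>\<^sub>C real"
    unfolding J_def
    by (intro continuous_intros indefinite_integral_continuous_1 Fint) simp
  have Jb: "(\<lambda>x. J (apply_bcontfun g) (cl x)) \<in> bcontfun" for g :: "real \<Rightarrow>\<^sub>C real"
    unfolding bcontfun_def
  proof (intro CollectI conjI)
    show "continuous_on UNIV (\<lambda>x. J (apply_bcontfun g) (cl x))"
      by (rule continuous_on_compose2[OF Jc]) (use cl in \<open>auto simp: cl_def intro!: continuous_intros\<close>)
    have "bounded (J (apply_bcontfun g) ` {0..l})"
      by (intro compact_imp_bounded compact_continuous_image Jc) auto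
    then show "bounded (range (\<lambda>x. J (apply_bcontfun g) (cl x)))"
      by (rule bounded_subset) (use cl in auto)
  qed
  define T where "T = (\<lambda>g::real \<Rightarrow>\<^sub>C real. Bcontfun (\<lambda>x. J (apply_bcontfun g) (cl x)))"
  have T: "apply_bcontfun (T g) x = J (apply_bcontfun g) (cl x)" for g x
    unfolding T_def using Bcontfun_inverse[OF Jb] by simp
  have "dist (T g) (T h) \<le> 1/2 * dist g h" for g h
  proof (rule dist_bound)
    fix x
    define y where "y = cl x"
    have y: "0 \<le> y" "y \<le> l" using cl[of x] by (auto simp: y_def)
    let ?D = "dist g h"
    have "\<bar>integral {0..y} (\<lambda>s. F s (wt s * g s) - F s (wt s * h s))\<bar> \<le> integral {0..y} (\<lambda>s. L * wt s * ?D)"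
    proof (rule integral_norm_bound_integral[where 'a = real, unfolded real_norm_def])
      show "(\<lambda>s. F s (wt s * g s) - F s (wt s * h s)) integrable_on {0..y}"
        by (intro integrable_diff Fint y)
      show "(\<lambda>s. L * wt s * ?D) integrable_on {0..y}"
        by (intro integrable_continuous_real continuous_intros cwt)
      fix s
      have "\<bar>F s (wt s * g s) - F s (wt s * h s)\<bar> \<le> L * \<bar>wt s * g s - wt s * h s\<bar>" by (rule lip)
      also have "\<bar>wt s * g s - wt s * h s\<bar> = wt s * dist (g s) (h s)"
        using wt0(1)[of s] by (simp add: dist_real_def abs_mult right_diff_distrib[symmetric])
      also have "L * \<dots> \<le> L * (wt s * ?D)"
        using \<open>0 \<le> L\<close> wt0(1)[of s] by (intro mult_left_mono dist_bounded) auto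
      finally show "\<bar>F s (wt s * g s) - F s (wt s * h s)\<bar> \<le> L * wt s * ?D" by simp
    qed
    \<comment> \<open>The exponent is twice the Lipschitz constant so that integrating
      \<open>L * wt\<close> yields \<open>wt / 2\<close>; the prefactor of \<open>J\<close> then
      cancels \<open>wt y\<close> and leaves the contraction factor 1/2.\<close>
    also have "\<dots> = (wt y / 2 - wt 0 / 2) * ?D"
    proof -
      have "((\<lambda>s. L * wt s) has_integral wt y / 2 - wt 0 / 2) {0..y}"
      proof (rule fundamental_theorem_of_calculus[OF y(1)])
        show "((\<lambda>s. wt s / 2) has_vector_derivative L * wt s) (at s within {0..y})" for s
          unfolding wt_def has_real_derivative_iff_has_vector_derivative[symmetric]
          by (auto intro!: derivative_eq_intros)
      qed
      then have "((\<lambda>s. L * wt s * ?D) has_integral (wt y / 2 - wt 0 / 2) * ?D) {0..y}"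
        by (rule has_integral_mult_left)
      then show ?thesis by (rule integral_unique)
    qed
    also have "\<dots> \<le> wt y / 2 * ?D" using wt0(1)[of 0] by (intro mult_right_mono) auto
    finally have "\<bar>integral {0..y} (\<lambda>s. F s (wt s * g s)) - integral {0..y} (\<lambda>s. F s (wt s * h s))\<bar> \<le> wt y / 2 * ?D"
      by (subst (asm) Henstock_Kurzweil_Integration.integral_diff) (auto intro: Fint y)
    then have "exp (- 2 * L * y) * \<bar>integral {0..y} (\<lambda>s. F s (wt s * g s)) - integral {0..y} (\<lambda>s. F s (wt s * h s))\<bar>
        \<le> exp (- 2 * L * y) * (wt y / 2 * ?D)"
      by (intro mult_left_mono) auto
    also have "\<dots> = (exp (- 2 * L * y) * wt y) * ?D / 2" by simp
    also have "\<dots> = 1/2 * ?D" unfolding wt0(3) by simp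
    finally have "\<bar>exp (- 2 * L * y) * (integral {0..y} (\<lambda>s. F s (wt s * g s)) - integral {0..y} (\<lambda>s. F s (wt s * h s)))\<bar> \<le> 1/2 * ?D"
      by (simp add: abs_mult)
    then show "dist (T g x) (T h x) \<le> 1/2 * ?D"
      unfolding T y_def[symmetric] J_def dist_real_def by (simp add: algebra_simps)
  qed
  then obtain g where g: "T g = g"
    using banach_fix_type[of "1/2" T] by auto
  define \<theta> where "\<theta> = (\<lambda>s. wt s * apply_bcontfun g s)"
  have c\<theta>: "continuous_on {0..l} \<theta>" unfolding \<theta>_def by (intro continuous_on_mult cwt) simp
  have \<theta>: "\<theta> y = \<theta>0 + integral {0..y} (\<lambda>s. F s (\<theta> s))" if "y \<in> {0..l}" for y
  proof -
    have "cl y = y" using that by (auto simp: cl_def)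
    then have "apply_bcontfun g y = J (apply_bcontfun g) y" using T[of g y] g by simp
    then have "\<theta> y = (exp (- 2 * L * y) * wt y) * (\<theta>0 + integral {0..y} (\<lambda>s. F s (wt s * apply_bcontfun g s)))"
      by (simp add: \<theta>_def J_def)
    then show ?thesis unfolding wt0(3) by (simp add: \<theta>_def)
  qed
  have "\<theta> 0 = \<theta>0" using \<theta>[of 0] \<open>0 < l\<close> by simp
  moreover have "ac_on 0 l \<theta> (\<lambda>s. F s (\<theta> s))"
    using ac_on_cong[OF ac_on_indefinite_integral[OF int[OF c\<theta>], of \<theta>0], of \<theta> "\<lambda>s. F s (\<theta> s)"] \<theta> by simp
  ultimately show ?thesis by blast
qed

text \<open>Here \<open>D\<close> will be the difference of two Pruefer angles and \<open>c\<close>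
  the effect of changing the parameter. Linearity of the bound in \<open>c\<close> makes the
  terminal angle Lipschitz in that parameter. The argument works with \<open>D\<^sup>2\<close> to
  avoid differentiating \<bar>D\<bar>.\<close>

lemma perturbed_ode_bound:
  assumes D: "ac_on 0 l D d" and "0 < l" and D0: "D 0 = 0"
    and b: "\<And>x. x \<in> {0..l} \<Longrightarrow> \<bar>d x\<bar> \<le> L * \<bar>D x\<bar> + c" and B: "\<And>x. x \<in> {0..l} \<Longrightarrow> \<bar>d x\<bar> \<le> B"
    and "0 \<le> L" "0 \<le> c"
  shows "\<bar>D l\<bar> \<le> c * sqrt (l * exp ((2 * L + 1) * l))"
proof -
  \<comment> \<open>The term \<open>2 * L\<close> comes from differentiating
    \<open>D\<^sup>2\<close>, and the additional 1 absorbs \<open>2 * c *\<close> \<bar>D\<bar>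
    \<le> \<open>c\<^sup>2 + D\<^sup>2\<close>.\<close>
  define K where "K = 2 * L + 1"
  obtain B' where B': "\<And>x. x \<in> {0..l} \<Longrightarrow> \<bar>- K * exp (- K * x)\<bar> \<le> B'"
    using exp_deriv_bounded[of 0 l "- K"] by blast
  have E: "ac_on 0 l (\<lambda>x. D x * D x * exp (- K * x))
      (\<lambda>x. (d x * D x + D x * d x) * exp (- K * x) + (D x * D x) * (- K * exp (- K * x)))"
    by (rule ac_on_mult[OF ac_on_mult[OF D D B] ac_on_exp B'])
  have lin: "ac_on 0 l (\<lambda>x. c\<^sup>2 * x) (\<lambda>x. c\<^sup>2)"
    by (rule ac_on_C1) (auto intro!: derivative_eq_intros)
  have "c\<^sup>2 * 0 + - 1 * (D 0 * D 0 * exp (- K * 0)) \<le> c\<^sup>2 * l + - 1 * (D l * D l * exp (- K * l))"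
  proof (rule ac_on_mono[OF ac_on_add[OF lin ac_on_cmult[OF E, of "- 1"]]])
    fix x assume x: "x \<in> {0..l}"
    have "d x * D x \<le> \<bar>d x\<bar> * \<bar>D x\<bar>" unfolding abs_mult[symmetric] by (rule abs_ge_self)
    also have "\<dots> \<le> (L * \<bar>D x\<bar> + c) * \<bar>D x\<bar>" using b[OF x] by (rule mult_right_mono) simp
    also have "\<dots> = L * (D x * D x) + c * \<bar>D x\<bar>" by (simp add: algebra_simps)
    finally have "2 * (d x * D x) \<le> 2 * L * (D x * D x) + 2 * c * \<bar>D x\<bar>" by simp
    also have "2 * c * \<bar>D x\<bar> \<le> c\<^sup>2 + \<bar>D x\<bar>\<^sup>2" by (rule sum_squares_bound)
    finally have "2 * (d x * D x) - K * (D x * D x) \<le> c\<^sup>2" by (simp add: K_def power2_eq_square algebra_simps)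
    then have "(2 * (d x * D x) - K * (D x * D x)) * exp (- K * x) \<le> c\<^sup>2 * exp (- K * x)"
      by (intro mult_right_mono) auto
    also have "\<dots> \<le> c\<^sup>2 * 1"
      using x \<open>0 \<le> L\<close> by (intro mult_left_mono) (auto simp: K_def mult_nonpos_nonneg)
    finally show "0 \<le> c\<^sup>2 + - 1 * ((d x * D x + D x * d x) * exp (- K * x) + (D x * D x) * (- K * exp (- K * x)))"
      by (simp add: algebra_simps)
  qed (use \<open>0 < l\<close> in auto)
  then have "D l * D l * exp (- K * l) \<le> c\<^sup>2 * l" using D0 by simp
  then have "(D l * D l * exp (- K * l)) * exp (K * l) \<le> (c\<^sup>2 * l) * exp (K * l)"
    by (intro mult_right_mono) auto
  then have "(D l * D l) * (exp (- K * l) * exp (K * l)) \<le> c\<^sup>2 * (l * exp (K * l))"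
    by (simp only: mult.assoc)
  moreover have one: "exp (- K * l) * exp (K * l) = 1" by (simp add: exp_add[symmetric])
  ultimately have "(D l)\<^sup>2 \<le> c\<^sup>2 * (l * exp (K * l))"
    unfolding one power2_eq_square[of "D l"] by (simp only: mult_1_right)
  then have "sqrt ((D l)\<^sup>2) \<le> sqrt (c\<^sup>2 * (l * exp (K * l)))" by (rule real_sqrt_le_mono)
  then show ?thesis using \<open>0 \<le> c\<close> by (simp add: real_sqrt_mult K_def)
qed

lemma abs_sin_cos_diff_le:
  fixes x y :: real
  shows "\<bar>sin x - sin y\<bar> \<le> \<bar>x - y\<bar>" "\<bar>cos x - cos y\<bar> \<le> \<bar>x - y\<bar>"
proof -
  obtain \<xi> where "sin x - sin y = cos \<xi> * (x - y)"
    using mvt_closed_segment[of sin cos y x] DERIV_sin by blast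
  then show "\<bar>sin x - sin y\<bar> \<le> \<bar>x - y\<bar>"
    using mult_right_mono[OF abs_cos_le_one[of \<xi>], of "\<bar>x - y\<bar>"] by (simp add: abs_mult)
  obtain \<xi> where "cos x - cos y = - sin \<xi> * (x - y)"
    using mvt_closed_segment[of cos "\<lambda>x. - sin x" y x] DERIV_cos by blast
  then show "\<bar>cos x - cos y\<bar> \<le> \<bar>x - y\<bar>"
    using mult_right_mono[OF abs_sin_le_one[of \<xi>], of "\<bar>x - y\<bar>"] by (simp add: abs_mult)
qed

text \<open>
  The substitution \<open>u = r sin \<theta>\<close>, \<open>u' = \<kappa> r cos \<theta>\<close> with \<open>\<mu> = \<kappa>\<^sup>2\<close>: this scaling makes \<open>\<theta>'\<close> proportional
  to \<open>\<kappa>\<close>, so \<open>\<theta> l\<close> runs from \<open>\<theta> 0\<close> to infinity as \<open>\<kappa>\<close> does from \<open>0\<close>.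
\<close>

definition pruefer_rhs :: "(real \<Rightarrow> real) \<Rightarrow> (real \<Rightarrow> real) \<Rightarrow> real \<Rightarrow> real \<Rightarrow> real \<Rightarrow> real" where
  "pruefer_rhs M N t x \<theta> = (cos \<theta>)\<^sup>2 + M x * (max 0 (sin \<theta>))\<^sup>2 + t * N x * (max 0 (- sin \<theta>))\<^sup>2"

lemma abs_square_diff_le:
  fixes p q :: real
  assumes "\<bar>p\<bar> \<le> 1" "\<bar>q\<bar> \<le> 1" "\<bar>p - q\<bar> \<le> D"
  shows "\<bar>p\<^sup>2 - q\<^sup>2\<bar> \<le> 2 * D"
proof -
  have "\<bar>p\<^sup>2 - q\<^sup>2\<bar> = \<bar>p + q\<bar> * \<bar>p - q\<bar>" by (simp add: power2_eq_square abs_mult[symmetric] algebra_simps)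
  also have "\<dots> \<le> 2 * D" using assms by (intro mult_mono) auto
  finally show ?thesis .
qed

lemma pruefer_rhs_lipschitz:
  assumes M: "bounded_weight a b M" and N: "bounded_weight a b N" and "0 < a" "0 < t"
  shows "\<bar>pruefer_rhs M N t s x - pruefer_rhs M N t s y\<bar> \<le> 2 * (1 + b + t * b) * \<bar>x - y\<bar>"
proof -
  have w: "0 \<le> M s" "M s \<le> b" "0 \<le> N s" "N s \<le> b"
    using M N \<open>0 < a\<close> by (auto simp: bounded_weight_def intro: order_trans[OF less_imp_le])
  let ?D = "\<bar>x - y\<bar>"
  have sin: "\<bar>max 0 (sin x) - max 0 (sin y)\<bar> \<le> ?D" "\<bar>max 0 (- sin x) - max 0 (- sin y)\<bar> \<le> ?D"
    using abs_sin_cos_diff_le(1)[of x y] by (auto simp: max_def abs_if split: if_splits)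
  have bnd: "\<bar>max 0 (sin z)\<bar> \<le> 1" "\<bar>max 0 (- sin z)\<bar> \<le> 1" for z :: real
    using sin_le_one[of z] sin_ge_minus_one[of z] by (auto simp: max_def)
  have 1: "\<bar>(cos x)\<^sup>2 - (cos y)\<^sup>2\<bar> \<le> 2 * ?D"
    by (rule abs_square_diff_le) (auto simp: abs_sin_cos_diff_le)
  have 2: "\<bar>M s * ((max 0 (sin x))\<^sup>2 - (max 0 (sin y))\<^sup>2)\<bar> \<le> b * (2 * ?D)"
    unfolding abs_mult using w by (intro mult_mono abs_square_diff_le bnd sin) auto
  have 3: "\<bar>t * N s * ((max 0 (- sin x))\<^sup>2 - (max 0 (- sin y))\<^sup>2)\<bar> \<le> (t * b) * (2 * ?D)"
    unfolding abs_mult using w \<open>0 < t\<close>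
    by (intro mult_mono[of "\<bar>t\<bar> * \<bar>N s\<bar>"] abs_square_diff_le bnd sin) auto
  have "pruefer_rhs M N t s x - pruefer_rhs M N t s y
    = ((cos x)\<^sup>2 - (cos y)\<^sup>2) + M s * ((max 0 (sin x))\<^sup>2 - (max 0 (sin y))\<^sup>2)
      + t * N s * ((max 0 (- sin x))\<^sup>2 - (max 0 (- sin y))\<^sup>2)"
    by (simp add: pruefer_rhs_def algebra_simps)
  also have "\<bar>\<dots>\<bar> \<le> 2 * ?D + b * (2 * ?D) + (t * b) * (2 * ?D)"
    by (intro order_trans[OF abs_triangle_ineq] add_mono 1 2 3)
  finally show ?thesis by (simp add: algebra_simps)
qed

text \<open>The squares of the cosine and of the two parts of the sine sum to 1, so the right-hand
  side is a convex combination of \<open>1\<close>, \<open>M s\<close> and \<open>t * N s\<close>.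
  The positive lower bound makes the angle strictly increasing.\<close>

lemma pruefer_rhs_bounds:
  assumes M: "bounded_weight a b M" and N: "bounded_weight a b N" and "0 < a" "0 < t"
  shows "min 1 (min a (t * a)) \<le> pruefer_rhs M N t s x" "\<bar>pruefer_rhs M N t s x\<bar> \<le> 1 + b + t * b"
proof -
  have w: "a \<le> M s" "M s \<le> b" "a \<le> N s" "N s \<le> b"
    using M N by (auto simp: bounded_weight_def)
  define g where "g = min 1 (min a (t * a))"
  have g: "g \<le> 1" "g \<le> M s" "g \<le> t * N s" "0 < g"
  proof -
    have "t * a \<le> t * N s" using w \<open>0 < t\<close> by simp
    then show "g \<le> 1" "g \<le> M s" "g \<le> t * N s" unfolding g_def using w by linarith+
    show "0 < g" using \<open>0 < a\<close> \<open>0 < t\<close> by (simp add: g_def)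
  qed
  have eq: "(cos x)\<^sup>2 + (max 0 (sin x))\<^sup>2 + (max 0 (- sin x))\<^sup>2 = 1"
    by (cases "0 \<le> sin x") (auto simp: max_def)
  have "g * ((cos x)\<^sup>2 + (max 0 (sin x))\<^sup>2 + (max 0 (- sin x))\<^sup>2) \<le> pruefer_rhs M N t s x"
    unfolding pruefer_rhs_def distrib_left
    using mult_right_mono[OF g(1), of "(cos x)\<^sup>2"] mult_right_mono[OF g(2), of "(max 0 (sin x))\<^sup>2"]
      mult_right_mono[OF g(3), of "(max 0 (- sin x))\<^sup>2"] by simp
  then show lower: "min 1 (min a (t * a)) \<le> pruefer_rhs M N t s x" unfolding eq g_def by simp
  have b0: "0 \<le> b" using w \<open>0 < a\<close> by linarith
  have le1: "(cos x)\<^sup>2 \<le> 1" "(max 0 (sin x))\<^sup>2 \<le> 1" "(max 0 (- sin x))\<^sup>2 \<le> 1"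
    using eq zero_le_power2[of "cos x"] zero_le_power2[of "max 0 (sin x)"] zero_le_power2[of "max 0 (- sin x)"]
    by linarith+
  have "M s * (max 0 (sin x))\<^sup>2 \<le> b * 1" "t * N s * (max 0 (- sin x))\<^sup>2 \<le> (t * b) * 1"
    using w b0 \<open>0 < t\<close> \<open>0 < a\<close> by (intro mult_mono le1; simp)+
  then have "pruefer_rhs M N t s x \<le> 1 + b + t * b" unfolding pruefer_rhs_def using le1(1) by linarith
  moreover have "0 \<le> pruefer_rhs M N t s x" using lower g(4) unfolding g_def by linarith
  ultimately show "\<bar>pruefer_rhs M N t s x\<bar> \<le> 1 + b + t * b" by simp
qed

lemma pruefer_rhs_abs_integrable:
  assumes M: "bounded_weight a b M" and N: "bounded_weight a b N" and h: "continuous_on {c..d} h"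
  shows "(\<lambda>s. pruefer_rhs M N t s (h s)) absolutely_integrable_on {c..d}"
proof -
  have "(\<lambda>s. (cos (h s))\<^sup>2) absolutely_integrable_on {c..d}"
    using absolutely_integrable_continuous[of c d "\<lambda>s. (cos (h s))\<^sup>2"] h by (simp add: continuous_intros)
  then have "(\<lambda>s. (cos (h s))\<^sup>2 + M s * (max 0 (sin (h s)))\<^sup>2 + N s * (t * (max 0 (- sin (h s)))\<^sup>2)) absolutely_integrable_on {c..d}"
    by (intro set_integral_add abs_integrable_mult_cont bounded_weight_abs_integrable[OF M]
        bounded_weight_abs_integrable[OF N] continuous_intros h)
  then show ?thesis by (simp add: pruefer_rhs_def mult_ac)
qed

text \<open>Shooting in \<open>\<kappa>\<close>: at \<open>\<kappa> = 0\<close> the angle stays at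
  \<open>\<theta>0\<close>, for large \<open>\<kappa>\<close> it passes the target, and it depends
  continuously on \<open>\<kappa>\<close>.\<close>

lemma pruefer_angle_exists:
  assumes M: "bounded_weight a b M" and N: "bounded_weight a b N" and "0 < a" "0 < t" "0 < l"
  shows "\<exists>\<kappa>>0. \<exists>\<theta>. ac_on 0 l \<theta> (\<lambda>s. \<kappa> * pruefer_rhs M N t s (\<theta> s)) \<and> \<theta> 0 = \<theta>0 \<and> \<theta> l = \<theta>0 + real (Suc k) * pi"
proof -
  have "0 \<le> b" using M \<open>0 < a\<close> by (auto simp: bounded_weight_def intro: order_trans[OF less_imp_le])
  define \<Gamma> where "\<Gamma> = 1 + b + t * b"
  have \<Gamma>: "0 < \<Gamma>" using \<open>0 \<le> b\<close> \<open>0 < t\<close> by (simp add: \<Gamma>_def add_pos_nonneg)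
  define g where "g = min 1 (min a (t * a))"
  have g: "0 < g" using \<open>0 < a\<close> \<open>0 < t\<close> by (simp add: g_def)
  note lip = pruefer_rhs_lipschitz[OF M N \<open>0 < a\<close> \<open>0 < t\<close>, folded \<Gamma>_def]
    and lower = pruefer_rhs_bounds(1)[OF M N \<open>0 < a\<close> \<open>0 < t\<close>, folded g_def]
    and upper = pruefer_rhs_bounds(2)[OF M N \<open>0 < a\<close> \<open>0 < t\<close>, folded \<Gamma>_def]
  let ?P = "\<lambda>\<kappa> \<theta>. ac_on 0 l \<theta> (\<lambda>s. \<kappa> * pruefer_rhs M N t s (\<theta> s)) \<and> \<theta> 0 = \<theta>0"
  have ex: "\<exists>\<theta>. ?P \<kappa> \<theta>" for \<kappa>
  proof (rule caratheodory_existence[OF \<open>0 < l\<close>, of "\<bar>\<kappa>\<bar> * (2 * \<Gamma>)"])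
    show "0 \<le> \<bar>\<kappa>\<bar> * (2 * \<Gamma>)" using \<Gamma> by simp
    show "(\<lambda>s. \<kappa> * pruefer_rhs M N t s (h s)) absolutely_integrable_on {0..l}" if "continuous_on {0..l} h" for h
      using pruefer_rhs_abs_integrable[OF M N that] by (intro set_integrable_mult_right) auto
    show "\<bar>\<kappa> * pruefer_rhs M N t s x - \<kappa> * pruefer_rhs M N t s y\<bar> \<le> \<bar>\<kappa>\<bar> * (2 * \<Gamma>) * \<bar>x - y\<bar>" for s x y
      using mult_left_mono[OF lip[of s x y], of "\<bar>\<kappa>\<bar>"] by (simp add: abs_mult[symmetric] algebra_simps)
  qed
  \<comment> \<open>The selection needs no care: the Lipschitz estimate \<open>cont\<close> holds
    for whichever solutions are selected.\<close>
  define \<Theta> where "\<Theta> = (\<lambda>\<kappa>. SOME \<theta>. ?P \<kappa> \<theta>)"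
  have \<Theta>: "?P \<kappa> (\<Theta> \<kappa>)" for \<kappa> unfolding \<Theta>_def by (rule someI_ex[OF ex])
  \<comment> \<open>At this parameter the speed of the angle is at least \<open>K * g\<close>, so
    over length \<open>l\<close> it gains at least \<open>(k + 1) * pi\<close>.\<close>
  define K where "K = real (Suc k) * pi / (g * l)"
  have K: "0 \<le> K" using g \<open>0 < l\<close> by (simp add: K_def)
  define Q where "Q = sqrt (l * exp ((2 * (K * (2 * \<Gamma>)) + 1) * l))"
  have Q: "0 \<le> Q" using \<open>0 < l\<close> by (simp add: Q_def)
  have cont: "\<bar>\<Theta> \<kappa> l - \<Theta> \<nu> l\<bar> \<le> (\<Gamma> * Q) * \<bar>\<kappa> - \<nu>\<bar>" if \<kappa>: "\<kappa> \<in> {0..K}" and \<nu>: "\<nu> \<in> {0..K}" for \<kappa> \<nu>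
  proof -
    have "\<bar>\<Theta> \<kappa> l + - 1 * \<Theta> \<nu> l\<bar> \<le> (\<bar>\<kappa> - \<nu>\<bar> * \<Gamma>) * Q"
      unfolding Q_def
    proof (rule perturbed_ode_bound[OF ac_on_add[OF conjunct1[OF \<Theta>[of \<kappa>]] ac_on_cmult[OF conjunct1[OF \<Theta>[of \<nu>]]]] \<open>0 < l\<close>])
      show "\<Theta> \<kappa> 0 + - 1 * \<Theta> \<nu> 0 = 0" using \<Theta> by simp
      show "0 \<le> K * (2 * \<Gamma>)" "0 \<le> \<bar>\<kappa> - \<nu>\<bar> * \<Gamma>" using K \<Gamma> by auto
      fix s
      let ?f = "pruefer_rhs M N t s (\<Theta> \<kappa> s)" and ?h = "pruefer_rhs M N t s (\<Theta> \<nu> s)"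
      have "\<kappa> * ?f + - 1 * (\<nu> * ?h) = \<nu> * (?f - ?h) + (\<kappa> - \<nu>) * ?f" by (simp add: algebra_simps)
      also have "\<bar>\<dots>\<bar> \<le> \<bar>\<nu>\<bar> * \<bar>?f - ?h\<bar> + \<bar>\<kappa> - \<nu>\<bar> * \<bar>?f\<bar>"
        unfolding abs_mult[symmetric] by (rule abs_triangle_ineq)
      also have "\<dots> \<le> K * (2 * \<Gamma> * \<bar>\<Theta> \<kappa> s - \<Theta> \<nu> s\<bar>) + \<bar>\<kappa> - \<nu>\<bar> * \<Gamma>"
        using \<nu> K by (intro add_mono mult_mono lip upper) auto
      finally show "\<bar>\<kappa> * ?f + - 1 * (\<nu> * ?h)\<bar> \<le> K * (2 * \<Gamma>) * \<bar>\<Theta> \<kappa> s + - 1 * \<Theta> \<nu> s\<bar> + \<bar>\<kappa> - \<nu>\<bar> * \<Gamma>"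
        by simp
      have "\<bar>\<kappa> * ?f\<bar> \<le> K * \<Gamma>" "\<bar>\<nu> * ?h\<bar> \<le> K * \<Gamma>"
        unfolding abs_mult using \<kappa> \<nu> K upper by (auto intro!: mult_mono)
      then show "\<bar>\<kappa> * ?f + - 1 * (\<nu> * ?h)\<bar> \<le> K * \<Gamma> + K * \<Gamma>" by linarith
    qed
    then show ?thesis by (simp add: mult_ac)
  qed
  have "continuous_on {0..K} (\<lambda>\<kappa>. \<Theta> \<kappa> l)"
  proof (rule lipschitz_on_continuous_on[of "\<Gamma> * Q"], rule lipschitz_onI)
    show "dist (\<Theta> \<kappa> l) (\<Theta> \<nu> l) \<le> \<Gamma> * Q * dist \<kappa> \<nu>" if "\<kappa> \<in> {0..K}" "\<nu> \<in> {0..K}" for \<kappa> \<nu>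
      using cont[OF that] by (simp add: dist_real_def)
    show "0 \<le> \<Gamma> * Q" using \<Gamma> Q by simp
  qed
  moreover have zero: "\<Theta> 0 l = \<theta>0"
    using ac_on_diff[OF conjunct1[OF \<Theta>[of 0]], of 0 l] \<Theta>[of 0] \<open>0 < l\<close> by simp
  moreover have "\<theta>0 + real (Suc k) * pi \<le> \<Theta> K l"
  proof -
    have lin: "ac_on 0 l (\<lambda>x. (- (K * g)) * x) (\<lambda>x. - (K * g))"
      by (rule ac_on_C1) (auto intro!: derivative_eq_intros)
    have "\<Theta> K 0 + (- (K * g)) * 0 \<le> \<Theta> K l + (- (K * g)) * l"
      by (rule ac_on_mono[OF ac_on_add[OF conjunct1[OF \<Theta>[of K]] lin]])
        (use lower K \<open>0 < l\<close> in \<open>auto intro!: mult_left_mono\<close>)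
    moreover have "K * g * l = real (Suc k) * pi" using g \<open>0 < l\<close> by (simp add: K_def)
    ultimately show ?thesis using \<Theta>[of K] by simp
  qed
  ultimately obtain \<kappa> where \<kappa>: "0 \<le> \<kappa>" "\<kappa> \<le> K" "\<Theta> \<kappa> l = \<theta>0 + real (Suc k) * pi"
    using IVT'[of "\<lambda>\<kappa>. \<Theta> \<kappa> l" 0 "\<theta>0 + real (Suc k) * pi" K] K by auto
  have "\<kappa> \<noteq> 0" using \<kappa>(3) zero by (auto simp: add_pos_nonneg)
  then show ?thesis using \<kappa> \<Theta>[of \<kappa>] by (intro exI[of _ \<kappa>] conjI exI[of _ "\<Theta> \<kappa>"]) auto
qed

text \<open>By strict monotonicity and the intermediate value theorem, \<open>\<psi>\<close> maps
  the zeros bijectively onto \<open>pi, ..., k * pi\<close>; the multiples 0 and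
  \<open>(k + 1) * pi\<close> are attained only at the endpoints.\<close>

lemma card_sin_zeros:
  fixes \<psi> :: "real \<Rightarrow> real"
  assumes "0 < l" and c: "continuous_on {0..l} \<psi>" and mono: "strict_mono_on {0..l} \<psi>"
    and \<psi>: "\<psi> 0 = 0" "\<psi> l = real (Suc k) * pi"
  shows "finite {x \<in> {0<..<l}. sin (\<psi> x) = 0}" "card {x \<in> {0<..<l}. sin (\<psi> x) = 0} = k"
proof -
  let ?Z = "{x \<in> {0<..<l}. sin (\<psi> x) = 0}" and ?J = "(\<lambda>j. real j * pi) ` {1..k}"
  have inj: "inj_on \<psi> ?Z"
    by (rule inj_on_subset[OF strict_mono_on_imp_inj_on[OF mono]]) auto
  have im: "\<psi> ` ?Z = ?J"
  proof (intro set_eqI iffI)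
    fix y assume "y \<in> \<psi> ` ?Z"
    then obtain x where x: "y = \<psi> x" "0 < x" "x < l" "sin (\<psi> x) = 0" by auto
    obtain i :: int where i: "\<psi> x = of_int i * pi" using x(4) sin_zero_iff_int2 by blast
    have "\<psi> 0 < \<psi> x" "\<psi> x < \<psi> l" using x \<open>0 < l\<close> by (auto intro!: strict_mono_onD[OF mono])
    then have "0 < of_int i * pi" "of_int i * pi < real (Suc k) * pi" using \<psi> i by auto
    then have "0 < real_of_int i" "real_of_int i < real (Suc k)"
      by (auto simp: zero_less_mult_iff dest: mult_right_less_imp_less)
    then have "0 < i" "i < int (Suc k)" by linarith+
    then have "nat i \<in> {1..k}" "real (nat i) = of_int i" by auto
    then show "y \<in> ?J" unfolding x(1) i by (intro image_eqI[of _ _ "nat i"]) auto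
  next
    fix y assume "y \<in> ?J"
    then obtain j where j: "1 \<le> j" "j \<le> k" "y = real j * pi" by auto
    have y: "0 < y" "y < real (Suc k) * pi" using j by (auto simp del: of_nat_Suc intro!: mult_strict_right_mono)
    then obtain x where x: "0 \<le> x" "x \<le> l" "\<psi> x = y"
      using IVT'[of \<psi> 0 y l] c \<psi> \<open>0 < l\<close> by auto
    have "x \<noteq> 0" "x \<noteq> l" using x(3) y \<psi> by auto
    then show "y \<in> \<psi> ` ?Z" using x j by (intro image_eqI[of _ _ x]) auto
  qed
  have injJ: "inj_on (\<lambda>j. real j * pi) {1..k}" by (auto simp: inj_on_def)
  show "finite ?Z" using im inj finite_imageD[of \<psi> ?Z] by simp
  show "card ?Z = k" using card_image[OF inj] im card_image[OF injJ] by simp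
qed

text \<open>Once the angle is known, the logarithm of the amplitude is an explicit integral, so no
  second differential equation has to be solved. The point on the curve has first coordinate
  \<open>\<kappa>\<^sup>2\<close>.\<close>

lemma fucik_curve_exists:
  assumes M: "bounded_weight a b M" and N: "bounded_weight a b N" and "0 < a" "0 < t" "0 < l" "s \<in> {1, - 1}"
  shows "\<exists>\<mu>. (\<mu>, t * \<mu>) \<in> fucik_curve l M N k s"
proof -
  have b0: "0 \<le> b" using M \<open>0 < a\<close> by (auto simp: bounded_weight_def intro: order_trans[OF less_imp_le])
  \<comment> \<open>Starting at 0 or pi makes \<open>u\<close> vanish at the origin and gives its
    slope the sign of \<open>cos \<theta>0 = s\<close>.\<close>
  define \<theta>0 where "\<theta>0 = (if s = 1 then 0 else pi)"
  have \<theta>0: "sin \<theta>0 = 0" "cos \<theta>0 = s" using \<open>s \<in> {1, - 1}\<close> by (auto simp: \<theta>0_def)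
  obtain \<kappa> \<theta> where \<kappa>: "0 < \<kappa>" and \<theta>: "ac_on 0 l \<theta> (\<lambda>x. \<kappa> * pruefer_rhs M N t x (\<theta> x))"
    and ends: "\<theta> 0 = \<theta>0" "\<theta> l = \<theta>0 + real (Suc k) * pi"
    using pruefer_angle_exists[OF M N \<open>0 < a\<close> \<open>0 < t\<close> \<open>0 < l\<close>] by blast
  define \<Gamma> where "\<Gamma> = 1 + b + t * b"
  note upper = pruefer_rhs_bounds(2)[OF M N \<open>0 < a\<close> \<open>0 < t\<close>, folded \<Gamma>_def]
  have c\<theta>: "continuous_on {0..l} \<theta>" by (rule ac_on_continuous[OF \<theta>])
  define \<theta>' where "\<theta>' = (\<lambda>x. \<kappa> * pruefer_rhs M N t x (\<theta> x))"
  have ac\<theta>: "ac_on 0 l \<theta> \<theta>'" using \<theta> by (simp add: \<theta>'_def)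
  have \<theta>'B: "\<bar>\<theta>' x\<bar> \<le> \<kappa> * \<Gamma>" for x
    using mult_left_mono[OF upper, of \<kappa>] \<kappa> by (simp add: \<theta>'_def abs_mult)
  define h where "h = (\<lambda>x. M x * max 0 (sin (\<theta> x)) - t * N x * max 0 (- sin (\<theta> x)))"
  \<comment> \<open>The derivative of the logarithm of the amplitude, solved from the requirement
    that the derivative of \<open>\<rho> * sin \<theta>\<close> be
    \<open>\<kappa> * \<rho> * cos \<theta>\<close>. The function \<open>h\<close> is the jump
    nonlinearity divided by \<open>\<kappa>\<^sup>2 * \<rho>\<close>.\<close>
  define R' where "R' = (\<lambda>x. \<kappa> * (cos (\<theta> x) * (sin (\<theta> x) - h x)))"
  have hi: "h absolutely_integrable_on {0..l}"
  proof -
    have "(\<lambda>x. M x * max 0 (sin (\<theta> x)) - N x * (t * max 0 (- sin (\<theta> x)))) absolutely_integrable_on {0..l}"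
      by (intro set_integral_diff abs_integrable_mult_cont bounded_weight_abs_integrable[OF M]
          bounded_weight_abs_integrable[OF N] continuous_intros c\<theta>)
    then show ?thesis by (simp add: h_def mult_ac)
  qed
  have hB: "\<bar>h x\<bar> \<le> \<Gamma>" for x
  proof -
    have w: "0 \<le> M x" "M x \<le> b" "0 \<le> N x" "N x \<le> b"
      using M N \<open>0 < a\<close> by (auto simp: bounded_weight_def intro: order_trans[OF less_imp_le])
    have "M x * max 0 (sin (\<theta> x)) \<le> b * 1" "t * N x * max 0 (- sin (\<theta> x)) \<le> (t * b) * 1"
      using w b0 \<open>0 < t\<close> sin_le_one[of "\<theta> x"] sin_ge_minus_one[of "\<theta> x"] by (intro mult_mono; auto)+
    moreover have "0 \<le> M x * max 0 (sin (\<theta> x))" "0 \<le> t * N x * max 0 (- sin (\<theta> x))"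
      using w \<open>0 < t\<close> by auto
    moreover have "0 \<le> t * b" using b0 \<open>0 < t\<close> by simp
    ultimately show ?thesis using b0 unfolding h_def \<Gamma>_def by linarith
  qed
  have R'i: "R' absolutely_integrable_on {0..l}"
  proof -
    have "(\<lambda>x. (\<kappa> * cos (\<theta> x)) * (sin (\<theta> x) - h x)) absolutely_integrable_on {0..l}"
      using absolutely_integrable_continuous[of 0 l "\<lambda>x. sin (\<theta> x)"] c\<theta>
      by (intro abs_integrable_cont_mult set_integral_diff hi continuous_intros c\<theta>) (simp add: continuous_intros)
    then show ?thesis by (simp add: R'_def mult_ac)
  qed
  have R'B: "\<bar>R' x\<bar> \<le> \<kappa> * (1 * (1 + \<Gamma>))" for x
  proof -
    have "\<bar>sin (\<theta> x) - h x\<bar> \<le> 1 + \<Gamma>" using hB[of x] abs_sin_le_one[of "\<theta> x"] by linarith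
    then show ?thesis unfolding R'_def abs_mult using \<kappa> by (intro mult_mono) auto
  qed
  define R where "R = (\<lambda>x. 0 + integral {0..x} R')"
  have R: "ac_on 0 l R R'" unfolding R_def by (rule ac_on_indefinite_integral[OF R'i])
  obtain BR where BR: "\<And>x. x \<in> {0..l} \<Longrightarrow> \<bar>R x\<bar> \<le> BR"
    using continuous_bounded_Icc[OF ac_on_continuous[OF R]] by blast
  \<comment> \<open>The chain rule needs a Lipschitz derivative, which the exponential has on the
    bounded range of \<open>R\<close>.\<close>
  have exp_lip: "\<bar>exp u - exp v\<bar> \<le> exp BR * \<bar>u - v\<bar>" if uv: "u \<in> {- BR..BR}" "v \<in> {- BR..BR}" for u v
  proof -
    obtain \<xi> where \<xi>: "\<xi> \<in> closed_segment v u" "exp u - exp v = exp \<xi> * (u - v)"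
      using mvt_closed_segment[of exp exp v u] DERIV_exp by blast
    have "\<xi> \<le> BR" using \<xi>(1) uv by (auto simp: closed_segment_eq_real_ivl split: if_splits)
    then show ?thesis unfolding \<xi>(2) abs_mult by (intro mult_right_mono) auto
  qed
  define \<rho> where "\<rho> = (\<lambda>x. exp (R x))"
  have \<rho>: "ac_on 0 l \<rho> (\<lambda>x. \<rho> x * R' x)"
    unfolding \<rho>_def
    by (rule ac_on_chain[OF R R'B DERIV_exp, of "{- BR..BR}" "exp BR"]) (use BR exp_lip in \<open>auto simp: abs_le_iff minus_le_iff\<close>)
  have S: "ac_on 0 l (\<lambda>x. sin (\<theta> x)) (\<lambda>x. cos (\<theta> x) * \<theta>' x)"
    by (rule ac_on_chain[OF ac\<theta> \<theta>'B DERIV_sin, of UNIV 1]) (auto simp: abs_sin_cos_diff_le)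
  have C: "ac_on 0 l (\<lambda>x. cos (\<theta> x)) (\<lambda>x. - sin (\<theta> x) * \<theta>' x)"
    by (rule ac_on_chain[OF ac\<theta> \<theta>'B DERIV_cos, of UNIV 1]) (auto simp: abs_sin_cos_diff_le abs_minus_commute)
  have G0: "0 \<le> \<kappa> * \<Gamma>" using \<theta>'B[of 0] by linarith
  have SB: "\<bar>cos (\<theta> x) * \<theta>' x\<bar> \<le> 1 * (\<kappa> * \<Gamma>)" "\<bar>- sin (\<theta> x) * \<theta>' x\<bar> \<le> 1 * (\<kappa> * \<Gamma>)" for x
    unfolding abs_mult abs_minus using \<theta>'B[of x] G0 by (intro mult_mono; simp)+
  define u where "u = (\<lambda>x. \<rho> x * sin (\<theta> x))"
  define p where "p = (\<lambda>x. \<kappa> * (\<rho> x * cos (\<theta> x)))"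
  have rhs: "pruefer_rhs M N t x (\<theta> x) = (cos (\<theta> x))\<^sup>2 + h x * sin (\<theta> x)" for x
    by (cases "0 \<le> sin (\<theta> x)") (auto simp: pruefer_rhs_def h_def power2_eq_square max_def)
  have cs: "sin (\<theta> x) * sin (\<theta> x) + cos (\<theta> x) * cos (\<theta> x) = 1" for x
    using sin_cos_squared_add[of "\<theta> x"] by (simp add: power2_eq_square)
  have acu: "ac_on 0 l u p"
    unfolding u_def
  proof (rule ac_on_cong[OF ac_on_mult[OF \<rho> S SB(1)]])
    fix x
    have "\<rho> x * R' x * sin (\<theta> x) + \<rho> x * (cos (\<theta> x) * \<theta>' x)
      = \<kappa> * \<rho> x * cos (\<theta> x) * (sin (\<theta> x) * sin (\<theta> x) + cos (\<theta> x) * cos (\<theta> x))"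
      by (simp only: R'_def \<theta>'_def rhs power2_eq_square algebra_simps)
    also have "\<dots> = p x" unfolding cs p_def by simp
    finally show "\<rho> x * R' x * sin (\<theta> x) + \<rho> x * (cos (\<theta> x) * \<theta>' x) = p x" .
  qed simp
  have acp: "ac_on 0 l p (\<lambda>x. - jump_rhs M N (\<kappa>\<^sup>2) (t * \<kappa>\<^sup>2) x (u x))"
    unfolding p_def
  proof (rule ac_on_cong[OF ac_on_cmult[OF ac_on_mult[OF \<rho> C SB(2)]]])
    fix x
    have "\<kappa> * (\<rho> x * R' x * cos (\<theta> x) + \<rho> x * (- sin (\<theta> x) * \<theta>' x))
      = - (\<kappa>\<^sup>2 * \<rho> x * h x * (sin (\<theta> x) * sin (\<theta> x) + cos (\<theta> x) * cos (\<theta> x)))"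
      by (simp only: R'_def \<theta>'_def rhs power2_eq_square algebra_simps)
    also have "\<dots> = - (\<kappa>\<^sup>2 * \<rho> x * h x)" unfolding cs by simp
    also have "\<kappa>\<^sup>2 * \<rho> x * h x = jump_rhs M N (\<kappa>\<^sup>2) (t * \<kappa>\<^sup>2) x (u x)"
    proof -
      have "0 < \<rho> x" by (simp add: \<rho>_def)
      then have "pos_part (u x) = \<rho> x * max 0 (sin (\<theta> x))" "neg_part (u x) = \<rho> x * max 0 (- sin (\<theta> x))"
        by (auto simp: u_def pos_part_def neg_part_def max_def zero_le_mult_iff mult_le_0_iff)
      then show ?thesis by (simp add: jump_rhs_def h_def algebra_simps)
    qed
    finally show "\<kappa> * (\<rho> x * R' x * cos (\<theta> x) + \<rho> x * (- sin (\<theta> x) * \<theta>' x))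
      = - jump_rhs M N (\<kappa>\<^sup>2) (t * \<kappa>\<^sup>2) x (u x)" .
  qed simp
  have sin_eq: "sin (\<theta> x) = s * sin (\<theta> x - \<theta>0)" for x
    using \<theta>0 \<open>s \<in> {1, - 1}\<close> by (auto simp: sin_diff)
  have zero_iff: "u x = 0 \<longleftrightarrow> sin (\<theta> x - \<theta>0) = 0" for x
    using sin_eq[of x] \<open>s \<in> {1, - 1}\<close> by (auto simp: u_def \<rho>_def)
  have "sin (real (Suc k) * pi) = 0" by (rule sin_npi)
  then have u0: "u 0 = 0" "u l = 0" using zero_iff ends by auto
  have reg: "regular_solution l M N (\<kappa>\<^sup>2) (t * \<kappa>\<^sup>2) u p"
    unfolding regular_solution_def using acu acp u0 by simp
  have weak: "weak_solution l M N (\<kappa>\<^sup>2) (t * \<kappa>\<^sup>2) u"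
    by (rule regular_weak_solution[OF M N _ _ _ \<open>0 < l\<close> reg]) (use \<open>0 < a\<close> \<open>0 < t\<close> in auto)
  have mono: "strict_mono_on {0..l} (\<lambda>x. \<theta> x - \<theta>0)"
  proof (rule strict_mono_onI)
    fix x y assume xy: "x \<in> {0..l}" "y \<in> {0..l}" "x < y"
    define g where "g = \<kappa> * min 1 (min a (t * a))"
    have g: "0 < g" using \<kappa> \<open>0 < a\<close> \<open>0 < t\<close> by (simp add: g_def)
    have lin: "ac_on 0 l (\<lambda>x. (- g) * x) (\<lambda>x. - g)"
      by (rule ac_on_C1) (auto intro!: derivative_eq_intros)
    \<comment> \<open>Strict growth is obtained by showing that the angle minus a line of positive
      slope \<open>g\<close> is still nondecreasing.\<close>
    have "\<theta> x + (- g) * x \<le> \<theta> y + (- g) * y"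
      by (rule ac_on_mono[OF ac_on_add[OF ac\<theta> lin]])
        (use xy \<kappa> pruefer_rhs_bounds(1)[OF M N \<open>0 < a\<close> \<open>0 < t\<close>] in \<open>auto simp: g_def \<theta>'_def intro!: mult_left_mono\<close>)
    moreover have "g * x < g * y" using g xy(3) by simp
    ultimately show "\<theta> x - \<theta>0 < \<theta> y - \<theta>0" by simp
  qed
  have c\<psi>: "continuous_on {0..l} (\<lambda>x. \<theta> x - \<theta>0)" by (intro continuous_intros c\<theta>)
  have Z: "finite {x \<in> {0<..<l}. u x = 0}" "card {x \<in> {0<..<l}. u x = 0} = k"
    unfolding zero_iff by (rule card_sin_zeros[OF \<open>0 < l\<close> c\<psi> mono]; use ends in simp)+
  have "\<exists>x\<in>{0..l}. u x \<noteq> 0"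
  proof (rule ccontr)
    assume "\<not> ?thesis"
    \<comment> \<open>A trivial solution would have infinitely many zeros, contrary to the count
      just made.\<close>
    then have "{x \<in> {0<..<l}. u x = 0} = {0<..<l}" by auto
    then show False using Z(1) \<open>0 < l\<close> by (simp add: infinite_Ioo)
  qed
  moreover have "(u has_real_derivative p 0) (at 0 within {0..l})"
    by (rule ac_on_has_derivative[OF acu ac_on_continuous[OF acp]]) (use \<open>0 < l\<close> in auto)
  moreover have "0 < s * p 0"
    using \<kappa> \<theta>0 ends \<open>s \<in> {1, - 1}\<close> by (auto simp: p_def \<rho>_def)
  ultimately have "(\<kappa>\<^sup>2, t * \<kappa>\<^sup>2) \<in> fucik_curve l M N k s"
    unfolding fucik_curve_def using weak Z \<open>0 < t\<close> by auto
  then show ?thesis by blast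
qed

section \<open>The convergence rate\<close>

text \<open>This justifies the definite description. The curve for the given weights is first
  identified with the one for pointwise bounded representatives, to which existence and uniqueness
  apply.\<close>

lemma fucik_lambda_mem:
  assumes M: "bounded_weight a b M" and N: "bounded_weight a b N" and "0 < a" "0 < t" "0 < l" "s \<in> {1, - 1}" "1 \<le> k"
    and eq: "fucik_curve l (weight l m \<epsilon>) (weight l n \<epsilon>) k s = fucik_curve l M N k s"
  shows "(fucik_lambda l m n k t \<epsilon> s, t * fucik_lambda l m n k t \<epsilon> s) \<in> fucik_curve l M N k s"
  unfolding fucik_lambda_def eq
proof (rule theI')
  show "\<exists>!\<mu>. (\<mu>, t * \<mu>) \<in> fucik_curve l M N k s"
    using fucik_curve_exists[OF M N assms(3-6)] fucik_curve_unique[OF M N assms(3-7)] by blast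
qed

text \<open>The factor \<open>l\<close> beside \<open>C\<close> matches the scaling of the problem.
  Substituting \<open>x = l * y\<close> reduces to the unit interval with weights of period 1, the
  same bounds and the same \<open>\<epsilon>\<close>, and multiplies eigenvalues by
  \<open>l\<^sup>2\<close>. The difference must therefore scale like the inverse of
  \<open>l\<^sup>2\<close>, whereas \<open>(real k / l) ^ 3\<close> alone carries one power of
  \<open>1 / l\<close> too many.\<close>

theorem theorem1p2:
  fixes a b :: real
  assumes "0 < a" and "a \<le> b"
  shows "\<exists>C::real. \<forall>l>0. \<forall>m n. admissible_weight l a b m \<longrightarrow> admissible_weight l a b n \<longrightarrow>
    (\<forall>k::nat. \<forall>t \<epsilon> s. 1 \<le> k \<longrightarrow> 0 < t \<longrightarrow> 0 < \<epsilon> \<longrightarrow> s \<in> {1, - 1} \<longrightarrow>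
      \<bar>fucik_lambda l m n k t \<epsilon> s - fucik_lambda l m n k t 0 s\<bar>
        \<le> (C * l) * (real k / l) ^ 3 * gamma_fun t * \<epsilon>)"
proof (intro exI[of _ "(2 * sqrt b / a * (2 * sqrt (10 / a)) ^ 3) * (2 * b)"] allI impI)
  fix l :: real and m n :: "real \<Rightarrow> real" and k :: nat and t \<epsilon> s :: real
  assume l: "0 < l" and m: "admissible_weight l a b m" and n: "admissible_weight l a b n"
    and k: "1 \<le> k" and t: "0 < t" and \<epsilon>: "0 < \<epsilon>" and s: "s \<in> {1, - 1}"
  obtain M M0 where M: "bounded_weight a b M" "bounded_weight a b M0"
    "weight l m \<epsilon> \<in> borel_measurable lebesgue" "weight l m 0 \<in> borel_measurable lebesgue"
    "AE x in lebesgue. weight l m \<epsilon> x = M x" "AE x in lebesgue. weight l m 0 x = M0 x"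
    and oscM: "\<And>x y. 0 \<le> x \<Longrightarrow> x \<le> y \<Longrightarrow> \<bar>integral {x..y} (\<lambda>s. M s - M0 s)\<bar> \<le> 2 * b * l * \<epsilon>"
    using admissible_weight_representative[OF m assms l \<epsilon>] by blast
  obtain N N0 where N: "bounded_weight a b N" "bounded_weight a b N0"
    "weight l n \<epsilon> \<in> borel_measurable lebesgue" "weight l n 0 \<in> borel_measurable lebesgue"
    "AE x in lebesgue. weight l n \<epsilon> x = N x" "AE x in lebesgue. weight l n 0 x = N0 x"
    and oscN: "\<And>x y. 0 \<le> x \<Longrightarrow> x \<le> y \<Longrightarrow> \<bar>integral {x..y} (\<lambda>s. N s - N0 s)\<bar> \<le> 2 * b * l * \<epsilon>"
    using admissible_weight_representative[OF n assms l \<epsilon>] by blast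
  have neg: "integral {x..y} (\<lambda>s. g s - f s) = - integral {x..y} (\<lambda>s. f s - g s)" for x y and f g :: "real \<Rightarrow> real"
    by (simp flip: Henstock_Kurzweil_Integration.integral_neg)
  have meas: "M \<in> borel_measurable lebesgue" "M0 \<in> borel_measurable lebesgue"
    "N \<in> borel_measurable lebesgue" "N0 \<in> borel_measurable lebesgue"
    using M(1,2) N(1,2) by (auto simp: bounded_weight_def)
  let ?le = "fucik_lambda l m n k t \<epsilon> s" and ?l0 = "fucik_lambda l m n k t 0 s"
  have ce: "(?le, t * ?le) \<in> fucik_curve l M N k s"
    by (rule fucik_lambda_mem[OF M(1) N(1) \<open>0 < a\<close> t l s k
          fucik_curve_cong_AE[OF M(3) N(3) meas(1,3) M(5) N(5)]])
  have c0: "(?l0, t * ?l0) \<in> fucik_curve l M0 N0 k s"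
    by (rule fucik_lambda_mem[OF M(2) N(2) \<open>0 < a\<close> t l s k
          fucik_curve_cong_AE[OF M(4) N(4) meas(2,4) M(6) N(6)]])
  \<comment> \<open>This is the oscillation bound of both weights: its \<open>2 * b\<close> enters
    the witness for \<open>C\<close>, while its \<open>l\<close> and \<open>\<epsilon>\<close>
    remain explicit.\<close>
  have \<delta>: "0 \<le> 2 * b * l * \<epsilon>" using assms l \<epsilon> by simp
  note bound = fucik_curve_difference_bound[OF _ _ _ _ \<open>0 < a\<close> t l s k _ _ _ _ \<delta>]
  have "?l0 - ?le \<le> (2 * sqrt b / a * (2 * sqrt (10 / a)) ^ 3) * (2 * b * l * \<epsilon>) * (real k / l) ^ 3 * gamma_fun t"
    by (rule bound[OF M(1) N(1) M(2) N(2) ce c0]) (use oscM oscN in auto)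
  moreover have "?le - ?l0 \<le> (2 * sqrt b / a * (2 * sqrt (10 / a)) ^ 3) * (2 * b * l * \<epsilon>) * (real k / l) ^ 3 * gamma_fun t"
    by (rule bound[OF M(2) N(2) M(1) N(1) c0 ce]) (use oscM oscN in \<open>auto simp: neg[of _ _ M] neg[of _ _ N]\<close>)
  ultimately have "\<bar>?le - ?l0\<bar> \<le> (2 * sqrt b / a * (2 * sqrt (10 / a)) ^ 3) * (2 * b * l * \<epsilon>) * (real k / l) ^ 3 * gamma_fun t"
    by linarith
  also have "\<dots> = (2 * sqrt b / a * (2 * sqrt (10 / a)) ^ 3) * (2 * b) * l * (real k / l) ^ 3 * gamma_fun t * \<epsilon>"
    by (simp only: mult_ac)
  finally show "\<bar>?le - ?l0\<bar> \<le> (2 * sqrt b / a * (2 * sqrt (10 / a)) ^ 3) * (2 * b) * l * (real k / l) ^ 3 * gamma_fun t * \<epsilon>" .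
qed

end
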